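(* Let $p\ge1$, let $J\subset\mathbb Z$ be finite, and for each $k\ge1$ let $A^{[k]}=(A^{[k]}_j)_{j\in J}$, $A_j^{[k]}\in\mathbb R^{p\times p}$, be matrix masks that are uniformly bounded in $k$ and $j$. Let $g:\mathbb R\to\mathbb R^p$ be continuous with compact support, and let $V_k$, the window $[\ell_-,\ell_+]$, $D$, $G_f$, $T^{[k]}_\epsilon$ be as in the context. Let $1\le r<D$ and let $P_k\in\mathbb R^{r\times D}$ ($k\ge1$) have full row rank with $\sigma_{\min}(P_k)\ge\gamma>0$ and $\|P_k\|_2\le\Gamma<\infty$ for all $k$. Let $\rho_{\rm ch}$ be the chronological radius of the family $C_{k,\epsilon}=U_k^TT^{[k]}_\epsilon U_{k+1}$ and let $\delta_k$ be the level-$k$ defect, both defined in the context. Assume $$\rho_{\rm ch}<1,\qquad \sum_{k\ge1}\delta_k<\infty .$$ Then $F_n:=V_1V_2\cdots V_ng$ converges uniformly on $\mathbb R$ to some compactly supported $\Phi:\mathbb R\to\mathbb R^p$, and for every $q\in(\rho_{\rm ch},1)$ there is a constant $C_q$ such that for all $n\ge1$ $$\|F_n-\Phi\|_\infty\le C_q\Bigl(q^n+\sum_{j=1}^n\delta_jq^{\,n-j}+\sum_{j>n}\delta_j\Bigr).$$ Furthermore: (a) If there are $\alpha>1$ and a constant $c$ with $\delta_k\le c(k+1)^{-\alpha}$ for all $k$, then $\|F_n-\Phi\|_\infty=O((n+1)^{1-\alpha})$. If moreover $g$ is CPwL, then there are constants $W,C$ such that for every $\varepsilon\in(0,1/2)$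 there is a ReLU network of width at most $W$ with at most $C\varepsilon^{-1/(\alpha-1)}$ parameters that coincides on $\mathbb R$ with some $F_n$ and is within $\varepsilon$ of $\Phi$ in $\|\cdot\|_\infty$. (b) If there are $\theta\in(0,1)$ and a constant $c$ with $\delta_k\le c\,\theta^k$ for all $k$, and $\kappa\in(\max\{\rho_{\rm ch},\theta\},1)$, then $\|F_n-\Phi\|_\infty=O(\kappa^n)$. With $$\Lambda:=\max\Bigl\{1,\,2\sup_k\sum_{j\in J}\|A_j^{[k]}\|_2\Bigr\},\qquad \beta_\kappa:=\frac{\log(\kappa^{-1})}{\log(\Lambda/\kappa)},$$ one also has $\Phi\in C^{0,\beta_\kappa}(\mathbb R;\mathbb R^p)$ (Hölder continuous with exponent $\beta_\kappa$). Moreover, for CPwL $g$, there are constants $W,C$ such that every $F_n$ is exactly realized on $\mathbb R$ by a ReLU network of width at most $W$ with at most $Cn$ parameters; hence, for every $\varepsilon\in(0,1/2)$, accuracy $\varepsilon$ in $\|\cdot\|_\infty$ for $\Phi$ is achieved by such a network with $O(\log\varepsilon^{-1})$ parameters.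
   Context: Conventions. For vector functions $\|f\|_\infty=\sup_x\max_i|f_i(x)|$. $\|\cdot\|_2$ is the Euclidean vector norm or the induced matrix norm. CPwL means continuous piecewise linear with finitely many breakpoints. A ReLU network consists of affine maps separated by coordinatewise activations $\rho(t)=\max\{t,0\}$, with an affine output layer; its width is the largest hidden dimension, and its parameter count is the number of all entries of its affine maps, including zeros. Cascade. $A_j^{[k]}:=0$ for $j\notin J$, and $(V_kf)(x)=\sum_{j\in J}A_j^{[k]}f(2x-j)$. In $V_1\cdots V_ng$ the rightmost operator acts first. Window and transition matrices. Fix integers $\ell_-<\ell_+$ such that $[\ell_-,\ell_+]$ contains $J$, $\operatorname{supp}g$ and $[0,1]$, with $g(\ell_-)=g(\ell_+)=0$; put $L=\ell_+-\ell_-$, $D=pL$. For $x\in[0,1]$ let $G_f(x)=(f(x+\ell_-),f(x+\ell_-+1),\dots,f(x+\ell_+-1))^T\in\mathbb R^D$ (stacked $\mathbb R^p$-blocks). For $\epsilon\in\{0,1\}$ let $T_\epsilon^{[k]}\in\mathbb R^{D\times D}$ be the block matrix with $p\times p$ blocks $[T^{[k]}_\epsilon]_{i\ell}=A^{[k]}_{\ell_-+2i-\ell-1+\epsilon}$, $1\le i,\ell\le L$. Matching data. For each $k$ let $U_k\in\mathbb R^{D\times(D-r)}$ have columns forming an orthonormal basis of $\ker P_k$, let $P_k^\dagger$ be the Moore–Penrose pseudoinverse, and $S_k=[\,U_k\ \ P_k^\dagger\,]\in\mathbb R^{D\times D}$. Put $C_{k,\epsilon}=U_k^TT_\epsilon^{[k]}U_{k+1}$,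 $\epsilon\in\{0,1\}$. Chronological radius. $\chi_m=\sup_{a\ge1}\ \max_{\epsilon_a,\dots,\epsilon_{a+m-1}\in\{0,1\}}\|C_{a,\epsilon_a}C_{a+1,\epsilon_{a+1}}\cdots C_{a+m-1,\epsilon_{a+m-1}}\|$ and $\rho_{\rm ch}=\lim_{m\to\infty}\chi_m^{1/m}$ (the limit exists by submultiplicativity of $\chi_m$; it does not depend on the choice of norm or of the bases $U_k$). Defect. $\delta_k=\max_{\epsilon\in\{0,1\}}\|(P_kT_\epsilon^{[k]}-P_{k+1})S_{k+1}\|_2+\sup_{t\in[0,1]}\|P_kG_{V_kg-g}(t)\|_2.$ *)

theory Defs
  imports
    "HOL-Library.Extended_Real"
    "HOL-Analysis.Uniform_Limit"
    "Jordan_Normal_Form.DL_Rank"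
    "Jordan_Normal_Form.Matrix_Kernel"
    "Jordan_Normal_Form.Spectral_Radius"
begin

text \<open>
  All dimensions occurring below (\<open>p\<close>, \<open>D\<close>, \<open>r\<close>, layer sizes) are natural numbers, so vectors and
  matrices are those of Jordan_Normal_Form, with explicit carriers. Coordinates count from 0.
\<close>

section \<open>Norms and matrix notions\<close>

definition vec_norm2 :: "real vec \<Rightarrow> real" where
  "vec_norm2 v = sqrt (v \<bullet> v)"

definition mat_norm2 :: "real mat \<Rightarrow> real" where
  "mat_norm2 M = (SUP v\<in>{v \<in> carrier_vec (dim_col M). vec_norm2 v \<le> 1}. vec_norm2 (M *\<^sub>v v))"

text \<open>
  For \<open>M\<close> with at most as many rows as columns, the singular values are the square roots of the
  eigenvalues of \<open>M M\<^sup>T\<close>.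
\<close>
definition sigma_min :: "real mat \<Rightarrow> real" where
  "sigma_min M = Min (sqrt ` spectrum (M * transpose_mat M))"

text \<open>The Moore--Penrose pseudoinverse, by the four Penrose equations.\<close>
definition pinv :: "real mat \<Rightarrow> real mat" where
  "pinv M = (THE X. X \<in> carrier_mat (dim_col M) (dim_row M) \<and>
      M * X * M = M \<and> X * M * X = X \<and>
      transpose_mat (M * X) = M * X \<and> transpose_mat (X * M) = X * M)"

definition orthonormal_kernel_basis :: "real mat \<Rightarrow> real mat \<Rightarrow> bool" where
  "orthonormal_kernel_basis M U \<longleftrightarrow>
     U \<in> carrier_mat (dim_col M) (dim_col U) \<and>
     transpose_mat U * U = 1\<^sub>m (dim_col U) \<and>
     vec_space.col_space (dim_col M) U = mat_kernel M"

section \<open>Vector-valued functions on the line\<close>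

text \<open>Extended-real valued, so that an upper bound also asserts boundedness.\<close>
definition sup_norm :: "nat \<Rightarrow> (real \<Rightarrow> real vec) \<Rightarrow> ereal" where
  "sup_norm p f = (SUP x. ereal (Max ((\<lambda>i. \<bar>f x $ i\<bar>) ` {..<p})))"

definition supp :: "nat \<Rightarrow> (real \<Rightarrow> real vec) \<Rightarrow> real set" where
  "supp p f = closure {x. f x \<noteq> 0\<^sub>v p}"

definition continuous_vec :: "nat \<Rightarrow> (real \<Rightarrow> real vec) \<Rightarrow> bool" where
  "continuous_vec p f \<longleftrightarrow> (\<forall>i<p. continuous_on UNIV (\<lambda>x. f x $ i))"

definition uniformly_converges :: "nat \<Rightarrow> (nat \<Rightarrow> real \<Rightarrow> real vec) \<Rightarrow> (real \<Rightarrow> real vec) \<Rightarrow> bool" where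
  "uniformly_converges p F f \<longleftrightarrow>
     (\<forall>i<p. uniform_limit UNIV (\<lambda>n x. F n x $ i) (\<lambda>x. f x $ i) sequentially)"

definition holder_continuous :: "real \<Rightarrow> (real \<Rightarrow> real vec) \<Rightarrow> bool" where
  "holder_continuous \<beta> f \<longleftrightarrow> (\<exists>H. \<forall>x y. vec_norm2 (f x - f y) \<le> H * \<bar>x - y\<bar> powr \<beta>)"

text \<open>Continuous, and affine on every interval that avoids a finite set of breakpoints.\<close>
definition cpwl :: "nat \<Rightarrow> (real \<Rightarrow> real vec) \<Rightarrow> bool" where
  "cpwl p f \<longleftrightarrow> continuous_vec p f \<and>
     (\<exists>B. finite B \<and>
        (\<forall>I. is_interval I \<and> I \<inter> B = {} \<longrightarrow>
           (\<exists>u\<in>carrier_vec p. \<exists>v\<in>carrier_vec p. \<forall>x\<in>I. f x = u + x \<cdot>\<^sub>v v)))"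

section \<open>ReLU networks\<close>

text \<open>
  A network is the list of its affine maps \<open>x \<mapsto> W x + b\<close>; the last one is the output layer.
\<close>
type_synonym relu_net = "(real mat \<times> real vec) list"

fun net_wf :: "nat \<Rightarrow> relu_net \<Rightarrow> nat \<Rightarrow> bool" where
  "net_wf d_in [] d_out \<longleftrightarrow> False"
| "net_wf d_in [(W, b)] d_out \<longleftrightarrow> W \<in> carrier_mat d_out d_in \<and> b \<in> carrier_vec d_out"
| "net_wf d_in ((W, b) # l # ls) d_out \<longleftrightarrow>
     0 < dim_vec b \<and> W \<in> carrier_mat (dim_vec b) d_in \<and> net_wf (dim_vec b) (l # ls) d_out"

fun net_eval :: "relu_net \<Rightarrow> real vec \<Rightarrow> real vec" where
  "net_eval [] x = x"
| "net_eval [(W, b)] x = W *\<^sub>v x + b"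
| "net_eval ((W, b) # l # ls) x = net_eval (l # ls) (map_vec (\<lambda>t. max t 0) (W *\<^sub>v x + b))"

definition net_width :: "relu_net \<Rightarrow> nat" where
  "net_width N = Max (insert 0 (set (map (\<lambda>(W, b). dim_vec b) (butlast N))))"

definition net_params :: "relu_net \<Rightarrow> nat" where
  "net_params N = (\<Sum>(W, b)\<leftarrow>N. dim_row W * dim_col W + dim_vec b)"

definition relu_realizable :: "nat \<Rightarrow> nat \<Rightarrow> real \<Rightarrow> (real \<Rightarrow> real vec) \<Rightarrow> bool" where
  "relu_realizable p w m f \<longleftrightarrow>
     (\<exists>N. net_wf 1 N p \<and> net_width N \<le> w \<and> real (net_params N) \<le> m \<and>
          (\<forall>x. net_eval N (vec 1 (\<lambda>_. x)) = f x))"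

section \<open>The cascade\<close>

text \<open>Masks, projections \<open>P\<close> and bases \<open>U\<close> are indexed by levels \<open>k \<ge> 1\<close>; level 0 is never used.\<close>

definition mask :: "nat \<Rightarrow> int set \<Rightarrow> (nat \<Rightarrow> int \<Rightarrow> real mat) \<Rightarrow> nat \<Rightarrow> int \<Rightarrow> real mat" where
  "mask p J A k j = (if j \<in> J then A k j else 0\<^sub>m p p)"

definition cascade_op ::
  "nat \<Rightarrow> int set \<Rightarrow> (nat \<Rightarrow> int \<Rightarrow> real mat) \<Rightarrow> nat \<Rightarrow> (real \<Rightarrow> real vec) \<Rightarrow> real \<Rightarrow> real vec" where
  "cascade_op p J A k f x = vec p (\<lambda>i. \<Sum>j\<in>J. (A k j *\<^sub>v f (2 * x - real_of_int j)) $ i)"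

text \<open>\<open>cascade p J A g n = V\<^sub>1 (V\<^sub>2 (\<dots> (V\<^sub>n g)))\<close>\<close>
definition cascade ::
  "nat \<Rightarrow> int set \<Rightarrow> (nat \<Rightarrow> int \<Rightarrow> real mat) \<Rightarrow> (real \<Rightarrow> real vec) \<Rightarrow> nat \<Rightarrow> real \<Rightarrow> real vec" where
  "cascade p J A g n = foldr (cascade_op p J A) [1..<Suc n] g"

definition window :: "nat \<Rightarrow> int set \<Rightarrow> (real \<Rightarrow> real vec) \<Rightarrow> int \<Rightarrow> int \<Rightarrow> bool" where
  "window p J g lm lp \<longleftrightarrow> lm < lp \<and>
     J \<subseteq> {lm..lp} \<and>
     supp p g \<subseteq> {real_of_int lm..real_of_int lp} \<and>
     {0..1} \<subseteq> {real_of_int lm..real_of_int lp} \<and>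
     g (real_of_int lm) = 0\<^sub>v p \<and> g (real_of_int lp) = 0\<^sub>v p"

text \<open>
  Row \<open>a\<close> of a stacked vector or block matrix is entry \<open>a mod p\<close> of the block with
  (zero-based) number \<open>a div p\<close>.
\<close>
definition stack :: "nat \<Rightarrow> int \<Rightarrow> int \<Rightarrow> (real \<Rightarrow> real vec) \<Rightarrow> real \<Rightarrow> real vec" where
  "stack p lm lp f x =
     vec (p * nat (lp - lm)) (\<lambda>a. f (x + real_of_int lm + real (a div p)) $ (a mod p))"

definition transition ::
  "nat \<Rightarrow> int set \<Rightarrow> (nat \<Rightarrow> int \<Rightarrow> real mat) \<Rightarrow> int \<Rightarrow> int \<Rightarrow> nat \<Rightarrow> nat \<Rightarrow> real mat" where
  "transition p J A lm lp k e =
     mat (p * nat (lp - lm)) (p * nat (lp - lm))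
       (\<lambda>(a, b). let i = int (a div p) + 1; l = int (b div p) + 1
                 in mask p J A k (lm + 2 * i - l - 1 + int e) $$ (a mod p, b mod p))"

text \<open>\<open>S\<^sub>k = [U\<^sub>k  P\<^sub>k\<^sup>\<dagger>]\<close>\<close>
definition matching :: "real mat \<Rightarrow> real mat \<Rightarrow> real mat" where
  "matching U P = mat_of_cols (dim_row U) (cols U @ cols (pinv P))"

section \<open>Chronological radius and defect\<close>

fun chrono_prod :: "nat \<Rightarrow> (nat \<Rightarrow> nat \<Rightarrow> real mat) \<Rightarrow> nat \<Rightarrow> nat list \<Rightarrow> real mat" where
  "chrono_prod d C a [] = 1\<^sub>m d"
| "chrono_prod d C a (e # es) = C a e * chrono_prod d C (Suc a) es"

definition chrono_sup :: "nat \<Rightarrow> (nat \<Rightarrow> nat \<Rightarrow> real mat) \<Rightarrow> nat \<Rightarrow> real" where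
  "chrono_sup d C m =
     (SUP a\<in>{1..}. Max ((\<lambda>es. mat_norm2 (chrono_prod d C a es)) `
                        {es. set es \<subseteq> {0, 1} \<and> length es = m}))"

definition chrono_radius :: "nat \<Rightarrow> (nat \<Rightarrow> nat \<Rightarrow> real mat) \<Rightarrow> real" where
  "chrono_radius d C = lim (\<lambda>m. root m (chrono_sup d C m))"

definition defect ::
  "nat \<Rightarrow> int set \<Rightarrow> (nat \<Rightarrow> int \<Rightarrow> real mat) \<Rightarrow> (real \<Rightarrow> real vec) \<Rightarrow> int \<Rightarrow> int \<Rightarrow>
   (nat \<Rightarrow> real mat) \<Rightarrow> (nat \<Rightarrow> real mat) \<Rightarrow> nat \<Rightarrow> real" where
  "defect p J A g lm lp P U k =
     Max ((\<lambda>e. mat_norm2 ((P k * transition p J A lm lp k e - P (Suc k)) *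
                         matching (U (Suc k)) (P (Suc k)))) ` {0, 1}) +
     (SUP t\<in>{0..1}. vec_norm2 (P k *\<^sub>v stack p lm lp (\<lambda>x. cascade_op p J A k g x - g x) t))"

end

theory Submission
  imports Defs "HOL-Analysis.L2_Norm"
begin

text \<open>
  On the window, \<open>V\<^sub>1 \<dots> V\<^sub>n\<close> acts by products of the matrices \<open>T\<^sub>\<epsilon>\<close> selected by the binary digits of the
  argument. Splitting \<open>\<real>\<^sup>D\<close> at level \<open>k\<close> into \<open>ker P\<^sub>k\<close> and its complement makes these products almost
  block triangular: the kernel block contracts at any rate \<open>q\<close> above the chronological radius (in a suitable
  norm), the complementary block is the identity, and the remaining block is bounded by the defect. Hence
  \<open>F\<^sub>n\<^sub>+\<^sub>1 - F\<^sub>n\<close> is bounded by a telescoping sequence.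

  For the Hoelder estimate, \<open>P\<^sub>k G\<^sub>g\<close> is shown to be constant on the unit interval up to a tail of the defects,
  so that \<open>g\<close> may be replaced by its piecewise linear interpolant at the integers, whose iterates have Lipschitz
  constants growing like \<open>\<Lambda>\<^sup>n\<close>.

  A network realizes \<open>F\<^sub>n\<close> by pushing the binary digits of its argument onto a stack, stored in one real
  number, and popping them while the matrices are applied. Digits of numbers close to dyadic rationals cannot be
  found by continuous functions; this does not matter for generators that vanish near the integers, and every
  generator is a sum of such a generator and a half-integer translate of another one.
\<close>

unbundle no vec_syntax and no inner_syntax

section \<open>Euclidean and operator norms\<close>

text \<open>The block from the complement into the kernel is bounded, not small. It is harmless
  because it feeds only components that shrink: a weight \<open>s\<close> with
  \<open>s * (1 - q) = \<beta>\<close> makes the gain through this block equal to the loss by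
  contraction, so only factors 1 + O(\<delta>) remain, whose product is finite by summability. Along
  the complement nothing contracts, hence a perturbation inserted at level n + 1 must itself have a
  small image under \<open>P (Suc n)\<close>; for V g - g this is the second half of the defect.

  A merely continuous \<open>g\<close> has no Lipschitz constant to propagate. Replacing it by its
  interpolant is a perturbation of the same kind, with small image because \<open>P\<close> flattens
  the stacked \<open>g\<close>.

  The network identity must hold at every real point. One test on the last folded distance certifies
  all N digits, as that distance at most doubles per step. Slopes and clipping levels grow
  exponentially with N, but only the number of entries is counted. Digits emerge first to last while
  the matrices act last to first, which is why the digits pass through a stack.\<close>

lemma vec_norm2_eq_L2_set: "vec_norm2 v = L2_set (\<lambda>i. v $ i) {0..<dim_vec v}"
  by (simp add: vec_norm2_def L2_set_def scalar_prod_def power2_eq_square)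

lemma vec_norm2_nonneg [simp]: "0 \<le> vec_norm2 v"
  by (simp add: vec_norm2_eq_L2_set)

lemma scalar_prod_self: "(v :: real vec) \<bullet> v = (vec_norm2 v)\<^sup>2"
proof -
  have "0 \<le> v \<bullet> v" by (auto simp: scalar_prod_def intro!: sum_nonneg)
  then show ?thesis by (simp add: vec_norm2_def)
qed

lemma vec_norm2_zero [simp]: "vec_norm2 (0\<^sub>v n) = 0"
  by (simp add: vec_norm2_eq_L2_set L2_set_def)

lemma vec_norm2_eq_0:
  assumes "v \<in> carrier_vec n" "vec_norm2 v = 0"
  shows "v = 0\<^sub>v n"
  using assms by (auto simp: vec_norm2_eq_L2_set L2_set_eq_0_iff intro!: eq_vecI)

lemma vec_norm2_triangle:
  assumes "v \<in> carrier_vec n" "w \<in> carrier_vec n"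
  shows "vec_norm2 (v + w) \<le> vec_norm2 v + vec_norm2 w"
proof -
  have "vec_norm2 (v + w) = L2_set (\<lambda>i. v $ i + w $ i) {0..<n}"
    using assms by (auto simp: vec_norm2_eq_L2_set intro!: L2_set_cong)
  also have "\<dots> \<le> L2_set (\<lambda>i. v $ i) {0..<n} + L2_set (\<lambda>i. w $ i) {0..<n}"
    by (rule L2_set_triangle_ineq)
  finally show ?thesis using assms by (simp add: vec_norm2_eq_L2_set)
qed

lemma vec_norm2_smult: "vec_norm2 (c \<cdot>\<^sub>v v) = \<bar>c\<bar> * vec_norm2 v"
proof -
  have "(\<Sum>i = 0..<dim_vec v. ((c \<cdot>\<^sub>v v) $ i)\<^sup>2) = c\<^sup>2 * (\<Sum>i = 0..<dim_vec v. (v $ i)\<^sup>2)"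
    by (simp add: sum_distrib_left power_mult_distrib)
  then show ?thesis
    by (simp add: vec_norm2_eq_L2_set L2_set_def real_sqrt_mult)
qed

lemma vec_norm2_uminus: "vec_norm2 (- v) = vec_norm2 v"
  by (auto simp: vec_norm2_eq_L2_set L2_set_def)

lemma vec_norm2_minus_commute:
  "v \<in> carrier_vec n \<Longrightarrow> w \<in> carrier_vec n \<Longrightarrow> vec_norm2 (v - w) = vec_norm2 (w - v)"
  by (auto simp: vec_norm2_eq_L2_set L2_set_def power2_commute)

lemma vec_norm2_triangle_minus:
  assumes "v \<in> carrier_vec n" "w \<in> carrier_vec n"
  shows "vec_norm2 (v - w) \<le> vec_norm2 v + vec_norm2 w"
proof -
  have "v - w = v + - w" using assms by auto
  then show ?thesis
    using vec_norm2_triangle[OF assms(1), of "- w"] assms by (simp add: vec_norm2_uminus)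
qed

lemma vec_norm2_triangle_via:
  assumes "u \<in> carrier_vec n" "v \<in> carrier_vec n" "w \<in> carrier_vec n"
  shows "vec_norm2 (u - w) \<le> vec_norm2 (u - v) + vec_norm2 (v - w)"
proof -
  have "u - w = (u - v) + (v - w)" using assms by (auto intro!: eq_vecI)
  then show ?thesis using assms by (simp add: vec_norm2_triangle[of _ n])
qed

lemma abs_vec_index_le_norm2: "i < dim_vec v \<Longrightarrow> \<bar>v $ i\<bar> \<le> vec_norm2 v"
  using member_le_L2_set[of "{0..<dim_vec v}" i "\<lambda>i. \<bar>v $ i\<bar>"]
  by (simp add: vec_norm2_eq_L2_set L2_set_def)

lemma vec_norm2_le_sum_abs: "vec_norm2 v \<le> (\<Sum>i<dim_vec v. \<bar>v $ i\<bar>)"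
  using L2_set_le_sum_abs[of "\<lambda>i. v $ i" "{0..<dim_vec v}"]
  by (simp add: vec_norm2_eq_L2_set atLeast0LessThan)

lemma vec_norm2_le_bound:
  assumes "\<And>i. i < dim_vec v \<Longrightarrow> \<bar>v $ i\<bar> \<le> c"
  shows "vec_norm2 v \<le> real (dim_vec v) * c"
  using vec_norm2_le_sum_abs[of v] sum_bounded_above[of "{..<dim_vec v}" "\<lambda>i. \<bar>v $ i\<bar>" c] assms
  by force

lemma Cauchy_Schwarz_vec_norm2:
  assumes "v \<in> carrier_vec n" "w \<in> carrier_vec n"
  shows "\<bar>v \<bullet> w\<bar> \<le> vec_norm2 v * vec_norm2 w"
proof -
  have "\<bar>v \<bullet> w\<bar> \<le> (\<Sum>i\<in>{0..<n}. \<bar>v $ i\<bar> * \<bar>w $ i\<bar>)"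
    using assms by (auto simp: scalar_prod_def abs_mult intro!: order_trans[OF sum_abs])
  also have "\<dots> \<le> L2_set (\<lambda>i. v $ i) {0..<n} * L2_set (\<lambda>i. w $ i) {0..<n}"
    by (rule L2_set_mult_ineq)
  finally show ?thesis using assms by (simp add: vec_norm2_eq_L2_set)
qed

lemma vec_norm2_sum_bounded:
  assumes "finite I" "\<And>i. i \<in> I \<Longrightarrow> f i \<in> carrier_vec n" "\<And>i. i \<in> I \<Longrightarrow> vec_norm2 (f i) \<le> b i"
  shows "vec_norm2 (Matrix.vec n (\<lambda>a. \<Sum>i\<in>I. f i $ a)) \<le> (\<Sum>i\<in>I. b i)"
  using assms
proof (induction I rule: finite_induct)
  case empty
  have "Matrix.vec n (\<lambda>a. \<Sum>i\<in>{}. f i $ a) = 0\<^sub>v n" by auto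
  then show ?case by simp
next
  case (insert i I)
  have "Matrix.vec n (\<lambda>a. \<Sum>i\<in>insert i I. f i $ a) = f i + Matrix.vec n (\<lambda>a. \<Sum>i\<in>I. f i $ a)"
    using insert by (auto intro!: eq_vecI)
  also have "vec_norm2 \<dots> \<le> vec_norm2 (f i) + vec_norm2 (Matrix.vec n (\<lambda>a. \<Sum>i\<in>I. f i $ a))"
    using insert by (intro vec_norm2_triangle[of _ n]) auto
  also have "\<dots> \<le> b i + (\<Sum>i\<in>I. b i)" using insert by (intro add_mono) auto
  finally show ?case using insert by simp
qed

lemma vec_norm2_mult_mat_vec_le_entries:
  assumes M: "M \<in> carrier_mat r c" and v: "v \<in> carrier_vec c"
    and e: "\<And>i j. i < r \<Longrightarrow> j < c \<Longrightarrow> \<bar>M $$ (i, j)\<bar> \<le> e"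
  shows "vec_norm2 (M *\<^sub>v v) \<le> real r * (real c * e) * vec_norm2 v"
proof -
  have "\<bar>(M *\<^sub>v v) $ i\<bar> \<le> real c * e * vec_norm2 v" if i: "i < r" for i
  proof -
    have "\<bar>(M *\<^sub>v v) $ i\<bar> = \<bar>row M i \<bullet> v\<bar>" using M i by simp
    also have "\<dots> \<le> vec_norm2 (row M i) * vec_norm2 v"
      using M v by (intro Cauchy_Schwarz_vec_norm2[of _ c]) auto
    also have "vec_norm2 (row M i) \<le> real (dim_vec (row M i)) * e"
      using M i e by (intro vec_norm2_le_bound) auto
    finally show ?thesis using M by (simp add: mult_right_mono)
  qed
  then show ?thesis
    using vec_norm2_le_bound[of "M *\<^sub>v v" "real c * e * vec_norm2 v"] M by (simp add: mult.assoc)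
qed

lemma mat_entries_bounded: "\<exists>e::real. \<forall>i<dim_row M. \<forall>j<dim_col M. \<bar>M $$ (i, j)\<bar> \<le> e"
proof -
  have "finite ((\<lambda>(i, j). \<bar>M $$ (i, j)\<bar>) ` ({..<dim_row M} \<times> {..<dim_col M}))" by simp
  then obtain e where "\<forall>x \<in> (\<lambda>(i, j). \<bar>M $$ (i, j)\<bar>) ` ({..<dim_row M} \<times> {..<dim_col M}). x \<le> e"
    using bdd_above_finite unfolding bdd_above_def by blast
  then show ?thesis by (intro exI[of _ e]) auto
qed

text \<open>The supremum defining \<open>mat_norm2\<close> is a real one, so it dominates its terms
  only once it is known to be bounded; the crude entrywise bound suffices.\<close>

lemma mat_norm2_bdd_above:
  "bdd_above ((\<lambda>v. vec_norm2 (M *\<^sub>v v)) ` {v \<in> carrier_vec (dim_col M). vec_norm2 v \<le> 1})"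
proof -
  obtain e where e: "\<forall>i<dim_row M. \<forall>j<dim_col M. \<bar>M $$ (i, j)\<bar> \<le> e"
    using mat_entries_bounded by blast
  define e' where "e' = max e 0"
  have b: "vec_norm2 (M *\<^sub>v v) \<le> real (dim_row M) * (real (dim_col M) * e')"
    if "v \<in> carrier_vec (dim_col M)" "vec_norm2 v \<le> 1" for v
  proof -
    have "vec_norm2 (M *\<^sub>v v) \<le> real (dim_row M) * (real (dim_col M) * e') * vec_norm2 v"
      using e that by (intro vec_norm2_mult_mat_vec_le_entries) (auto simp: e'_def max.coboundedI1)
    also have "\<dots> \<le> real (dim_row M) * (real (dim_col M) * e') * 1"
      using that by (intro mult_left_mono) (auto simp: e'_def)
    finally show ?thesis by simp
  qed
  then show ?thesis by (intro bdd_aboveI2) auto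
qed

lemma mat_norm2_nonneg [simp]: "0 \<le> mat_norm2 M"
proof -
  have "vec_norm2 (M *\<^sub>v 0\<^sub>v (dim_col M)) \<le> mat_norm2 M"
    unfolding mat_norm2_def by (rule cSUP_upper[OF _ mat_norm2_bdd_above]) auto
  then show ?thesis using vec_norm2_nonneg order_trans by blast
qed

lemma vec_norm2_mult_mat_vec_le:
  assumes M: "M \<in> carrier_mat r c" and v: "v \<in> carrier_vec c"
  shows "vec_norm2 (M *\<^sub>v v) \<le> mat_norm2 M * vec_norm2 v"
proof (cases "vec_norm2 v = 0")
  case True
  then have "v = 0\<^sub>v c" using v vec_norm2_eq_0 by blast
  moreover have "M *\<^sub>v 0\<^sub>v c = 0\<^sub>v r" using M by (auto intro!: eq_vecI)
  ultimately show ?thesis by simp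
next
  case False
  then have pos: "vec_norm2 v > 0" using vec_norm2_nonneg[of v] by linarith
  define w where "w = (1 / vec_norm2 v) \<cdot>\<^sub>v v"
  have w: "w \<in> carrier_vec c" "vec_norm2 w = 1" using v pos by (auto simp: w_def vec_norm2_smult)
  have "vec_norm2 (M *\<^sub>v w) \<le> mat_norm2 M"
    unfolding mat_norm2_def using w M by (intro cSUP_upper[OF _ mat_norm2_bdd_above]) auto
  moreover have "M *\<^sub>v w = (1 / vec_norm2 v) \<cdot>\<^sub>v (M *\<^sub>v v)"
    unfolding w_def using M v by (simp add: mult_mat_vec)
  ultimately show ?thesis using pos by (simp add: vec_norm2_smult field_simps)
qed

lemma mat_norm2_le:
  assumes M: "M \<in> carrier_mat r c" and "0 \<le> b"
    and "\<And>v. v \<in> carrier_vec c \<Longrightarrow> vec_norm2 (M *\<^sub>v v) \<le> b * vec_norm2 v"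
  shows "mat_norm2 M \<le> b"
  unfolding mat_norm2_def
proof (rule cSUP_least)
  show "{v \<in> carrier_vec (dim_col M). vec_norm2 v \<le> 1} \<noteq> {}"
    by (auto intro!: exI[of _ "0\<^sub>v (dim_col M)"])
  fix v assume v: "v \<in> {v \<in> carrier_vec (dim_col M). vec_norm2 v \<le> 1}"
  then have "vec_norm2 (M *\<^sub>v v) \<le> b * vec_norm2 v" using M assms(3) by auto
  also have "\<dots> \<le> b * 1" using v assms(2) by (intro mult_left_mono) auto
  finally show "vec_norm2 (M *\<^sub>v v) \<le> b" by simp
qed

lemma mat_norm2_mult_le:
  assumes M: "M \<in> carrier_mat a b" and N: "N \<in> carrier_mat b c"
  shows "mat_norm2 (M * N) \<le> mat_norm2 M * mat_norm2 N"
proof (rule mat_norm2_le)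
  show "M * N \<in> carrier_mat a c" using M N by simp
  fix v :: "real vec" assume v: "v \<in> carrier_vec c"
  have "vec_norm2 (M * N *\<^sub>v v) = vec_norm2 (M *\<^sub>v (N *\<^sub>v v))" using M N v by simp
  also have "\<dots> \<le> mat_norm2 M * vec_norm2 (N *\<^sub>v v)"
    using M N v by (intro vec_norm2_mult_mat_vec_le) auto
  also have "\<dots> \<le> mat_norm2 M * (mat_norm2 N * vec_norm2 v)"
    using N v by (intro mult_left_mono vec_norm2_mult_mat_vec_le) auto
  finally show "vec_norm2 (M * N *\<^sub>v v) \<le> mat_norm2 M * mat_norm2 N * vec_norm2 v"
    by (simp add: mult.assoc)
qed simp

lemma mat_norm2_le_entries:
  assumes "M \<in> carrier_mat r c" "0 \<le> e"
    and "\<And>i j. i < r \<Longrightarrow> j < c \<Longrightarrow> \<bar>M $$ (i, j)\<bar> \<le> e"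
  shows "mat_norm2 M \<le> real r * (real c * e)"
  using assms by (intro mat_norm2_le vec_norm2_mult_mat_vec_le_entries) auto

text \<open>An entry is a coordinate of the image of a unit vector. This turns norm bounds on the
  masks into bounds on the entries of the transition matrices.\<close>

lemma abs_entry_le_mat_norm2:
  assumes M: "M \<in> carrier_mat r c" and i: "i < r" and j: "j < c"
  shows "\<bar>M $$ (i, j)\<bar> \<le> mat_norm2 M"
proof -
  have "M *\<^sub>v unit_vec c j = col M j"
    using M j by (intro eq_vecI) (auto simp: scalar_prod_right_unit)
  then have "M $$ (i, j) = (M *\<^sub>v unit_vec c j) $ i" using M i j by simp
  also have "\<bar>\<dots>\<bar> \<le> vec_norm2 (M *\<^sub>v unit_vec c j)"
    using M i by (intro abs_vec_index_le_norm2) auto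
  also have "\<dots> \<le> mat_norm2 M * vec_norm2 (unit_vec c j)"
    using M by (intro vec_norm2_mult_mat_vec_le) auto
  also have "vec_norm2 (unit_vec c j) = 1" using j by (simp add: vec_norm2_def)
  finally show ?thesis by simp
qed

lemma mat_norm2_one_le: "mat_norm2 (1\<^sub>m n) \<le> 1"
  by (rule mat_norm2_le[of _ n n]) auto

lemma mult_mat_vec_zero: "M \<in> carrier_mat r c \<Longrightarrow> M *\<^sub>v 0\<^sub>v c = (0\<^sub>v r :: real vec)"
  by (auto intro!: eq_vecI)

lemma scalar_prod_transpose:
  assumes "M \<in> carrier_mat r c" "v \<in> carrier_vec r" "w \<in> carrier_vec c"
  shows "(transpose_mat M *\<^sub>v v) \<bullet> w = v \<bullet> (M *\<^sub>v (w :: real vec))"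
proof -
  have "(transpose_mat M *\<^sub>v v) \<bullet> w = (\<Sum>j<c. (\<Sum>i<r. M $$ (i, j) * v $ i) * w $ j)"
    using assms by (auto simp: scalar_prod_def atLeast0LessThan intro!: sum.cong)
  also have "\<dots> = (\<Sum>j<c. \<Sum>i<r. v $ i * (M $$ (i, j) * w $ j))"
    by (simp add: sum_distrib_right mult.assoc mult.left_commute)
  also have "\<dots> = (\<Sum>i<r. \<Sum>j<c. v $ i * (M $$ (i, j) * w $ j))" by (rule sum.swap)
  also have "\<dots> = v \<bullet> (M *\<^sub>v w)"
    using assms by (auto simp: scalar_prod_def sum_distrib_left atLeast0LessThan intro!: sum.cong)
  finally show ?thesis .
qed

text \<open>For w = M^T v one has |w|^2 = <v, M w> <= |v| |M| |w|, and |w| cancels unless it is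
  zero.\<close>

lemma mat_norm2_transpose_le:
  assumes M: "M \<in> carrier_mat r c"
  shows "mat_norm2 (transpose_mat M) \<le> mat_norm2 M"
proof (rule mat_norm2_le)
  show "transpose_mat M \<in> carrier_mat c r" using M by simp
  fix v :: "real vec" assume v: "v \<in> carrier_vec r"
  let ?w = "transpose_mat M *\<^sub>v v"
  have w: "?w \<in> carrier_vec c" using M v by simp
  have "(vec_norm2 ?w)\<^sup>2 = v \<bullet> (M *\<^sub>v ?w)"
    using scalar_prod_transpose[OF M v w] by (simp add: scalar_prod_self)
  also have "\<dots> \<le> vec_norm2 v * vec_norm2 (M *\<^sub>v ?w)"
    using Cauchy_Schwarz_vec_norm2[of v r "M *\<^sub>v ?w"] M v w by auto
  also have "\<dots> \<le> vec_norm2 v * (mat_norm2 M * vec_norm2 ?w)"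
    using M w by (intro mult_left_mono vec_norm2_mult_mat_vec_le) auto
  finally have *: "vec_norm2 ?w * vec_norm2 ?w \<le> (mat_norm2 M * vec_norm2 v) * vec_norm2 ?w"
    by (simp add: power2_eq_square mult_ac)
  show "vec_norm2 ?w \<le> mat_norm2 M * vec_norm2 v"
  proof (cases "vec_norm2 ?w = 0")
    case False
    then have "0 < vec_norm2 ?w" using vec_norm2_nonneg[of ?w] by linarith
    with * show ?thesis by simp
  qed simp
qed simp

lemma vec_norm2_isometry:
  assumes U: "U \<in> carrier_mat r c" and UU: "transpose_mat U * U = 1\<^sub>m c" and v: "v \<in> carrier_vec c"
  shows "vec_norm2 (U *\<^sub>v v) = vec_norm2 v"
proof -
  have "(U *\<^sub>v v) \<bullet> (U *\<^sub>v v) = (transpose_mat U *\<^sub>v (U *\<^sub>v v)) \<bullet> v"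
    using U v by (subst scalar_prod_transpose[of U r c]) auto
  also have "transpose_mat U *\<^sub>v (U *\<^sub>v v) = (transpose_mat U * U) *\<^sub>v v"
    using U v by (subst assoc_mult_mat_vec[of _ c r _ c]) auto
  also have "\<dots> = v" using UU v by simp
  finally show ?thesis by (simp add: vec_norm2_def)
qed

section \<open>Smallest singular value and pseudoinverse\<close>

lemma mult_mat_vec_cancel:
  fixes A :: "real mat"
  assumes "A \<in> carrier_mat n m" "B \<in> carrier_mat m n" "A * B = 1\<^sub>m n" "v \<in> carrier_vec n"
  shows "A *\<^sub>v (B *\<^sub>v v) = v"
  using assms(3,4) assoc_mult_mat_vec[OF assms(1,2,4)] by simp

lemma injective_mat_has_inverse:
  fixes N :: "real mat"
  assumes N: "N \<in> carrier_mat n n"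
    and inj: "\<And>v. v \<in> carrier_vec n \<Longrightarrow> N *\<^sub>v v = 0\<^sub>v n \<Longrightarrow> v = 0\<^sub>v n"
  obtains B where "B \<in> carrier_mat n n" "B * N = 1\<^sub>m n" "N * B = 1\<^sub>m n"
proof -
  have "det N \<noteq> 0" using inj det_0_iff_vec_prod_zero_field[OF N] by blast
  from det_non_zero_imp_unit[OF N this, unfolded Units_def, of "()"]
  obtain B where "B \<in> carrier_mat n n" "B * N = 1\<^sub>m n" "N * B = 1\<^sub>m n"
    by (auto simp: ring_mat_def)
  then show ?thesis using that by blast
qed

text \<open>Nonnegativity of the form at x - t N x, with t the reciprocal of
  \<open>mat_norm2 N + 1\<close>, gives the estimate without a square root of \<open>N\<close>; the
  summand 1 keeps t defined for \<open>N = 0\<close>.\<close>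

lemma psd_norm_mult_le:
  fixes N :: "real mat"
  assumes N: "N \<in> carrier_mat n n" and sym: "transpose_mat N = N"
    and psd: "\<And>x. x \<in> carrier_vec n \<Longrightarrow> 0 \<le> x \<bullet> (N *\<^sub>v x)" and x: "x \<in> carrier_vec n"
  shows "(vec_norm2 (N *\<^sub>v x))\<^sup>2 \<le> (mat_norm2 N + 1) * (x \<bullet> (N *\<^sub>v x))"
proof -
  define c where "c = mat_norm2 N + 1"
  define t where "t = 1 / c"
  have c: "c > 0" using mat_norm2_nonneg[of N] unfolding c_def by linarith
  define y where "y = N *\<^sub>v x"
  have y: "y \<in> carrier_vec n" and Ny: "N *\<^sub>v y \<in> carrier_vec n" using N x by (auto simp: y_def)
  have xNy: "x \<bullet> (N *\<^sub>v y) = (vec_norm2 y)\<^sup>2"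
    using scalar_prod_transpose[OF N x y] sym by (simp add: y_def[symmetric] scalar_prod_self)
  have yNy: "y \<bullet> (N *\<^sub>v y) \<le> c * (vec_norm2 y)\<^sup>2"
  proof -
    have "y \<bullet> (N *\<^sub>v y) \<le> vec_norm2 y * vec_norm2 (N *\<^sub>v y)"
      using Cauchy_Schwarz_vec_norm2[OF y Ny] by simp
    also have "\<dots> \<le> vec_norm2 y * (mat_norm2 N * vec_norm2 y)"
      using N y by (intro mult_left_mono vec_norm2_mult_mat_vec_le) auto
    also have "\<dots> \<le> vec_norm2 y * (c * vec_norm2 y)"
      by (intro mult_left_mono mult_right_mono) (auto simp: c_def)
    finally show ?thesis by (simp add: power2_eq_square mult_ac)
  qed
  have "N *\<^sub>v (x - t \<cdot>\<^sub>v y) = y - t \<cdot>\<^sub>v (N *\<^sub>v y)"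
    using N x y by (simp add: mult_minus_distrib_mat_vec[of _ n n] mult_mat_vec[of _ n n] y_def)
  then have "0 \<le> (x - t \<cdot>\<^sub>v y) \<bullet> (y - t \<cdot>\<^sub>v (N *\<^sub>v y))"
    using psd[of "x - t \<cdot>\<^sub>v y"] x y by simp
  also have "\<dots> = x \<bullet> y - t * (x \<bullet> (N *\<^sub>v y)) - t * (y \<bullet> y) + t * (t * (y \<bullet> (N *\<^sub>v y)))"
    using x y Ny
    by (simp add: minus_scalar_prod_distrib[of _ n] scalar_prod_minus_distrib[of _ n] algebra_simps)
  also have "\<dots> \<le> x \<bullet> y - t * (vec_norm2 y)\<^sup>2 - t * (vec_norm2 y)\<^sup>2 + t * (t * (c * (vec_norm2 y)\<^sup>2))"
  proof -
    have "t * (t * (y \<bullet> (N *\<^sub>v y))) \<le> t * (t * (c * (vec_norm2 y)\<^sup>2))"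
      using yNy c by (intro mult_left_mono) (auto simp: t_def)
    then show ?thesis unfolding xNy scalar_prod_self by linarith
  qed
  also have "\<dots> = x \<bullet> y - (vec_norm2 y)\<^sup>2 / c" using c by (simp add: t_def field_simps)
  finally show ?thesis using c by (simp add: y_def c_def field_simps)
qed

text \<open>
  If the infimum \<open>m\<close> of the Rayleigh quotient were not an eigenvalue, then \<open>M - m\<close> would be
  positive semidefinite and invertible, so the quotient would stay away from \<open>m\<close>.
\<close>
lemma rayleigh_min_eigenvalue:
  fixes M :: "real mat"
  assumes M: "M \<in> carrier_mat n n" and sym: "transpose_mat M = M" and n: "0 < n"
  obtains m where "eigenvalue M m"
    "\<And>x. x \<in> carrier_vec n \<Longrightarrow> m * (vec_norm2 x)\<^sup>2 \<le> x \<bullet> (M *\<^sub>v x)"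
proof -
  define S where "S = {x \<in> carrier_vec n. vec_norm2 x = (1::real)}"
  define m where "m = (INF x\<in>S. x \<bullet> (M *\<^sub>v x))"
  have "unit_vec n 0 \<in> S" using n by (auto simp: S_def vec_norm2_def)
  then have ne: "S \<noteq> {}" by auto
  have bdd: "bdd_below ((\<lambda>x. x \<bullet> (M *\<^sub>v x)) ` S)"
  proof (rule bdd_belowI2)
    fix x assume "x \<in> S"
    then have x: "x \<in> carrier_vec n" "vec_norm2 x = 1" by (auto simp: S_def)
    have "\<bar>x \<bullet> (M *\<^sub>v x)\<bar> \<le> vec_norm2 x * vec_norm2 (M *\<^sub>v x)"
      using M x by (intro Cauchy_Schwarz_vec_norm2[of _ n]) auto
    also have "\<dots> \<le> mat_norm2 M" using vec_norm2_mult_mat_vec_le[OF M x(1)] x by simp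
    finally show "- mat_norm2 M \<le> x \<bullet> (M *\<^sub>v x)" by linarith
  qed
  have low: "m * (vec_norm2 x)\<^sup>2 \<le> x \<bullet> (M *\<^sub>v x)" if x: "x \<in> carrier_vec n" for x
  proof (cases "vec_norm2 x = 0")
    case True
    then have "x = 0\<^sub>v n" using x vec_norm2_eq_0 by blast
    then show ?thesis using M by (simp add: mult_mat_vec_zero)
  next
    case False
    then have pos: "vec_norm2 x > 0" using vec_norm2_nonneg[of x] by linarith
    define z where "z = (1 / vec_norm2 x) \<cdot>\<^sub>v x"
    have z: "z \<in> S" using x pos by (auto simp: z_def S_def vec_norm2_smult)
    have "m \<le> z \<bullet> (M *\<^sub>v z)" unfolding m_def by (rule cINF_lower[OF bdd z])
    also have "\<dots> = (1 / vec_norm2 x) * ((1 / vec_norm2 x) * (x \<bullet> (M *\<^sub>v x)))"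
      using M x by (simp add: z_def mult_mat_vec[of _ n n])
    finally show ?thesis using pos by (simp add: field_simps power2_eq_square)
  qed
  define N where "N = char_matrix M m"
  have N: "N \<in> carrier_mat n n" using M by (simp add: N_def)
  have Nx: "N *\<^sub>v x = M *\<^sub>v x - m \<cdot>\<^sub>v x" if "x \<in> carrier_vec n" for x
    using M that unfolding N_def char_matrix_def
    by (intro eq_vecI) (auto simp: add_scalar_prod_distrib[of _ n])
  have symN: "transpose_mat N = N"
    using sym M unfolding N_def char_matrix_def
    by (intro eq_matI) (auto simp: mat_eq_iff)
  have form: "x \<bullet> (N *\<^sub>v x) = x \<bullet> (M *\<^sub>v x) - m * (vec_norm2 x)\<^sup>2" if "x \<in> carrier_vec n" for x
    using M that by (simp add: Nx scalar_prod_minus_distrib[of _ n] scalar_prod_self)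
  have psd: "0 \<le> x \<bullet> (N *\<^sub>v x)" if "x \<in> carrier_vec n" for x using form low that by simp
  have "eigenvalue M m"
  proof (rule ccontr)
    assume "\<not> eigenvalue M m"
    then obtain B where B: "B \<in> carrier_mat n n" "B * N = 1\<^sub>m n"
      using injective_mat_has_inverse[OF N] unfolding eigenvalue_char_matrix[OF M] N_def by blast
    \<comment> \<open>On the unit sphere 1 <= |B| |N x|, and |N x|^2 is at most |N| + 1 times the
      form of \<open>N\<close>; so that form is at least 1 / c there.\<close>
    define c where "c = (mat_norm2 B + 1)\<^sup>2 * (mat_norm2 N + 1)"
    have c: "c > 0" unfolding c_def
      by (intro mult_pos_pos zero_less_power add_nonneg_pos mat_norm2_nonneg) auto
    have "m + 1 / c \<le> x \<bullet> (M *\<^sub>v x)" if "x \<in> S" for x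
    proof -
      have x: "x \<in> carrier_vec n" "vec_norm2 x = 1" using that by (auto simp: S_def)
      have "x = B *\<^sub>v (N *\<^sub>v x)" using mult_mat_vec_cancel[OF B(1) N B(2) x(1)] by simp
      then have "1 \<le> mat_norm2 B * vec_norm2 (N *\<^sub>v x)"
        using vec_norm2_mult_mat_vec_le[OF B(1), of "N *\<^sub>v x"] N x by simp
      also have "\<dots> \<le> (mat_norm2 B + 1) * vec_norm2 (N *\<^sub>v x)" by (intro mult_right_mono) auto
      finally have "1 \<le> ((mat_norm2 B + 1) * vec_norm2 (N *\<^sub>v x))\<^sup>2" by simp
      also have "\<dots> \<le> (mat_norm2 B + 1)\<^sup>2 * ((mat_norm2 N + 1) * (x \<bullet> (N *\<^sub>v x)))"
        using psd_norm_mult_le[OF N symN psd x(1)] by (simp add: power_mult_distrib mult_left_mono)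
      finally have "1 \<le> c * (x \<bullet> (M *\<^sub>v x) - m)"
        using x by (simp add: c_def form mult.assoc)
      then show ?thesis using c by (simp add: field_simps)
    qed
    then have "m + 1 / c \<le> m" unfolding m_def by (rule cINF_greatest[OF ne])
    then show False using c by (simp add: field_simps)
  qed
  then show ?thesis using low that by blast
qed

text \<open>Turns the spectral definition of \<open>sigma_min\<close> into the inequality used from
  here on: the least Rayleigh quotient of P P^T is an eigenvalue, so its root is among those
  minimised in \<open>sigma_min\<close>.\<close>

lemma sigma_min_lower_bound:
  assumes P: "P \<in> carrier_mat r D" and r: "0 < r" and \<gamma>: "0 < \<gamma>" "\<gamma> \<le> sigma_min P"
    and x: "x \<in> carrier_vec r"
  shows "\<gamma> * vec_norm2 x \<le> vec_norm2 (transpose_mat P *\<^sub>v x)"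
proof -
  define M where "M = P * transpose_mat P"
  have M: "M \<in> carrier_mat r r" using P by (simp add: M_def)
  have sym: "transpose_mat M = M" unfolding M_def using P by (simp add: transpose_mult[of _ r D _ r])
  have form: "y \<bullet> (M *\<^sub>v y) = (vec_norm2 (transpose_mat P *\<^sub>v y))\<^sup>2" if y: "y \<in> carrier_vec r" for y
  proof -
    have "y \<bullet> (M *\<^sub>v y) = y \<bullet> (P *\<^sub>v (transpose_mat P *\<^sub>v y))"
      using P y by (simp add: M_def assoc_mult_mat_vec[of _ r D _ r])
    also have "\<dots> = (transpose_mat P *\<^sub>v y) \<bullet> (transpose_mat P *\<^sub>v y)"
      using P y by (subst scalar_prod_transpose[of P r D]) auto
    finally show ?thesis by (simp add: scalar_prod_self)
  qed
  obtain m where m: "eigenvalue M m"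
    and low: "\<And>x. x \<in> carrier_vec r \<Longrightarrow> m * (vec_norm2 x)\<^sup>2 \<le> x \<bullet> (M *\<^sub>v x)"
    using rayleigh_min_eigenvalue[OF M sym r] by blast
  have "sqrt m \<ge> Min (sqrt ` spectrum M)"
    using m card_finite_spectrum(1)[OF M] by (intro Min_le) (auto simp: spectrum_def)
  then have g: "\<gamma> \<le> sqrt m" using \<gamma> by (simp add: sigma_min_def M_def)
  then have "0 < m" using \<gamma>(1) by (metis less_le_trans real_sqrt_gt_0_iff)
  then have "\<gamma>\<^sup>2 \<le> m" using power_mono[OF g, of 2] \<gamma>(1) by simp
  then have "\<gamma>\<^sup>2 * (vec_norm2 x)\<^sup>2 \<le> m * (vec_norm2 x)\<^sup>2" by (intro mult_right_mono) auto
  also have "\<dots> \<le> (vec_norm2 (transpose_mat P *\<^sub>v x))\<^sup>2" using low[OF x] form[OF x] by simp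
  finally show ?thesis
    by (intro power2_le_imp_le[of "\<gamma> * vec_norm2 x"]) (auto simp: power_mult_distrib)
qed

text \<open>\<open>THE\<close> needs a unique solution. Existence: P^T times the inverse of P P^T,
  which is injective by the lower bound. Uniqueness: any solution \<open>Y\<close> is a right
  inverse as well, and \<open>Y * P\<close>, \<open>X * P\<close> are symmetric with each product
  equal to its left factor, hence they coincide.\<close>

lemma pinv_full_row_rank:
  assumes P: "P \<in> carrier_mat r D" and \<gamma>: "0 < \<gamma>"
    and low: "\<And>x. x \<in> carrier_vec r \<Longrightarrow> \<gamma> * vec_norm2 x \<le> vec_norm2 (transpose_mat P *\<^sub>v x)"
  shows "pinv P \<in> carrier_mat D r" "P * pinv P = 1\<^sub>m r"
    "\<exists>B\<in>carrier_mat r r. pinv P = transpose_mat P * B"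
proof -
  define M where "M = P * transpose_mat P"
  have M: "M \<in> carrier_mat r r" using P by (simp add: M_def)
  have symM: "transpose_mat M = M" unfolding M_def using P by (simp add: transpose_mult[of _ r D _ r])
  have "x = 0\<^sub>v r" if x: "x \<in> carrier_vec r" and "M *\<^sub>v x = 0\<^sub>v r" for x
  proof -
    have "(transpose_mat P *\<^sub>v x) \<bullet> (transpose_mat P *\<^sub>v x) = x \<bullet> (P *\<^sub>v (transpose_mat P *\<^sub>v x))"
      using P x by (subst scalar_prod_transpose[of P r D]) auto
    also have "P *\<^sub>v (transpose_mat P *\<^sub>v x) = M *\<^sub>v x"
      using P x by (simp add: M_def assoc_mult_mat_vec[of _ r D _ r])
    finally have "vec_norm2 (transpose_mat P *\<^sub>v x) = 0" using that by (simp add: vec_norm2_def)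
    then have "vec_norm2 x = 0" using low[OF x] \<gamma>
      by (metis antisym mult_le_0_iff not_le vec_norm2_nonneg)
    then show ?thesis using x vec_norm2_eq_0 by blast
  qed
  then obtain B where B: "B \<in> carrier_mat r r" "B * M = 1\<^sub>m r" "M * B = 1\<^sub>m r"
    using injective_mat_has_inverse[OF M] by blast
  have symB: "transpose_mat B = B"
  proof -
    have BT: "transpose_mat B * M = 1\<^sub>m r"
      using arg_cong[OF B(3), of transpose_mat] M B(1) symM by (simp add: transpose_mult[of _ r r _ r])
    have "transpose_mat B = transpose_mat B * (M * B)" using B by simp
    also have "\<dots> = (transpose_mat B * M) * B" using B M by (simp add: assoc_mult_mat[of _ r r _ r])
    finally show ?thesis using BT B by simp
  qed
  define X where "X = transpose_mat P * B"
  have X: "X \<in> carrier_mat D r" using P B by (simp add: X_def)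
  have PX: "P * X = 1\<^sub>m r"
  proof -
    have "P * X = M * B" unfolding X_def M_def using P B by (intro assoc_mult_mat[symmetric]) auto
    then show ?thesis using B by simp
  qed
  have XPsym: "transpose_mat (X * P) = X * P"
  proof -
    have BP: "B * P \<in> carrier_mat r D" using P B by simp
    have XP: "X * P = transpose_mat P * (B * P)"
      unfolding X_def using P B by (intro assoc_mult_mat) auto
    have "transpose_mat (X * P) = transpose_mat (B * P) * P"
      unfolding XP using P BP by (subst transpose_mult[of _ D r _ D]) auto
    also have "transpose_mat (B * P) = X"
      unfolding X_def using transpose_mult[OF B(1) P] symB by simp
    finally show ?thesis .
  qed
  have "pinv P = X"
    unfolding pinv_def
  proof (rule the_equality)
    show "X \<in> carrier_mat (dim_col P) (dim_row P) \<and> P * X * P = P \<and> X * P * X = X \<and>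
      transpose_mat (P * X) = P * X \<and> transpose_mat (X * P) = X * P"
      using X P PX XPsym by (auto simp: assoc_mult_mat[of _ D r _ D _ r])
    fix Y assume a: "Y \<in> carrier_mat (dim_col P) (dim_row P) \<and> P * Y * P = P \<and> Y * P * Y = Y \<and>
      transpose_mat (P * Y) = P * Y \<and> transpose_mat (Y * P) = Y * P"
    then have Y: "Y \<in> carrier_mat D r" using P by simp
    have PY: "P * Y = 1\<^sub>m r"
    proof -
      have "P * Y = P * Y * (P * X)" using PX P Y by simp
      also have "\<dots> = P * Y * P * X"
        using P X Y by (intro assoc_mult_mat[symmetric, of _ r r _ D _ r]) auto
      finally show ?thesis using a PX by simp
    qed
    have YP: "Y * P \<in> carrier_mat D D" and XP: "X * P \<in> carrier_mat D D" using P X Y by auto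
    have 1: "(Y * P) * (X * P) = Y * P"
    proof -
      have "(Y * P) * (X * P) = Y * (P * (X * P))" 
        using P X Y by (intro assoc_mult_mat[of _ D r _ D _ D]) auto
      also have "P * (X * P) = (P * X) * P" 
        using P X by (intro assoc_mult_mat[symmetric, of _ r D _ r _ D]) auto
      finally show ?thesis using PX P by simp
    qed
    have 2: "(X * P) * (Y * P) = X * P"
    proof -
      have "(X * P) * (Y * P) = X * (P * (Y * P))" 
        using P X Y by (intro assoc_mult_mat[of _ D r _ D _ D]) auto
      also have "P * (Y * P) = (P * Y) * P" 
        using P Y by (intro assoc_mult_mat[symmetric, of _ r D _ r _ D]) auto
      finally show ?thesis using PY P by simp
    qed
    have "Y * P = transpose_mat ((Y * P) * (X * P))" using 1 a by simp
    also have "\<dots> = (X * P) * (Y * P)"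
      using transpose_mult[OF YP XP] XPsym a by simp
    finally have eq: "Y * P = X * P" using 2 by simp
    have "Y = (Y * P) * Y" using a by simp
    also have "\<dots> = X * (P * Y)" 
      unfolding eq using P X Y by (intro assoc_mult_mat[of _ D r _ D _ r]) auto
    finally show "Y = X" using PY X by simp
  qed
  then show "pinv P \<in> carrier_mat D r" "P * pinv P = 1\<^sub>m r"
    "\<exists>B\<in>carrier_mat r r. pinv P = transpose_mat P * B"
    using X PX B(1) X_def by auto
qed

text \<open>The vector y = pinv P b has the form P^T z and satisfies P y = b, so |y|^2 = <z, b> <=
  |z| |b|, while the lower bound for P^T gives |z| <= |y| / \<gamma>.\<close>

lemma vec_norm2_pinv_le:
  assumes P: "P \<in> carrier_mat r D" and \<gamma>: "0 < \<gamma>"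
    and low: "\<And>x. x \<in> carrier_vec r \<Longrightarrow> \<gamma> * vec_norm2 x \<le> vec_norm2 (transpose_mat P *\<^sub>v x)"
    and b: "b \<in> carrier_vec r"
  shows "vec_norm2 (pinv P *\<^sub>v b) \<le> vec_norm2 b / \<gamma>"
proof -
  obtain B where B: "B \<in> carrier_mat r r" "pinv P = transpose_mat P * B"
    using pinv_full_row_rank(3)[OF P \<gamma> low] by blast
  note X = pinv_full_row_rank(1)[OF P \<gamma> low] and PX = pinv_full_row_rank(2)[OF P \<gamma> low]
  define y where "y = pinv P *\<^sub>v b"
  define z where "z = B *\<^sub>v b"
  have y: "y \<in> carrier_vec D" and z: "z \<in> carrier_vec r" using X B b by (auto simp: y_def z_def)
  have yz: "y = transpose_mat P *\<^sub>v z"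
    unfolding y_def z_def B(2) using P B(1) b by (intro assoc_mult_mat_vec[of _ D r _ r]) auto
  have "P *\<^sub>v y = b" unfolding y_def by (rule mult_mat_vec_cancel[OF P X PX b])
  then have "(vec_norm2 y)\<^sup>2 = z \<bullet> b"
    using scalar_prod_transpose[OF P z y] by (simp add: yz[symmetric] scalar_prod_self)
  also have "\<dots> \<le> vec_norm2 z * vec_norm2 b" using Cauchy_Schwarz_vec_norm2[OF z b] by simp
  also have "\<dots> \<le> (vec_norm2 y / \<gamma>) * vec_norm2 b"
    using low[OF z] \<gamma> by (intro mult_right_mono) (auto simp: yz field_simps)
  finally have "vec_norm2 y * vec_norm2 y \<le> (vec_norm2 b / \<gamma>) * vec_norm2 y"
    by (simp add: power2_eq_square mult_ac)
  then show ?thesis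
  proof (cases "vec_norm2 y = 0")
    case False
    then have "0 < vec_norm2 y" using vec_norm2_nonneg[of y] by linarith
    with \<open>vec_norm2 y * vec_norm2 y \<le> _\<close> show ?thesis unfolding y_def[symmetric]
      by (rule mult_right_le_imp_le)
  qed (use \<gamma> in \<open>simp add: y_def\<close>)
qed

text \<open>Subtracting the second summand from \<open>v\<close> leaves a vector of the kernel, that
  is, of the range of \<open>U\<close>. And U^T kills the second summand, since the range of the
  pseudoinverse lies in that of P^T, which is orthogonal to the kernel.\<close>

lemma kernel_basis_decomposition:
  assumes P: "P \<in> carrier_mat r D" and \<gamma>: "0 < \<gamma>"
    and low: "\<And>x. x \<in> carrier_vec r \<Longrightarrow> \<gamma> * vec_norm2 x \<le> vec_norm2 (transpose_mat P *\<^sub>v x)"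
    and U: "U \<in> carrier_mat D d" and basis: "orthonormal_kernel_basis P U"
    and v: "v \<in> carrier_vec D"
  shows "v = U *\<^sub>v (transpose_mat U *\<^sub>v v) + pinv P *\<^sub>v (P *\<^sub>v v)"
proof -
  obtain B where B: "B \<in> carrier_mat r r" "pinv P = transpose_mat P * B"
    using pinv_full_row_rank(3)[OF P \<gamma> low] by blast
  note X = pinv_full_row_rank(1)[OF P \<gamma> low] and PX = pinv_full_row_rank(2)[OF P \<gamma> low]
  have UU: "transpose_mat U * U = 1\<^sub>m d" and space: "vec_space.col_space D U = mat_kernel P"
    using basis U P by (auto simp: orthonormal_kernel_basis_def)
  have image: "mat_kernel P = {y \<in> carrier_vec D. \<exists>x\<in>carrier_vec d. U *\<^sub>v x = y}"
    using vec_space.col_space_eq[OF U] U space by simp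
  have PU: "P *\<^sub>v (U *\<^sub>v a) = 0\<^sub>v r" if "a \<in> carrier_vec d" for a
  proof -
    have "U *\<^sub>v a \<in> mat_kernel P" using image U that by auto
    then show ?thesis using mat_kernelD[OF P] by auto
  qed
  have UTP: "transpose_mat U *\<^sub>v (transpose_mat P *\<^sub>v z) = 0\<^sub>v d" if z: "z \<in> carrier_vec r" for z
  proof -
    let ?a = "transpose_mat U *\<^sub>v (transpose_mat P *\<^sub>v z)"
    have a: "?a \<in> carrier_vec d" using U P z by simp
    have "?a \<bullet> ?a = (transpose_mat P *\<^sub>v z) \<bullet> (U *\<^sub>v ?a)"
      using scalar_prod_transpose[OF U _ a, of "transpose_mat P *\<^sub>v z"] P z by simp
    also have "\<dots> = z \<bullet> (P *\<^sub>v (U *\<^sub>v ?a))"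
      using scalar_prod_transpose[OF P z, of "U *\<^sub>v ?a"] U a by simp
    also have "\<dots> = 0" using PU[OF a] z by simp
    finally have "vec_norm2 ?a = 0" by (simp add: vec_norm2_def)
    then show ?thesis using a vec_norm2_eq_0 by blast
  qed
  define b where "b = P *\<^sub>v v"
  define w where "w = pinv P *\<^sub>v b"
  have b: "b \<in> carrier_vec r" and w: "w \<in> carrier_vec D" using P X v by (auto simp: b_def w_def)
  have Uw: "transpose_mat U *\<^sub>v w = 0\<^sub>v d"
  proof -
    have "w = transpose_mat P *\<^sub>v (B *\<^sub>v b)"
      unfolding w_def B(2) using P B(1) b by (intro assoc_mult_mat_vec[of _ D r _ r]) auto
    then show ?thesis using UTP[of "B *\<^sub>v b"] B b by simp
  qed
  have "P *\<^sub>v w = b" unfolding w_def by (rule mult_mat_vec_cancel[OF P X PX b])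
  then have "P *\<^sub>v (v - w) = 0\<^sub>v r"
    using P v w b by (simp add: mult_minus_distrib_mat_vec[of _ r D] b_def)
  then have "v - w \<in> mat_kernel P" using P v w by (intro mat_kernelI) auto
  then obtain a where a: "a \<in> carrier_vec d" "U *\<^sub>v a = v - w" using image by auto
  have "transpose_mat U *\<^sub>v v = transpose_mat U *\<^sub>v (v - w)"
    using U v w Uw by (simp add: mult_minus_distrib_mat_vec[of _ d D])
  also have "\<dots> = a"
    unfolding a(2)[symmetric] using U by (intro mult_mat_vec_cancel[OF _ U UU a(1)]) simp
  finally have "U *\<^sub>v (transpose_mat U *\<^sub>v v) = v - w" using a by simp
  then show ?thesis using v w X by (auto simp: w_def b_def intro!: eq_vecI)
qed

lemma matching_mult_append:
  assumes U: "U \<in> carrier_mat D d" and X: "pinv P \<in> carrier_mat D r"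
    and a: "a \<in> carrier_vec d" and b: "b \<in> carrier_vec r"
  shows "matching U P *\<^sub>v (a @\<^sub>v b) = U *\<^sub>v a + pinv P *\<^sub>v b"
proof (rule eq_vecI)
  have dims: "dim_row U = D" "dim_col U = d" "dim_row (pinv P) = D" "dim_col (pinv P) = r"
    using U X by auto
  show "dim_vec (matching U P *\<^sub>v (a @\<^sub>v b)) = dim_vec (U *\<^sub>v a + pinv P *\<^sub>v b)"
    using dims by (simp add: matching_def)
  fix i assume "i < dim_vec (U *\<^sub>v a + pinv P *\<^sub>v b)"
  then have i: "i < D" using dims by simp
  have ri: "Matrix.row (matching U P) i = Matrix.row U i @\<^sub>v Matrix.row (pinv P) i"
    using i dims by (intro eq_vecI) (auto simp: matching_def mat_of_cols_index nth_append)
  have "(matching U P *\<^sub>v (a @\<^sub>v b)) $ i = (Matrix.row U i @\<^sub>v Matrix.row (pinv P) i) \<bullet> (a @\<^sub>v b)"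
    using i dims by (simp add: ri[symmetric] matching_def)
  also have "\<dots> = Matrix.row U i \<bullet> a + Matrix.row (pinv P) i \<bullet> b"
    using U X a b by (intro scalar_prod_append[of _ d _ r]) auto
  finally show "(matching U P *\<^sub>v (a @\<^sub>v b)) $ i = (U *\<^sub>v a + pinv P *\<^sub>v b) $ i"
    using i dims by simp
qed

lemma vec_norm2_append_le: "vec_norm2 (a @\<^sub>v b) \<le> vec_norm2 a + vec_norm2 b"
proof -
  have "(a @\<^sub>v b) \<bullet> (a @\<^sub>v b) = a \<bullet> a + b \<bullet> b"
    by (rule scalar_prod_append[OF carrier_vec_dim_vec carrier_vec_dim_vec carrier_vec_dim_vec carrier_vec_dim_vec])
  then have "(vec_norm2 (a @\<^sub>v b))\<^sup>2 = (vec_norm2 a)\<^sup>2 + (vec_norm2 b)\<^sup>2"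
    by (simp add: scalar_prod_self)
  also have "\<dots> \<le> (vec_norm2 a + vec_norm2 b)\<^sup>2" by (simp add: power2_sum)
  finally show ?thesis by (rule power2_le_imp_le) simp
qed

text \<open>The defect measures matrices after multiplication by \<open>matching\<close>. Since a
  vector is \<open>matching\<close> applied to its two stacked components, such a norm bounds the
  image of the vector by the sizes of the components.\<close>

lemma vec_norm2_mult_matching_le:
  assumes E: "E \<in> carrier_mat s D" and U: "U \<in> carrier_mat D d" and X: "pinv P \<in> carrier_mat D r"
    and a: "a \<in> carrier_vec d" and b: "b \<in> carrier_vec r"
  shows "vec_norm2 (E *\<^sub>v (U *\<^sub>v a + pinv P *\<^sub>v b)) \<le>
    mat_norm2 (E * matching U P) * (vec_norm2 a + vec_norm2 b)"
proof -
  have S: "matching U P \<in> carrier_mat D (d + r)" using U X by (auto simp: matching_def)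
  have ab: "a @\<^sub>v b \<in> carrier_vec (d + r)" using a b by simp
  have "E *\<^sub>v (U *\<^sub>v a + pinv P *\<^sub>v b) = (E * matching U P) *\<^sub>v (a @\<^sub>v b)"
    unfolding matching_mult_append[OF U X a b, symmetric]
    using E S ab by (intro assoc_mult_mat_vec[symmetric]) auto
  also have "vec_norm2 \<dots> \<le> mat_norm2 (E * matching U P) * vec_norm2 (a @\<^sub>v b)"
    using E S ab by (intro vec_norm2_mult_mat_vec_le) auto
  also have "\<dots> \<le> mat_norm2 (E * matching U P) * (vec_norm2 a + vec_norm2 b)"
    by (intro mult_left_mono vec_norm2_append_le) simp
  finally show ?thesis .
qed

section \<open>Chronological products\<close>

text \<open>Fekete's lemma in multiplicative form. The radius is defined by \<open>lim\<close>,
  which says something only once convergence is known.\<close>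

lemma submultiplicative_root_tendsto:
  fixes u :: "nat \<Rightarrow> real"
  assumes nonneg: "\<And>m. 0 \<le> u m" and sub: "\<And>m n. u (m + n) \<le> u m * u n"
  shows "(\<lambda>m. root m (u m)) \<longlonglongrightarrow> (INF m\<in>{1..}. root m (u m))"
proof -
  define L where "L = (INF m\<in>{1..}. root m (u m))"
  have bdd: "bdd_below ((\<lambda>m. root m (u m)) ` {1..})"
    using nonneg by (intro bdd_belowI2[of _ 0]) auto
  have L0: "0 \<le> L" unfolding L_def using nonneg by (intro cINF_greatest) auto
  have "(\<lambda>m. root m (u m)) \<longlonglongrightarrow> L"
  proof (rule order_tendstoI)
    fix a assume "a < L"
    moreover have "L \<le> root m (u m)" if "m \<ge> 1" for m
      unfolding L_def using that by (intro cINF_lower[OF bdd]) auto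
    ultimately show "eventually (\<lambda>m. a < root m (u m)) sequentially"
      by (intro eventually_sequentiallyI[of 1]) (meson less_le_trans)
  next
    fix a assume "L < a"
    define s where "s = (L + a) / 2"
    have s: "L < s" "s < a" "0 < s" using \<open>L < a\<close> L0 by (auto simp: s_def)
    obtain M where M: "M \<ge> 1" "root M (u M) < s"
      using s(1) cINF_less_iff[OF _ bdd] unfolding L_def by auto
    have uM: "u M \<le> s ^ M"
    proof -
      have "u M = root M (u M) ^ M" using M nonneg by simp
      also have "\<dots> \<le> s ^ M" using M nonneg by (intro power_mono) auto
      finally show ?thesis .
    qed
    \<comment> \<open>Strong induction strips blocks of length \<open>M\<close>, each costing at
      most \<open>s ^ M\<close>; \<open>C\<close> covers the remainder shorter than
      \<open>M\<close>, and its n-th root tends to 1.\<close>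
    define C where "C = 1 + (\<Sum>b<M. u b / s ^ b)"
    have C1: "1 \<le> C" unfolding C_def using nonneg s by (auto intro!: sum_nonneg divide_nonneg_pos)
    have bound: "u n \<le> C * s ^ n" for n
    proof (induction n rule: less_induct)
      case (less n)
      show ?case
      proof (cases "n < M")
        case True
        have "u n / s ^ n \<le> (\<Sum>b<M. u b / s ^ b)"
          using True nonneg s by (intro member_le_sum) auto
        then have "u n / s ^ n \<le> C" by (simp add: C_def)
        then show ?thesis using s by (simp add: divide_le_eq)
      next
        case False
        have "u n \<le> u M * u (n - M)" using sub[of M "n - M"] False by simp
        also have "\<dots> \<le> s ^ M * (C * s ^ (n - M))"
          using uM less.IH[of "n - M"] M False nonneg s by (intro mult_mono) auto
        also have "\<dots> = C * s ^ n" using False by (simp flip: power_add)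
        finally show ?thesis .
      qed
    qed
    have "(\<lambda>n. root n C * s) \<longlonglongrightarrow> 1 * s"
      using C1 by (intro tendsto_mult LIMSEQ_root_const tendsto_const) auto
    then have "eventually (\<lambda>n. root n C * s < a) sequentially"
      using s by (intro order_tendstoD(2)[of _ "1 * s"]) auto
    moreover have "root n (u n) \<le> root n C * s" if "n \<ge> 1" for n
    proof -
      have "root n (u n) \<le> root n (C * s ^ n)" using bound that by (intro real_root_le_mono) auto
      also have "\<dots> = root n C * s" using that s by (simp add: real_root_mult real_root_power_cancel)
      finally show ?thesis .
    qed
    ultimately have "eventually (\<lambda>n. root n (u n) < a) sequentially"
      using eventually_conj[OF _ eventually_ge_at_top[of "1::nat"]]
      by (rule_tac eventually_mono[of "\<lambda>n. root n C * s < a \<and> 1 \<le> n"]) (auto intro: le_less_trans)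
    then show "eventually (\<lambda>m. root m (u m) < a) sequentially" .
  qed
  then show ?thesis by (simp add: L_def)
qed

lemma submultiplicative_geometric_bound:
  fixes u :: "nat \<Rightarrow> real"
  assumes nonneg: "\<And>m. 0 \<le> u m" and sub: "\<And>m n. u (m + n) \<le> u m * u n"
    and q: "lim (\<lambda>m. root m (u m)) < q"
  shows "0 \<le> lim (\<lambda>m. root m (u m))" "\<exists>K\<ge>1. \<forall>m. u m \<le> K * q ^ m"
proof -
  let ?L = "lim (\<lambda>m. root m (u m))"
  have lim: "(\<lambda>m. root m (u m)) \<longlonglongrightarrow> ?L"
    using submultiplicative_root_tendsto[OF nonneg sub] limI by metis
  show L0: "0 \<le> ?L" using lim nonneg
    by (intro LIMSEQ_le_const[OF lim] exI[of _ 1] allI impI real_root_ge_zero) auto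
  have q0: "q > 0" using L0 q by linarith
  obtain N where N: "\<And>m. m \<ge> N \<Longrightarrow> root m (u m) < q"
    using order_tendstoD(2)[OF lim q] by (auto simp: eventually_sequentially)
  \<comment> \<open>From \<open>N\<close> on the root is below \<open>q\<close>; the finitely many
    earlier terms are absorbed by the constant.\<close>
  define K where "K = 1 + (\<Sum>b<Suc N. u b / q ^ b)"
  have K1: "1 \<le> K" unfolding K_def using sum_nonneg[of "{..<Suc N}" "\<lambda>b. u b / q ^ b"] nonneg q0 by simp
  have "u m \<le> K * q ^ m" for m
  proof (cases "m < Suc N")
    case True
    have "u m / q ^ m \<le> (\<Sum>b<Suc N. u b / q ^ b)"
      using True nonneg q0 by (intro member_le_sum) auto
    then have "u m / q ^ m \<le> K" by (simp add: K_def)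
    then show ?thesis using q0 by (simp add: divide_le_eq)
  next
    case False
    then have "u m = root m (u m) ^ m" using nonneg by simp
    also have "\<dots> \<le> q ^ m" using N[of m] False nonneg by (intro power_mono) auto
    also have "\<dots> \<le> K * q ^ m" using K1 q0 by simp
    finally show ?thesis .
  qed
  then show "\<exists>K\<ge>1. \<forall>m. u m \<le> K * q ^ m" using K1 by blast
qed

definition binary_family :: "nat \<Rightarrow> (nat \<Rightarrow> nat \<Rightarrow> real mat) \<Rightarrow> bool" where
  "binary_family d C \<longleftrightarrow> (\<forall>k\<ge>1. \<forall>e\<in>{0, 1}. C k e \<in> carrier_mat d d)"

lemma binary_familyD: "binary_family d C \<Longrightarrow> k \<ge> 1 \<Longrightarrow> e \<in> {0, 1} \<Longrightarrow> C k e \<in> carrier_mat d d"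
  unfolding binary_family_def by blast

lemma chrono_prod_carrier:
  assumes "binary_family d C"
    and "a \<ge> 1" "set es \<subseteq> {0, 1}"
  shows "chrono_prod d C a es \<in> carrier_mat d d"
  using assms(2,3)
proof (induction es arbitrary: a)
  case (Cons e es)
  then show ?case using binary_familyD[OF assms(1), of a e] Cons.IH[of "Suc a"] by auto
qed simp

lemma chrono_prod_append:
  assumes C: "binary_family d C"
    and "a \<ge> 1" "set es \<subseteq> {0, 1}" "set fs \<subseteq> {0, 1}"
  shows "chrono_prod d C a (es @ fs) = chrono_prod d C a es * chrono_prod d C (a + length es) fs"
  using assms(2,3)
proof (induction es arbitrary: a)
  case Nil
  then show ?case using chrono_prod_carrier[OF C, of a fs] assms(4) by simp
next
  case (Cons e es)
  have "chrono_prod d C a ((e # es) @ fs) =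
      C a e * (chrono_prod d C (Suc a) es * chrono_prod d C (Suc a + length es) fs)"
    using Cons by simp
  also have "\<dots> = (C a e * chrono_prod d C (Suc a) es) * chrono_prod d C (Suc a + length es) fs"
    using binary_familyD[OF C, of a e] Cons.prems assms(4) chrono_prod_carrier[OF C]
    by (intro assoc_mult_mat[symmetric, of _ d d _ d _ d]) auto
  finally show ?case by simp
qed

lemma chrono_prod_norm_le_power:
  assumes C: "binary_family d C"
    and \<beta>: "\<forall>k\<ge>1. \<forall>e\<in>{0, 1}. mat_norm2 (C k e) \<le> \<beta>"
    and "a \<ge> 1" "set es \<subseteq> {0, 1}"
  shows "mat_norm2 (chrono_prod d C a es) \<le> \<beta> ^ length es"
  using assms(3,4)
proof (induction es arbitrary: a)
  case Nil
  then show ?case by (simp add: mat_norm2_one_le)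
next
  case (Cons e es)
  have \<beta>0: "0 \<le> \<beta>" using \<beta> order_trans[OF mat_norm2_nonneg[of "C 1 0"], of \<beta>] by auto
  have "mat_norm2 (chrono_prod d C a (e # es)) \<le>
      mat_norm2 (C a e) * mat_norm2 (chrono_prod d C (Suc a) es)"
    using binary_familyD[OF C, of a e] Cons.prems chrono_prod_carrier[OF C, of "Suc a" es]
    by (auto intro!: mat_norm2_mult_le)
  also have "\<dots> \<le> \<beta> * \<beta> ^ length es"
    using \<beta> Cons \<beta>0 by (intro mult_mono) auto
  finally show ?case by simp
qed

lemma finite_binary_lists: "finite {es :: nat list. set es \<subseteq> {0, 1} \<and> length es = m}"
  by (rule finite_lists_length_eq) simp

lemma binary_lists_nonempty: "{es :: nat list. set es \<subseteq> {0, 1} \<and> length es = m} \<noteq> {}"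
  by (auto intro!: exI[of _ "replicate m 0"] split: if_splits)

text \<open>The uniform bound \<beta> on the factors keeps the supremum over the starting levels
  finite.\<close>

lemma chrono_sup_upper:
  assumes C: "binary_family d C"
    and \<beta>: "\<forall>k\<ge>1. \<forall>e\<in>{0, 1}. mat_norm2 (C k e) \<le> \<beta>"
    and "a \<ge> 1" "set es \<subseteq> {0, 1}"
  shows "mat_norm2 (chrono_prod d C a es) \<le> chrono_sup d C (length es)"
proof -
  let ?B = "\<lambda>m. {es :: nat list. set es \<subseteq> {0, 1} \<and> length es = m}"
  let ?f = "\<lambda>a. Max ((\<lambda>es. mat_norm2 (chrono_prod d C a es)) ` ?B (length es))"
  have "?f a \<le> \<beta> ^ length es" if "a \<ge> 1" for a
    using finite_binary_lists[of "length es"] binary_lists_nonempty[of "length es"]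
      chrono_prod_norm_le_power[OF C \<beta> that]
    by (subst Max_le_iff) (auto, metis)
  then have bdd: "bdd_above (?f ` {1..})" by (intro bdd_aboveI2) auto
  have "mat_norm2 (chrono_prod d C a es) \<le> ?f a"
    using assms(4) finite_binary_lists by (intro Max_ge) auto
  also have "\<dots> \<le> chrono_sup d C (length es)"
    unfolding chrono_sup_def using assms(3) by (intro cSUP_upper[OF _ bdd]) auto
  finally show ?thesis .
qed

lemma chrono_sup_least:
  assumes "\<And>a es. a \<ge> 1 \<Longrightarrow> set es \<subseteq> {0, 1} \<Longrightarrow> length es = m \<Longrightarrow>
      mat_norm2 (chrono_prod d C a es) \<le> b"
  shows "chrono_sup d C m \<le> b"
  unfolding chrono_sup_def
  using assms finite_binary_lists binary_lists_nonempty
  by (intro cSUP_least) (auto simp: Max_le_iff)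

text \<open>Cutting a digit list after \<open>m\<close> entries splits the product, and the second
  factor starts at level a + m. The supremum over all starting levels covers it, which gives
  submultiplicativity.\<close>

lemma chrono_radius_decay:
  assumes C: "binary_family d C"
    and \<beta>: "\<forall>k\<ge>1. \<forall>e\<in>{0, 1}. mat_norm2 (C k e) \<le> \<beta>"
    and q: "chrono_radius d C < q"
  shows "0 \<le> chrono_radius d C"
    "\<exists>K\<ge>1. \<forall>a\<ge>1. \<forall>es. set es \<subseteq> {0, 1} \<longrightarrow> mat_norm2 (chrono_prod d C a es) \<le> K * q ^ length es"
proof -
  note up = chrono_sup_upper[OF C \<beta>]
  have nonneg: "0 \<le> chrono_sup d C m" for m
  proof -
    have "set (replicate m 0) \<subseteq> {0, 1::nat}" by (auto split: if_splits)
    from order_trans[OF mat_norm2_nonneg up[OF le_refl this]] show ?thesis by simp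
  qed
  have sub: "chrono_sup d C (m + n) \<le> chrono_sup d C m * chrono_sup d C n" for m n
  proof (rule chrono_sup_least)
    fix a es assume a: "(1::nat) \<le> a" "set es \<subseteq> {0, 1::nat}" "length es = m + n"
    let ?e = "take m es" and ?f = "drop m es"
    have sets: "set ?e \<subseteq> {0, 1}" "set ?f \<subseteq> {0, 1}"
      using a(2) by (auto dest!: in_set_takeD in_set_dropD)
    have "chrono_prod d C a es = chrono_prod d C a ?e * chrono_prod d C (a + length ?e) ?f"
      using chrono_prod_append[OF C a(1) sets] by simp
    also have "mat_norm2 \<dots> \<le> mat_norm2 (chrono_prod d C a ?e) * mat_norm2 (chrono_prod d C (a + length ?e) ?f)"
      using a sets chrono_prod_carrier[OF C] by (intro mat_norm2_mult_le[of _ d d _ d]) auto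
    also have "\<dots> \<le> chrono_sup d C (length ?e) * chrono_sup d C (length ?f)"
      using up[OF a(1) sets(1)] up[OF _ sets(2), of "a + length ?e"] a(1) nonneg
      by (intro mult_mono) (simp_all del: length_take length_drop)
    finally show "mat_norm2 (chrono_prod d C a es) \<le> chrono_sup d C m * chrono_sup d C n"
      using a by simp
  qed
  note * = submultiplicative_geometric_bound[OF nonneg sub q[unfolded chrono_radius_def]]
  show "0 \<le> chrono_radius d C" using *(1) by (simp add: chrono_radius_def)
  from *(2) obtain K where "K \<ge> 1" "\<forall>m. chrono_sup d C m \<le> K * q ^ m" by blast
  then show "\<exists>K\<ge>1. \<forall>a\<ge>1. \<forall>es. set es \<subseteq> {0, 1} \<longrightarrow>
      mat_norm2 (chrono_prod d C a es) \<le> K * q ^ length es"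
    using up by (meson order_trans)
qed

text \<open>
  A norm on level \<open>k\<close> for which every factor of a chronological product contracts by \<open>q\<close>; it is
  equivalent to the Euclidean norm with constants independent of the level.
\<close>
primrec adapted_norm :: "(nat \<Rightarrow> nat \<Rightarrow> real mat) \<Rightarrow> real \<Rightarrow> nat \<Rightarrow> real vec \<Rightarrow> real" where
  "adapted_norm C q 0 a = vec_norm2 a"
| "adapted_norm C q (Suc k) a = max (vec_norm2 a)
     (max (adapted_norm C q k (C (Suc k) 0 *\<^sub>v a)) (adapted_norm C q k (C (Suc k) 1 *\<^sub>v a)) / q)"

lemma vec_norm2_le_adapted_norm: "vec_norm2 a \<le> adapted_norm C q k a"
  by (cases k) auto

lemma adapted_norm_contract:
  assumes "0 < q" "e \<in> {0, 1}"
  shows "adapted_norm C q k (C (Suc k) e *\<^sub>v a) \<le> q * adapted_norm C q (Suc k) a"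
proof -
  have "adapted_norm C q k (C (Suc k) e *\<^sub>v a) / q \<le> adapted_norm C q (Suc k) a"
    using assms by (auto simp: divide_right_mono le_max_iff_disj)
  then show ?thesis using assms(1) by (simp add: divide_le_eq mult.commute)
qed

lemma adapted_norm_triangle:
  assumes C: "binary_family d C" and q: "0 < q"
    and "a \<in> carrier_vec d" "b \<in> carrier_vec d"
  shows "adapted_norm C q k (a + b) \<le> adapted_norm C q k a + adapted_norm C q k b"
  using assms(3,4)
proof (induction k arbitrary: a b)
  case 0
  then show ?case by (simp add: vec_norm2_triangle)
next
  case (Suc k)
  have *: "adapted_norm C q k (C (Suc k) e *\<^sub>v (a + b)) / q \<le>
      adapted_norm C q (Suc k) a + adapted_norm C q (Suc k) b" if e: "e \<in> {0, 1}" for e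
  proof -
    have Ce: "C (Suc k) e \<in> carrier_mat d d" using binary_familyD[OF C] e by simp
    have "adapted_norm C q k (C (Suc k) e *\<^sub>v (a + b)) \<le>
        adapted_norm C q k (C (Suc k) e *\<^sub>v a) + adapted_norm C q k (C (Suc k) e *\<^sub>v b)"
      using Suc.IH[of "C (Suc k) e *\<^sub>v a" "C (Suc k) e *\<^sub>v b"] Ce Suc.prems
      by (simp add: mult_add_distrib_mat_vec[OF Ce])
    also have "\<dots> \<le> q * adapted_norm C q (Suc k) a + q * adapted_norm C q (Suc k) b"
      by (intro add_mono adapted_norm_contract q e)
    finally show ?thesis using q by (simp add: divide_le_eq algebra_simps del: adapted_norm.simps)
  qed
  have "vec_norm2 (a + b) \<le> adapted_norm C q (Suc k) a + adapted_norm C q (Suc k) b"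
    using vec_norm2_triangle[OF Suc.prems] vec_norm2_le_adapted_norm[of a C q "Suc k"]
      vec_norm2_le_adapted_norm[of b C q "Suc k"] by linarith
  then show ?case
    unfolding adapted_norm.simps(2)[of C q k "a + b"]
    using *[of 0] *[of 1] q by (auto simp del: adapted_norm.simps simp: max_def)
qed

text \<open>Unfolded, the adapted norm is a maximum of norms of products of length j applied to
  \<open>x\<close>, divided by \<open>q ^ j\<close>, and \<open>K\<close> bounds each of
  them.\<close>

lemma adapted_norm_le:
  assumes C: "binary_family d C" and q: "0 < q"
    and K: "\<forall>a\<ge>1. \<forall>es. set es \<subseteq> {0, 1} \<longrightarrow> mat_norm2 (chrono_prod d C a es) \<le> K * q ^ length es"
    and x: "x \<in> carrier_vec d"
  shows "adapted_norm C q k x \<le> K * vec_norm2 x"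
proof -
  have prod: "vec_norm2 (chrono_prod d C a es *\<^sub>v x) \<le> (K * q ^ length es) * vec_norm2 x"
    if "a \<ge> 1" "set es \<subseteq> {0, 1}" for a es
  proof -
    have "vec_norm2 (chrono_prod d C a es *\<^sub>v x) \<le> mat_norm2 (chrono_prod d C a es) * vec_norm2 x"
      using chrono_prod_carrier[OF C that] x by (intro vec_norm2_mult_mat_vec_le) auto
    also have "\<dots> \<le> (K * q ^ length es) * vec_norm2 x"
      using K that by (intro mult_right_mono) auto
    finally show ?thesis .
  qed
  \<comment> \<open>The induction runs over the levels still to be descended, so the factors already
    applied are carried along as \<open>es\<close>.\<close>
  have "adapted_norm C q k (chrono_prod d C (Suc k) es *\<^sub>v x) \<le> K * q ^ length es * vec_norm2 x"
    if "set es \<subseteq> {0, 1}" for es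
    using that
  proof (induction k arbitrary: es)
    case 0
    then show ?case using prod[of 1 es] by simp
  next
    case (Suc k)
    have "adapted_norm C q k (C (Suc k) e *\<^sub>v (chrono_prod d C (Suc (Suc k)) es *\<^sub>v x)) / q \<le>
        K * q ^ length es * vec_norm2 x" if e: "e \<in> {0, 1}" for e
    proof -
      have "C (Suc k) e *\<^sub>v (chrono_prod d C (Suc (Suc k)) es *\<^sub>v x) = chrono_prod d C (Suc k) (e # es) *\<^sub>v x"
        using binary_familyD[OF C, of "Suc k" e] e x Suc.prems chrono_prod_carrier[OF C, of "Suc (Suc k)" es]
        by (simp add: assoc_mult_mat_vec[of _ d d _ d])
      then show ?thesis
        using Suc.IH[of "e # es"] Suc.prems e q by (simp add: divide_le_eq mult_ac)
    qed
    then show ?case using prod[of "Suc (Suc k)" es] Suc.prems q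
      by (auto simp: max_def simp del: chrono_prod.simps)
  qed
  from this[of "[]"] show ?thesis using x by simp
qed

section \<open>Window coordinates of the cascade\<close>

lemma sum_div_mod:
  fixes p L :: nat
  assumes "0 < p"
  shows "(\<Sum>b<p * L. h (b div p) (b mod p)) = (\<Sum>l<L. \<Sum>c<p. h l c :: real)"
proof (induction L)
  case (Suc L)
  have "{..<p * Suc L} = {..<p * L} \<union> (\<lambda>c. p * L + c) ` {..<p}"
  proof safe
    fix x assume "x < p * Suc L" "x \<notin> (\<lambda>c. p * L + c) ` {..<p}"
    then have "x - p * L \<ge> p \<or> x < p * L" by (metis imageI le_add_diff_inverse lessThan_iff not_less)
    with \<open>x < p * Suc L\<close> show "x < p * L" by auto
  qed (auto simp: algebra_simps)
  then have "(\<Sum>b<p * Suc L. h (b div p) (b mod p)) =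
      (\<Sum>b<p * L. h (b div p) (b mod p)) + (\<Sum>b\<in>(\<lambda>c. p * L + c) ` {..<p}. h (b div p) (b mod p))"
    by (simp only:, subst sum.union_disjoint) auto
  also have "(\<Sum>b\<in>(\<lambda>c. p * L + c) ` {..<p}. h (b div p) (b mod p)) = (\<Sum>c<p. h L c)"
    using assms by (subst sum.reindex) (auto simp: inj_on_def)
  finally show ?case using Suc by simp
qed simp

section \<open>Binary digits and the doubling map\<close>

definition binary_digit :: "real \<Rightarrow> nat" where
  "binary_digit t = (if 1 / 2 \<le> t then 1 else 0)"

text \<open>The digit of 1/2 is 1, and 1 is a fixed point with digit 1. So the closed unit interval
  is invariant and dyadic points need no separate treatment.\<close>

definition doubling :: "real \<Rightarrow> real" where
  "doubling t = 2 * t - real (binary_digit t)"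

lemma binary_digit_01: "binary_digit t \<in> {0, 1}"
  by (simp add: binary_digit_def)

lemma doubling_unit_interval: "t \<in> {0..1} \<Longrightarrow> doubling t \<in> {0..1}"
  by (auto simp: doubling_def binary_digit_def)

lemma doubling_funpow_unit_interval: "t \<in> {0..1} \<Longrightarrow> (doubling ^^ k) t \<in> {0..1}"
  by (induction k) (simp_all only: funpow.simps o_apply id_apply doubling_unit_interval)

definition binary_digits :: "nat \<Rightarrow> real \<Rightarrow> nat list" where
  "binary_digits m t = map (\<lambda>k. binary_digit ((doubling ^^ k) t)) [0..<m]"

lemma length_binary_digits [simp]: "length (binary_digits m t) = m"
  by (simp add: binary_digits_def)

lemma set_binary_digits: "set (binary_digits m t) \<subseteq> {0, 1}"
  by (auto simp: binary_digits_def binary_digit_def)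

lemma binary_digits_Suc: "binary_digits (Suc m) t = binary_digit t # binary_digits m (doubling t)"
  by (simp add: binary_digits_def upt_conv_Cons map_Suc_upt[symmetric] funpow_swap1 del: upt_Suc)

section \<open>Functions that vanish off the open window\<close>

definition windowed :: "nat \<Rightarrow> int \<Rightarrow> int \<Rightarrow> (real \<Rightarrow> real vec) \<Rightarrow> bool" where
  "windowed p lm lp f \<longleftrightarrow> (\<forall>x. f x \<in> carrier_vec p) \<and>
     (\<forall>x. x \<le> real_of_int lm \<or> real_of_int lp \<le> x \<longrightarrow> f x = 0\<^sub>v p)"

lemma windowed_carrier: "windowed p lm lp f \<Longrightarrow> f x \<in> carrier_vec p"
  by (simp add: windowed_def)

lemma windowed_zero:
  "windowed p lm lp f \<Longrightarrow> x \<le> real_of_int lm \<or> real_of_int lp \<le> x \<Longrightarrow> f x = 0\<^sub>v p"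
  by (auto simp: windowed_def)

lemma windowed_minus:
  "windowed p lm lp f \<Longrightarrow> windowed p lm lp g \<Longrightarrow> windowed p lm lp (\<lambda>x. f x - g x)"
  by (auto simp: windowed_def)

lemma window_imp_windowed:
  assumes "window p J g lm lp" "\<And>x. g x \<in> carrier_vec p"
  shows "windowed p lm lp g"
proof -
  have "g x = 0\<^sub>v p" if "x \<notin> {real_of_int lm..real_of_int lp}" for x
    using assms(1) that closure_subset[of "{x. g x \<noteq> 0\<^sub>v p}"]
    unfolding window_def supp_def by blast
  then show ?thesis
    using assms unfolding windowed_def window_def
    by (metis atLeastAtMost_iff less_eq_real_def not_le)
qed

lemma stack_carrier: "stack p lm lp f t \<in> carrier_vec (p * nat (lp - lm))"
  by (simp add: stack_def)

lemma stack_index_less: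
  fixes a p L :: nat
  assumes "a < p * L"
  shows "a div p < L" "a mod p < p" "0 < p"
proof -
  show p: "0 < p" using assms by (cases p) auto
  show "a mod p < p" using p by simp
  show "a div p < L" using assms by (simp add: less_mult_imp_div_less mult.commute)
qed

lemma stack_minus:
  assumes "\<And>x. f x \<in> carrier_vec p" "\<And>x. g x \<in> carrier_vec p"
  shows "stack p lm lp (\<lambda>x. f x - g x) t = stack p lm lp f t - stack p lm lp g t"
proof (rule eq_vecI)
  fix a assume "a < dim_vec (stack p lm lp f t - stack p lm lp g t)"
  then have a: "a < p * nat (lp - lm)" by (simp add: stack_def)
  have "dim_vec (g x) = p" for x using assms(2)[of x] by simp
  then show "stack p lm lp (\<lambda>x. f x - g x) t $ a = (stack p lm lp f t - stack p lm lp g t) $ a"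
    using a stack_index_less[OF a] by (simp add: stack_def)
qed (simp add: stack_def)

lemma windowed_eq_stack:
  assumes "lm < lp" "real_of_int lm \<le> x" "x < real_of_int lp" "c < p"
  defines "i \<equiv> nat \<lfloor>x - real_of_int lm\<rfloor>"
  shows "x - real_of_int lm - real i \<in> {0..<1}" "i < nat (lp - lm)" "i * p + c < p * nat (lp - lm)"
    "f x $ c = stack p lm lp f (x - real_of_int lm - real i) $ (i * p + c)"
proof -
  have ri: "real i = real_of_int \<lfloor>x - real_of_int lm\<rfloor>" 
    unfolding i_def using assms(2) by (intro of_nat_nat) (simp add: le_floor_iff)
  show "x - real_of_int lm - real i \<in> {0..<1}" unfolding ri by (simp add: floor_less_iff) linarith
  have "\<lfloor>x - real_of_int lm\<rfloor> < lp - lm" using assms(3) by (simp add: floor_less_iff)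
  then show i: "i < nat (lp - lm)" using assms(1) by (simp add: i_def)
  have "i * p + c < (i + 1) * p" using assms(4) by simp
  also have "\<dots> \<le> nat (lp - lm) * p" using i by (intro mult_le_mono1) simp
  finally show ic: "i * p + c < p * nat (lp - lm)" by (simp add: mult.commute)
  show "f x $ c = stack p lm lp f (x - real_of_int lm - real i) $ (i * p + c)"
    using ic assms(4) by (simp add: stack_def)
qed

lemma windowed_abs_le_stack:
  assumes f: "windowed p lm lp f" and "lm < lp" and c: "c < p"
    and b: "\<And>t. t \<in> {0..1} \<Longrightarrow> vec_norm2 (stack p lm lp f t) \<le> b"
  shows "\<bar>f x $ c\<bar> \<le> b"
proof (cases "real_of_int lm \<le> x \<and> x < real_of_int lp")
  case True
  define i where "i = nat \<lfloor>x - real_of_int lm\<rfloor>"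
  define t where "t = x - real_of_int lm - real i"
  note * = windowed_eq_stack[OF assms(2) conjunct1[OF True] conjunct2[OF True] c, folded i_def, folded t_def]
  have "\<bar>f x $ c\<bar> \<le> vec_norm2 (stack p lm lp f t)"
    unfolding *(4) using *(3) by (intro abs_vec_index_le_norm2) (simp add: stack_def)
  also have "\<dots> \<le> b" using *(1) by (intro b) auto
  finally show ?thesis .
next
  case False
  then have "f x = 0\<^sub>v p" using windowed_zero[OF f] by auto
  moreover have "0 \<le> b" using order_trans[OF vec_norm2_nonneg b[of 0]] by simp
  ultimately show ?thesis using c by simp
qed

section \<open>Refinement in window coordinates\<close>

locale cascade_window =
  fixes p :: nat and J :: "int set" and A :: "nat \<Rightarrow> int \<Rightarrow> real mat" and lm lp :: int
  assumes p_ge_1: "p \<ge> 1" and finite_J: "finite J"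
    and A_carrier: "\<And>k j. k \<ge> 1 \<Longrightarrow> j \<in> J \<Longrightarrow> A k j \<in> carrier_mat p p"
    and J_window: "J \<subseteq> {lm..lp}" and lm_less_lp: "lm < lp"
begin

abbreviation "D \<equiv> p * nat (lp - lm)"
abbreviation "V \<equiv> cascade_op p J A"
abbreviation "G \<equiv> stack p lm lp"
abbreviation "T \<equiv> transition p J A lm lp"

lemma transition_carrier: "T k e \<in> carrier_mat D D"
  by (simp add: transition_def)

lemma V_carrier: "V k f x \<in> carrier_vec p"
  by (simp add: cascade_op_def)

text \<open>For j between \<open>lm\<close> and \<open>lp\<close>, the point 2 x - j lies outside
  the open window whenever x does.\<close>

lemma windowed_V:
  assumes f: "windowed p lm lp f" and k: "k \<ge> 1"
  shows "windowed p lm lp (V k f)"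
  unfolding windowed_def
proof (intro conjI allI impI)
  fix x :: real assume x: "x \<le> real_of_int lm \<or> real_of_int lp \<le> x"
  have "f (2 * x - real_of_int j) = 0\<^sub>v p" if "j \<in> J" for j
  proof -
    have "lm \<le> j" "j \<le> lp" using J_window that by auto
    then have "2 * x - real_of_int j \<le> real_of_int lm \<or> real_of_int lp \<le> 2 * x - real_of_int j"
      using x by linarith
    then show ?thesis by (rule windowed_zero[OF f])
  qed
  then have "(A k j *\<^sub>v f (2 * x - real_of_int j)) $ i = 0" if "j \<in> J" "i < p" for i j
    using that A_carrier[OF k that(1)] mult_mat_vec_zero[OF A_carrier[OF k that(1)]] by simp
  then show "V k f x = 0\<^sub>v p" by (intro eq_vecI) (auto simp: cascade_op_def)
qed (rule V_carrier)

lemma stack_V: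
  assumes f: "windowed p lm lp f" and k: "k \<ge> 1" and t: "t \<in> {0..1}" and e: "e \<in> {0, 1}"
  shows "G (V k f) ((t + real e) / 2) = T k e *\<^sub>v G f t"
proof (rule eq_vecI)
  show "dim_vec (G (V k f) ((t + real e) / 2)) = dim_vec (T k e *\<^sub>v G f t)"
    by (simp add: stack_def transition_def)
  fix a assume "a < dim_vec (T k e *\<^sub>v G f t)"
  then have a: "a < D" by (simp add: transition_def)
  define L where "L = nat (lp - lm)"
  define i where "i = a div p"
  define c where "c = a mod p"
  have ic: "i < L" "c < p" "0 < p" using stack_index_less[OF a] by (auto simp: i_def c_def L_def)
  \<comment> \<open>The map between mask indices and block columns in block row \<open>i\<close>; it
    is its own inverse. Counting blocks from 0 absorbs the -1 in the mask index of
    \<open>transition\<close>.\<close>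
  define \<phi> where "\<phi> j = lm + 2 * int i + int e - j" for j
  define h where "h j = (A k j *\<^sub>v f (t + real_of_int (lm + \<phi> j))) $ c" for j
  have "G (V k f) ((t + real e) / 2) $ a = V k f ((t + real e) / 2 + real_of_int lm + real i) $ c"
    using a by (simp add: stack_def i_def c_def)
  also have "\<dots> = (\<Sum>j\<in>J. h j)"
  proof -
    have "2 * ((t + real e) / 2 + real_of_int lm + real i) - real_of_int j = t + real_of_int (lm + \<phi> j)" for j
      by (simp add: \<phi>_def field_simps)
    then show ?thesis using ic unfolding cascade_op_def h_def by (simp only: index_vec)
  qed
  finally have lhs: "G (V k f) ((t + real e) / 2) $ a = (\<Sum>j\<in>J. h j)" .
  have mask: "(mask p J A k j *\<^sub>v f (t + real_of_int (lm + \<phi> j))) $ c = (if j \<in> J then h j else 0)" for j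
    using ic scalar_prod_left_zero[OF windowed_carrier[OF f]] by (auto simp: mask_def h_def)
  have "(T k e *\<^sub>v G f t) $ a = (\<Sum>b<D. T k e $$ (a, b) * G f t $ b)"
    using a by (simp add: scalar_prod_def transition_def stack_def atLeast0LessThan)
  also have "\<dots> = (\<Sum>b<p * L. (\<lambda>l c'. mask p J A k (\<phi> (int l)) $$ (c, c') *
      f (t + real_of_int lm + real l) $ c') (b div p) (b mod p))"
    using a by (intro sum.cong)
      (auto simp: transition_def stack_def Let_def L_def i_def c_def \<phi>_def algebra_simps)
  also have "\<dots> = (\<Sum>l<L. \<Sum>c'<p. mask p J A k (\<phi> (int l)) $$ (c, c') * f (t + real_of_int lm + real l) $ c')"
    using ic by (subst sum_div_mod) auto
  also have "\<dots> = (\<Sum>l<L. (mask p J A k (\<phi> (int l)) *\<^sub>v f (t + real_of_int (lm + \<phi> (\<phi> (int l))))) $ c)"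
  proof (rule sum.cong[OF refl])
    fix l
    have fc: "dim_vec (f x) = p" for x using windowed_carrier[OF f, of x] by simp
    have mc: "mask p J A k j \<in> carrier_mat p p" for j using A_carrier[OF k] by (auto simp: mask_def)
    have idx: "t + real_of_int (lm + \<phi> (\<phi> (int l))) = t + real_of_int lm + real l"
      by (simp add: \<phi>_def)
    show "(\<Sum>c'<p. mask p J A k (\<phi> (int l)) $$ (c, c') * f (t + real_of_int lm + real l) $ c') =
      (mask p J A k (\<phi> (int l)) *\<^sub>v f (t + real_of_int (lm + \<phi> (\<phi> (int l))))) $ c"
      unfolding idx using mc[of "\<phi> (int l)"] ic fc by (simp add: scalar_prod_def atLeast0LessThan)
  qed
  also have "\<dots> = (\<Sum>l<L. if \<phi> (int l) \<in> J then h (\<phi> (int l)) else 0)"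
    unfolding mask ..
  also have "\<dots> = (\<Sum>j\<in>(\<lambda>l. \<phi> (int l)) ` {..<L}. if j \<in> J then h j else 0)"
  proof -
    have "inj_on (\<lambda>l. \<phi> (int l)) {..<L}" by (auto simp: inj_on_def \<phi>_def)
    then show ?thesis by (simp add: sum.reindex)
  qed
  also have "\<dots> = (\<Sum>j\<in>J \<inter> (\<lambda>l. \<phi> (int l)) ` {..<L}. h j)"
    by (subst sum.inter_restrict[symmetric]) (auto simp: Int_commute)
  \<comment> \<open>A mask index that meets no block contributes nothing: the argument of
    \<open>f\<close> is then at most \<open>lm\<close> or at least \<open>lp\<close>. Equality can
    occur at t = 1 or t = 0, where the zeros of \<open>f\<close> at the ends of the window are
    used.\<close>
  also have "\<dots> = (\<Sum>j\<in>J. h j)"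
  proof (rule sum.mono_neutral_left[OF finite_J])
    show "\<forall>j\<in>J - J \<inter> (\<lambda>l. \<phi> (int l)) ` {..<L}. h j = 0"
    proof
      fix j assume j: "j \<in> J - J \<inter> (\<lambda>l. \<phi> (int l)) ` {..<L}"
      have "\<not> (0 \<le> \<phi> j \<and> \<phi> j < int L)"
      proof
        assume b: "0 \<le> \<phi> j \<and> \<phi> j < int L"
        then have "j = \<phi> (int (nat (\<phi> j)))" by (simp add: \<phi>_def)
        moreover have "nat (\<phi> j) \<in> {..<L}" using b by auto
        ultimately have "j \<in> (\<lambda>l. \<phi> (int l)) ` {..<L}" by (rule image_eqI)
        then show False using j by blast
      qed
      then have "lm + \<phi> j \<le> lm - 1 \<or> lp \<le> lm + \<phi> j" using lm_less_lp by (auto simp: L_def)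
      then have "t + real_of_int (lm + \<phi> j) \<le> real_of_int lm \<or> real_of_int lp \<le> t + real_of_int (lm + \<phi> j)"
        using t by (auto simp: of_int_le_iff[symmetric, where 'a=real] simp del: of_int_le_iff)
      then have "f (t + real_of_int (lm + \<phi> j)) = 0\<^sub>v p" by (rule windowed_zero[OF f])
      then show "h j = 0" using j ic A_carrier[OF k, of j] by (simp add: h_def mult_mat_vec_zero)
    qed
  qed auto
  finally show "G (V k f) ((t + real e) / 2) $ a = (T k e *\<^sub>v G f t) $ a" using lhs by simp
qed

text \<open>A free starting level lets the recursion peel operators off at both ends: the outermost
  for products along digits, the innermost for comparing consecutive iterates.\<close>

definition cascade_from :: "nat \<Rightarrow> nat \<Rightarrow> (real \<Rightarrow> real vec) \<Rightarrow> real \<Rightarrow> real vec" where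
  "cascade_from a m f = foldr V [a..<a + m] f"

lemma cascade_from_0 [simp]: "cascade_from a 0 f = f"
  by (simp add: cascade_from_def)

lemma cascade_from_Suc: "cascade_from a (Suc m) f = V a (cascade_from (Suc a) m f)"
  by (simp add: cascade_from_def upt_conv_Cons del: upt_Suc)

lemma cascade_from_Suc': "cascade_from a (Suc m) f = cascade_from a m (V (a + m) f)"
  by (simp add: cascade_from_def)

lemma cascade_eq_from: "cascade p J A g n = cascade_from 1 n g"
  by (simp add: cascade_def cascade_from_def)

lemma windowed_cascade_from:
  "windowed p lm lp f \<Longrightarrow> a \<ge> 1 \<Longrightarrow> windowed p lm lp (cascade_from a m f)"
  by (induction m arbitrary: a) (auto simp: cascade_from_Suc windowed_V)

lemma binary_family_T: "binary_family D T"
  by (simp add: binary_family_def transition_carrier)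

lemma stack_cascade_from:
  assumes "windowed p lm lp f" "a \<ge> 1" "t \<in> {0..1}"
  shows "G (cascade_from a m f) t = chrono_prod D T a (binary_digits m t) *\<^sub>v G f ((doubling ^^ m) t)"
  using assms(2,3)
proof (induction m arbitrary: a t)
  case 0
  then show ?case using stack_carrier[of p lm lp f t] by (simp add: binary_digits_def)
next
  case (Suc m)
  have tt: "t = (doubling t + real (binary_digit t)) / 2" by (simp add: doubling_def)
  have d: "doubling t \<in> {0..1}" using Suc.prems(2) by (rule doubling_unit_interval)
  have P: "chrono_prod D T (Suc a) (binary_digits m (doubling t)) \<in> carrier_mat D D"
    by (rule chrono_prod_carrier[OF binary_family_T _ set_binary_digits]) simp
  have "G (cascade_from a (Suc m) f) t =
      T a (binary_digit t) *\<^sub>v G (cascade_from (Suc a) m f) (doubling t)"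
    unfolding cascade_from_Suc
    by (subst tt, rule stack_V[OF windowed_cascade_from[OF assms(1)] Suc.prems(1) d binary_digit_01]) simp
  also have "\<dots> = T a (binary_digit t) *\<^sub>v
      (chrono_prod D T (Suc a) (binary_digits m (doubling t)) *\<^sub>v G f ((doubling ^^ m) (doubling t)))"
    using Suc.IH[of "Suc a" "doubling t"] d by simp
  also have "\<dots> = (T a (binary_digit t) * chrono_prod D T (Suc a) (binary_digits m (doubling t))) *\<^sub>v
      G f ((doubling ^^ m) (doubling t))"
    by (rule assoc_mult_mat_vec[symmetric, OF transition_carrier P stack_carrier])
  finally show ?case by (simp add: binary_digits_Suc funpow_swap1)
qed

lemma T_norm_bounded:
  assumes B: "\<forall>k\<ge>1. \<forall>j\<in>J. mat_norm2 (A k j) \<le> B"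
  obtains \<tau> where "\<tau> \<ge> 1" "\<And>k e. k \<ge> 1 \<Longrightarrow> mat_norm2 (T k e) \<le> \<tau>"
proof
  define B' where "B' = max B 0"
  show "1 \<le> max 1 (real D * (real D * B'))" by simp
  fix k e :: nat assume k: "k \<ge> 1"
  have m: "\<bar>mask p J A k j $$ (c, c')\<bar> \<le> B'" if "c < p" "c' < p" for j c c'
  proof (cases "j \<in> J")
    case True
    have "\<bar>A k j $$ (c, c')\<bar> \<le> mat_norm2 (A k j)" by (rule abs_entry_le_mat_norm2[OF A_carrier[OF k True] that])
    also have "\<dots> \<le> B'" using B k True by (auto simp: B'_def le_max_iff_disj)
    finally show ?thesis using True by (simp add: mask_def)
  qed (use that in \<open>simp add: mask_def B'_def\<close>)
  have "mat_norm2 (T k e) \<le> real D * (real D * B')"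
  proof (rule mat_norm2_le_entries[OF transition_carrier])
    show "0 \<le> B'" by (simp add: B'_def)
    fix a b assume "a < D" "b < D"
    then show "\<bar>T k e $$ (a, b)\<bar> \<le> B'"
      using m p_ge_1 by (simp add: transition_def Let_def)
  qed
  then show "mat_norm2 (T k e) \<le> max 1 (real D * (real D * B'))" by linarith
qed

end

section \<open>Stability of the matched cascade\<close>

text \<open>The profile of a quantity that starts at 1, is contracted by \<open>q\<close> at each
  level and receives the defect of that level.\<close>

definition discounted_sum :: "real \<Rightarrow> (nat \<Rightarrow> real) \<Rightarrow> nat \<Rightarrow> real" where
  "discounted_sum q \<delta> n = q ^ n + (\<Sum>j=1..n. \<delta> j * q ^ (n - j))"

lemma discounted_sum_0 [simp]: "discounted_sum q \<delta> 0 = 1"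
  by (simp add: discounted_sum_def)

lemma discounted_sum_Suc:
  "discounted_sum q \<delta> (Suc n) = q * discounted_sum q \<delta> n + \<delta> (Suc n)"
proof -
  have "(\<Sum>j=1..n. \<delta> j * q ^ (Suc n - j)) = q * (\<Sum>j=1..n. \<delta> j * q ^ (n - j))"
    by (auto simp: sum_distrib_left Suc_diff_le intro!: sum.cong)
  then show ?thesis by (simp add: discounted_sum_def algebra_simps)
qed

lemma discounted_sum_nonneg:
  "0 \<le> q \<Longrightarrow> (\<And>j. j \<ge> 1 \<Longrightarrow> 0 \<le> \<delta> j) \<Longrightarrow> 0 \<le> discounted_sum q \<delta> n"
  by (induction n) (auto simp: discounted_sum_Suc)

lemma continuous_windowed_bounded:
  assumes f: "windowed p lm lp f" and cont: "continuous_vec p f"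
  obtains M where "M \<ge> 0" "\<And>x c. c < p \<Longrightarrow> \<bar>f x $ c\<bar> \<le> M"
proof -
  have "\<exists>M\<ge>0. \<forall>x. \<bar>f x $ c\<bar> \<le> M" if c: "c < p" for c
  proof -
    have "compact ((\<lambda>x. f x $ c) ` {real_of_int lm..real_of_int lp})"
      using cont c by (intro compact_continuous_image compact_Icc)
        (auto simp: continuous_vec_def intro: continuous_on_subset)
    then have "bounded ((\<lambda>x. f x $ c) ` {real_of_int lm..real_of_int lp})"
      by (rule compact_imp_bounded)
    then obtain M where M: "\<forall>x\<in>{real_of_int lm..real_of_int lp}. \<bar>f x $ c\<bar> \<le> M"
      unfolding bounded_iff by auto
    have "\<bar>f x $ c\<bar> \<le> max M 0" for x
    proof (cases "x \<in> {real_of_int lm..real_of_int lp}")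
      case True
      with M have "\<bar>f x $ c\<bar> \<le> M" by blast
      then show ?thesis by linarith
    next
      case False
      then have "f x = 0\<^sub>v p" using windowed_zero[OF f, of x] by auto
      then show ?thesis using c by simp
    qed
    then show ?thesis by (intro exI[of _ "max M 0"]) auto
  qed
  then obtain m where m: "\<And>c. c < p \<Longrightarrow> m c \<ge> 0" "\<And>c x. c < p \<Longrightarrow> \<bar>f x $ c\<bar> \<le> m c" by metis
  have "\<bar>f x $ c\<bar> \<le> (\<Sum>c<p. m c)" if "c < p" for x c
    using m(2)[OF that, of x] member_le_sum[of c "{..<p}" m] m(1) that by force
  moreover have "0 \<le> (\<Sum>c<p. m c)" using m(1) by (intro sum_nonneg) auto
  ultimately show ?thesis using that by blast
qed

lemma stack_norm_le:
  assumes "\<And>x c. c < p \<Longrightarrow> \<bar>f x $ c\<bar> \<le> M"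
  shows "vec_norm2 (stack p lm lp f t) \<le> real (p * nat (lp - lm)) * M"
proof -
  have "\<bar>stack p lm lp f t $ a\<bar> \<le> M" if "a < p * nat (lp - lm)" for a
    using that stack_index_less[OF that] assms by (simp add: stack_def)
  then show ?thesis using vec_norm2_le_bound[of "stack p lm lp f t" M] by (simp add: stack_def)
qed

locale matched_cascade = cascade_window +
  fixes g :: "real \<Rightarrow> real vec" and r :: nat and P U :: "nat \<Rightarrow> real mat" and \<gamma> \<Gamma> B :: real
  assumes g_windowed: "windowed p lm lp g" and g_cont: "continuous_vec p g"
    and r: "1 \<le> r" "r < D"
    and P_carrier: "\<And>k. k \<ge> 1 \<Longrightarrow> P k \<in> carrier_mat r D"
    and \<gamma>: "\<gamma> > 0" "\<And>k. k \<ge> 1 \<Longrightarrow> sigma_min (P k) \<ge> \<gamma>"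
    and \<Gamma>: "\<And>k. k \<ge> 1 \<Longrightarrow> mat_norm2 (P k) \<le> \<Gamma>"
    and U_carrier: "\<And>k. k \<ge> 1 \<Longrightarrow> U k \<in> carrier_mat D (D - r)"
    and U_basis: "\<And>k. k \<ge> 1 \<Longrightarrow> orthonormal_kernel_basis (P k) (U k)"
    and A_bounded: "\<forall>k\<ge>1. \<forall>j\<in>J. mat_norm2 (A k j) \<le> B"
begin

abbreviation "d \<equiv> D - r"
abbreviation "Cm \<equiv> (\<lambda>k e. transpose_mat (U k) * T k e * U (Suc k))"
abbreviation "\<delta> \<equiv> defect p J A g lm lp P U"
abbreviation "\<rho> \<equiv> chrono_radius d Cm"

definition "\<tau> = (SOME \<tau>. \<tau> \<ge> 1 \<and> (\<forall>k\<ge>1. \<forall>e. mat_norm2 (T k e) \<le> \<tau>))"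

lemma \<tau>: "\<tau> \<ge> 1" "\<And>k e. k \<ge> 1 \<Longrightarrow> mat_norm2 (T k e) \<le> \<tau>"
proof -
  have "\<exists>\<tau>. \<tau> \<ge> 1 \<and> (\<forall>k\<ge>1. \<forall>e. mat_norm2 (T k e) \<le> \<tau>)"
    using T_norm_bounded[OF A_bounded] by metis
  from someI_ex[OF this] show "\<tau> \<ge> 1" "\<And>k e. k \<ge> 1 \<Longrightarrow> mat_norm2 (T k e) \<le> \<tau>"
    unfolding \<tau>_def by auto
qed

lemma T_mult_norm: "k \<ge> 1 \<Longrightarrow> v \<in> carrier_vec D \<Longrightarrow> vec_norm2 (T k e *\<^sub>v v) \<le> \<tau> * vec_norm2 v"
  using vec_norm2_mult_mat_vec_le[OF transition_carrier, of v k e] \<tau>(2)[of k e]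
  by (meson mult_right_mono order_trans vec_norm2_nonneg)

lemma \<Gamma>_nonneg: "0 \<le> \<Gamma>"
  using order_trans[OF mat_norm2_nonneg \<Gamma>[of 1]] by simp

lemma P_mult_norm: "k \<ge> 1 \<Longrightarrow> v \<in> carrier_vec D \<Longrightarrow> vec_norm2 (P k *\<^sub>v v) \<le> \<Gamma> * vec_norm2 v"
  using vec_norm2_mult_mat_vec_le[OF P_carrier, of k v] \<Gamma>[of k]
  by (meson mult_right_mono order_trans vec_norm2_nonneg)

lemma P_low:
  assumes "k \<ge> 1" "x \<in> carrier_vec r"
  shows "\<gamma> * vec_norm2 x \<le> vec_norm2 (transpose_mat (P k) *\<^sub>v x)"
  using sigma_min_lower_bound[OF P_carrier _ \<gamma>(1) \<gamma>(2)] assms r by simp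

lemma pinv_carrier: "k \<ge> 1 \<Longrightarrow> pinv (P k) \<in> carrier_mat D r"
  by (rule pinv_full_row_rank(1)[OF P_carrier \<gamma>(1) P_low])

lemma pinv_norm: "k \<ge> 1 \<Longrightarrow> b \<in> carrier_vec r \<Longrightarrow> vec_norm2 (pinv (P k) *\<^sub>v b) \<le> vec_norm2 b / \<gamma>"
  by (rule vec_norm2_pinv_le[OF P_carrier \<gamma>(1) P_low])

lemma decomposition:
  "k \<ge> 1 \<Longrightarrow> v \<in> carrier_vec D \<Longrightarrow>
    v = U k *\<^sub>v (transpose_mat (U k) *\<^sub>v v) + pinv (P k) *\<^sub>v (P k *\<^sub>v v)"
  by (rule kernel_basis_decomposition[OF P_carrier \<gamma>(1) P_low U_carrier U_basis])

lemma U_isometry: "k \<ge> 1 \<Longrightarrow> a \<in> carrier_vec d \<Longrightarrow> vec_norm2 (U k *\<^sub>v a) = vec_norm2 a"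
  using U_basis[of k] U_carrier[of k]
  by (intro vec_norm2_isometry[of _ D d]) (auto simp: orthonormal_kernel_basis_def)

lemma UT_norm:
  assumes "k \<ge> 1" "v \<in> carrier_vec D"
  shows "vec_norm2 (transpose_mat (U k) *\<^sub>v v) \<le> vec_norm2 v"
proof -
  have "mat_norm2 (U k) \<le> 1"
    using U_isometry[OF assms(1)] by (intro mat_norm2_le[OF U_carrier[OF assms(1)]]) auto
  then have "mat_norm2 (transpose_mat (U k)) \<le> 1"
    using mat_norm2_transpose_le[OF U_carrier[OF assms(1)]] by linarith
  moreover have "vec_norm2 (transpose_mat (U k) *\<^sub>v v) \<le> mat_norm2 (transpose_mat (U k)) * vec_norm2 v"
    using U_carrier[OF assms(1)] assms(2) by (intro vec_norm2_mult_mat_vec_le[of _ d D]) auto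
  ultimately show ?thesis by (meson mult_right_mono order_trans vec_norm2_nonneg mult_left_le_one_le
        mat_norm2_nonneg)
qed

lemma UT_carrier: "k \<ge> 1 \<Longrightarrow> transpose_mat (U k) \<in> carrier_mat d D"
  using U_carrier[of k] by simp

lemma Cm_mult:
  assumes "k \<ge> 1" "a \<in> carrier_vec d"
  shows "Cm k e *\<^sub>v a = transpose_mat (U k) *\<^sub>v (T k e *\<^sub>v (U (Suc k) *\<^sub>v a))"
proof -
  have Ua: "U (Suc k) *\<^sub>v a \<in> carrier_vec D" using U_carrier[of "Suc k"] assms by simp
  have "Cm k e *\<^sub>v a = (transpose_mat (U k) * T k e) *\<^sub>v (U (Suc k) *\<^sub>v a)"
    using UT_carrier[OF assms(1)] transition_carrier[of k e] U_carrier[of "Suc k"] assms(2)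
    by (intro assoc_mult_mat_vec[of _ d D _ d]) auto
  also have "\<dots> = transpose_mat (U k) *\<^sub>v (T k e *\<^sub>v (U (Suc k) *\<^sub>v a))"
    by (rule assoc_mult_mat_vec[OF UT_carrier[OF assms(1)] transition_carrier Ua])
  finally show ?thesis .
qed

lemma Cm_family: "binary_family d Cm"
  unfolding binary_family_def using UT_carrier U_carrier transition_carrier
  by (auto intro!: mult_carrier_mat[of _ d D])

lemma Cm_bounded: "\<forall>k\<ge>1. \<forall>e\<in>{0, 1}. mat_norm2 (Cm k e) \<le> \<tau>"
proof (intro allI impI ballI)
  fix k e :: nat assume k: "1 \<le> k" and e: "e \<in> {0, 1}"
  show "mat_norm2 (Cm k e) \<le> \<tau>"
  proof (rule mat_norm2_le[OF binary_familyD[OF Cm_family k e]])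
    show "0 \<le> \<tau>" using \<tau> by simp
    fix a :: "real vec" assume a: "a \<in> carrier_vec d"
    have Ua: "U (Suc k) *\<^sub>v a \<in> carrier_vec D" using U_carrier[of "Suc k"] a by simp
    have "vec_norm2 (Cm k e *\<^sub>v a) \<le> vec_norm2 (T k e *\<^sub>v (U (Suc k) *\<^sub>v a))"
      unfolding Cm_mult[OF k a] by (rule UT_norm[OF k mult_mat_vec_carrier[OF transition_carrier Ua]])
    also have "\<dots> \<le> \<tau> * vec_norm2 (U (Suc k) *\<^sub>v a)" by (rule T_mult_norm[OF k Ua])
    finally show "vec_norm2 (Cm k e *\<^sub>v a) \<le> \<tau> * vec_norm2 a" using U_isometry[of "Suc k" a] a by simp
  qed
qed

lemma g_bounded: obtains M where "M \<ge> 0" "\<And>t. vec_norm2 (G g t) \<le> M"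
proof -
  obtain M where M: "M \<ge> 0" "\<And>x c. c < p \<Longrightarrow> \<bar>g x $ c\<bar> \<le> M"
    using continuous_windowed_bounded[OF g_windowed g_cont] by blast
  show ?thesis using that[of "real D * M"] M(1) stack_norm_le[of p g M lm lp, OF M(2)] by simp
qed

lemma stack_V_minus_g:
  "G (\<lambda>x. V k g x - g x) t = G (V k g) t - G g t"
  by (rule stack_minus[OF V_carrier windowed_carrier[OF g_windowed]])

text \<open>The bound is uniform in the level. It makes the supremum inside \<open>defect\<close>
  finite and later controls the full size of the vectors to which the products along digits are
  applied.\<close>

lemma stack_V_minus_g_bounded:
  obtains M where "M \<ge> 0"
    "\<And>k t. k \<ge> 1 \<Longrightarrow> t \<in> {0..1} \<Longrightarrow> vec_norm2 (G (\<lambda>x. V k g x - g x) t) \<le> M"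
proof -
  obtain M where M: "M \<ge> 0" "\<And>t. vec_norm2 (G g t) \<le> M" using g_bounded by blast
  have "vec_norm2 (G (\<lambda>x. V k g x - g x) t) \<le> \<tau> * M + M" if k: "k \<ge> 1" and t: "t \<in> {0..1}" for k t
  proof -
    have tt: "t = (doubling t + real (binary_digit t)) / 2" by (simp add: doubling_def)
    have "G (V k g) t = T k (binary_digit t) *\<^sub>v G g (doubling t)"
      by (subst tt, rule stack_V[OF g_windowed k doubling_unit_interval[OF t] binary_digit_01])
    then have "vec_norm2 (G (V k g) t) \<le> \<tau> * vec_norm2 (G g (doubling t))"
      using T_mult_norm[OF k stack_carrier] by simp
    also have "\<dots> \<le> \<tau> * M" using M \<tau>(1) by (intro mult_left_mono) auto
    finally have "vec_norm2 (G (V k g) t) \<le> \<tau> * M" .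
    then show ?thesis unfolding stack_V_minus_g
      using vec_norm2_triangle_minus[OF stack_carrier stack_carrier, of p lm lp "V k g" t g t] M(2)[of t]
      by linarith
  qed
  then show ?thesis using that[of "\<tau> * M + M"] M \<tau>(1) by simp
qed

section \<open>The defect and the passage through one level\<close>

lemma
  assumes k: "k \<ge> 1"
  shows defect_mat: "e \<in> {0, 1} \<Longrightarrow>
      mat_norm2 ((P k * T k e - P (Suc k)) * matching (U (Suc k)) (P (Suc k))) \<le> \<delta> k"
    and defect_stack: "t \<in> {0..1} \<Longrightarrow> vec_norm2 (P k *\<^sub>v G (\<lambda>x. V k g x - g x) t) \<le> \<delta> k"
    and defect_nonneg: "0 \<le> \<delta> k"
proof -
  let ?m = "\<lambda>e. mat_norm2 ((P k * T k e - P (Suc k)) * matching (U (Suc k)) (P (Suc k)))"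
  let ?s = "\<lambda>t. vec_norm2 (P k *\<^sub>v G (\<lambda>x. V k g x - g x) t)"
  obtain M where M: "M \<ge> 0" "\<And>t. t \<in> {0..1} \<Longrightarrow> vec_norm2 (G (\<lambda>x. V k g x - g x) t) \<le> M"
    using stack_V_minus_g_bounded k by metis
  have "?s t \<le> \<Gamma> * M" if "t \<in> {0..1}" for t
    using P_mult_norm[OF k stack_carrier, of "\<lambda>x. V k g x - g x" t] M(2)[OF that] \<Gamma>_nonneg
    by (meson mult_left_mono order_trans)
  then have bdd: "bdd_above (?s ` {0..1})" by (intro bdd_aboveI2) auto
  have s: "?s t \<le> (SUP t\<in>{0..1}. ?s t)" if "t \<in> {0..1}" for t by (rule cSUP_upper[OF that bdd])
  have s0: "0 \<le> (SUP t\<in>{0..1}. ?s t)" using order_trans[OF vec_norm2_nonneg s[of 0]] by simp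
  have m: "?m e \<le> Max (?m ` {0, 1})" if "e \<in> {0, 1}" for e using that by (intro Max_ge) auto
  have m0: "0 \<le> Max (?m ` {0, 1})" using order_trans[OF mat_norm2_nonneg m[of 0]] by simp
  have \<delta>: "\<delta> k = Max (?m ` {0, 1}) + (SUP t\<in>{0..1}. ?s t)" by (simp add: defect_def)
  show "?m e \<le> \<delta> k" if "e \<in> {0, 1}" using m[OF that] s0 \<delta> by linarith
  show "?s t \<le> \<delta> k" if "t \<in> {0..1}" using s[OF that] m0 \<delta> by linarith
  show "0 \<le> \<delta> k" using m0 s0 \<delta> by linarith
qed

text \<open>In the coordinates given by \<open>P\<close> a transition matrix acts as the identity up
  to the defect; \<open>decomposition\<close> writes \<open>v\<close> as \<open>matching\<close>
  applied to its two components, which is what the defect is tested against.\<close>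

lemma P_step:
  assumes k: "k \<ge> 1" and e: "e \<in> {0, 1}" and v: "v \<in> carrier_vec D"
  shows "vec_norm2 (P k *\<^sub>v (T k e *\<^sub>v v) - P (Suc k) *\<^sub>v v) \<le>
    \<delta> k * (vec_norm2 (transpose_mat (U (Suc k)) *\<^sub>v v) + vec_norm2 (P (Suc k) *\<^sub>v v))"
proof -
  let ?E = "P k * T k e - P (Suc k)"
  define a where "a = transpose_mat (U (Suc k)) *\<^sub>v v"
  define b where "b = P (Suc k) *\<^sub>v v"
  have a: "a \<in> carrier_vec d" and b: "b \<in> carrier_vec r"
    using UT_carrier[of "Suc k"] P_carrier[of "Suc k"] v by (auto simp: a_def b_def)
  have PT: "P k * T k e \<in> carrier_mat r D" using P_carrier[OF k] transition_carrier by (rule mult_carrier_mat)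
  have E: "?E \<in> carrier_mat r D" using P_carrier[of "Suc k"] by (intro minus_carrier_mat) simp
  have "P k *\<^sub>v (T k e *\<^sub>v v) - P (Suc k) *\<^sub>v v = ?E *\<^sub>v v"
    using minus_mult_distrib_mat_vec[OF PT P_carrier v, of "Suc k"]
      assoc_mult_mat_vec[OF P_carrier[OF k] transition_carrier v] by simp
  also have "\<dots> = ?E *\<^sub>v (U (Suc k) *\<^sub>v a + pinv (P (Suc k)) *\<^sub>v b)"
    using decomposition[of "Suc k" v] v by (simp add: a_def b_def)
  also have "vec_norm2 \<dots> \<le> mat_norm2 (?E * matching (U (Suc k)) (P (Suc k))) * (vec_norm2 a + vec_norm2 b)"
    by (rule vec_norm2_mult_matching_le[OF E U_carrier pinv_carrier a b]) auto
  also have "\<dots> \<le> \<delta> k * (vec_norm2 a + vec_norm2 b)"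
    by (intro mult_right_mono defect_mat k e) auto
  finally show ?thesis by (simp add: a_def b_def)
qed

text \<open>In kernel coordinates the transition is \<open>Cm k e\<close> plus the contribution
  \<open>w\<close> of the complement. The latter is bounded through the pseudoinverse, but it need
  not be small.\<close>

lemma U_step:
  assumes k: "k \<ge> 1" and e: "e \<in> {0, 1}" and v: "v \<in> carrier_vec D"
  obtains w where "w \<in> carrier_vec d" "vec_norm2 w \<le> \<tau> / \<gamma> * vec_norm2 (P (Suc k) *\<^sub>v v)"
    "transpose_mat (U k) *\<^sub>v (T k e *\<^sub>v v) = Cm k e *\<^sub>v (transpose_mat (U (Suc k)) *\<^sub>v v) + w"
proof
  define a where "a = transpose_mat (U (Suc k)) *\<^sub>v v"
  define b where "b = P (Suc k) *\<^sub>v v"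
  have a: "a \<in> carrier_vec d" and b: "b \<in> carrier_vec r"
    using UT_carrier[of "Suc k"] P_carrier[of "Suc k"] v by (auto simp: a_def b_def)
  define x where "x = pinv (P (Suc k)) *\<^sub>v b"
  have x: "x \<in> carrier_vec D" using pinv_carrier[of "Suc k"] b by (simp add: x_def)
  have Ua: "U (Suc k) *\<^sub>v a \<in> carrier_vec D" using U_carrier[of "Suc k"] a by simp
  let ?w = "transpose_mat (U k) *\<^sub>v (T k e *\<^sub>v x)"
  have Tx: "T k e *\<^sub>v x \<in> carrier_vec D" "T k e *\<^sub>v (U (Suc k) *\<^sub>v a) \<in> carrier_vec D"
    using transition_carrier x Ua by (auto intro: mult_mat_vec_carrier)
  show "?w \<in> carrier_vec d" using UT_carrier[OF k] Tx by simp
  have "vec_norm2 ?w \<le> vec_norm2 (T k e *\<^sub>v x)" by (rule UT_norm[OF k Tx(1)])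
  also have "\<dots> \<le> \<tau> * vec_norm2 x" by (rule T_mult_norm[OF k x])
  also have "\<dots> \<le> \<tau> * (vec_norm2 b / \<gamma>)"
    using \<tau>(1) pinv_norm[of "Suc k" b] b by (intro mult_left_mono) (auto simp: x_def)
  finally show "vec_norm2 ?w \<le> \<tau> / \<gamma> * vec_norm2 (P (Suc k) *\<^sub>v v)" by (simp add: b_def)
  have "v = U (Suc k) *\<^sub>v a + x" using decomposition[of "Suc k" v] v by (simp add: a_def b_def x_def)
  then have "T k e *\<^sub>v v = T k e *\<^sub>v (U (Suc k) *\<^sub>v a) + T k e *\<^sub>v x"
    using mult_add_distrib_mat_vec[OF transition_carrier Ua x] by metis
  then have "transpose_mat (U k) *\<^sub>v (T k e *\<^sub>v v) = Cm k e *\<^sub>v a + ?w"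
    using mult_add_distrib_mat_vec[OF UT_carrier[OF k] Tx(2,1)] Cm_mult[OF k a] by simp
  then show "transpose_mat (U k) *\<^sub>v (T k e *\<^sub>v v) = Cm k e *\<^sub>v (transpose_mat (U (Suc k)) *\<^sub>v v) + ?w"
    by (simp add: a_def)
qed

end

context matched_cascade
begin

lemma defect_partial_sum_le:
  assumes "summable (\<lambda>k. \<delta> (Suc k))"
  shows "(\<Sum>j=1..n. \<delta> j) \<le> (\<Sum>k. \<delta> (Suc k))"
proof -
  have "(\<Sum>j=1..n. \<delta> j) = (\<Sum>k<n. \<delta> (Suc k))"
    by (rule sum.reindex_bij_witness[of _ Suc "\<lambda>j. j - 1"]) auto
  also have "\<dots> \<le> (\<Sum>k. \<delta> (Suc k))" using defect_nonneg by (intro sum_le_suminf assms) auto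
  finally show ?thesis .
qed

text \<open>
  The components of \<open>v\<close> along the kernels and along the row spaces obey a coupled linear recursion.
  Reading it forwards, \<open>u\<close> and \<open>w\<close> are the weights with which these components at level \<open>n + 1\<close>
  enter the bound: \<open>w\<close> stays bounded since the defects are summable, and \<open>u\<close> is contracted by \<open>q\<close>
  up to defects.
\<close>
lemma cascade_stability:
  assumes summable: "summable (\<lambda>k. \<delta> (Suc k))" and q: "\<rho> < q" "q < 1"
  shows "\<exists>W\<ge>0. \<forall>es v. set es \<subseteq> {0, 1} \<longrightarrow> v \<in> carrier_vec D \<longrightarrow>
    vec_norm2 (chrono_prod D T 1 es *\<^sub>v v) \<le>
      W * (discounted_sum q \<delta> (length es) * vec_norm2 v + vec_norm2 (P (Suc (length es)) *\<^sub>v v))"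
proof -
  have q0: "0 < q" using chrono_radius_decay(1)[OF Cm_family Cm_bounded q(1)] q by linarith
  obtain K where K: "K \<ge> 1"
    "\<forall>a\<ge>1. \<forall>es. set es \<subseteq> {0, 1} \<longrightarrow> mat_norm2 (chrono_prod d Cm a es) \<le> K * q ^ length es"
    using chrono_radius_decay(2)[OF Cm_family Cm_bounded q(1)] by blast
  \<comment> \<open>Index shift: \<open>N n\<close> measures kernel coordinates of level n + 1,
    since \<open>Cm (Suc n)\<close> maps those of level n + 2 to those of level n + 1.\<close>
  define N where "N = adapted_norm Cm q"
  have N_le: "N k x \<le> K * vec_norm2 x" if "x \<in> carrier_vec d" for k x
    unfolding N_def by (rule adapted_norm_le[OF Cm_family q0 K(2) that])
  have N_ge: "vec_norm2 x \<le> N k x" for k x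
    unfolding N_def by (rule vec_norm2_le_adapted_norm)
  define \<beta> where "\<beta> = K * (\<tau> / \<gamma>)"
  have \<beta>0: "0 \<le> \<beta>" using K \<tau> \<gamma> by (simp add: \<beta>_def)
  \<comment> \<open>Chosen so that in w + s u the gain \<beta> u through the bounded block cancels
    the loss s (1 - q) u by contraction.\<close>
  define s where "s = \<beta> / (1 - q)"
  have s0: "0 \<le> s" and sq: "s * (1 - q) = \<beta>" using \<beta>0 q by (auto simp: s_def)
  \<comment> \<open>The induction starts with u = 1 and w = 1 / \<gamma>; the extra 1 ensures that
    \<open>W\<close> is at least 1.\<close>
  define c0 where "c0 = 1 / \<gamma> + s + 1"
  have c0: "c0 \<ge> 1" using \<gamma> s0 by (simp add: c0_def)
  define S where "S = (\<Sum>k. \<delta> (Suc k))"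
  \<comment> \<open>The exponential majorises the product of the growth factors 1 + (1 + s) \<delta>
    that remain after this cancellation.\<close>
  define E where "E n = c0 * exp ((1 + s) * (\<Sum>j=1..n. \<delta> j))" for n
  define W where "W = c0 * exp ((1 + s) * S)"
  have EW: "E n \<le> W" for n
    unfolding E_def W_def S_def using c0 s0 defect_partial_sum_le[OF summable, of n]
    by (intro mult_left_mono) (auto intro!: mult_left_mono)
  have S0: "0 \<le> S" using defect_partial_sum_le[OF summable, of 0] by (simp add: S_def)
  have W1: "1 \<le> W" using EW[of 0] c0 by (simp add: E_def)
  have main: "\<exists>u w. 0 \<le> u \<and> 0 \<le> w \<and> w + s * u \<le> E n \<and> u \<le> W * discounted_sum q \<delta> n \<and>
      (\<forall>es v. length es = n \<longrightarrow> set es \<subseteq> {0, 1} \<longrightarrow> v \<in> carrier_vec D \<longrightarrow>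
        vec_norm2 (chrono_prod D T 1 es *\<^sub>v v) \<le>
        u * N n (transpose_mat (U (Suc n)) *\<^sub>v v) + w * vec_norm2 (P (Suc n) *\<^sub>v v))" for n
  proof (induction n)
    case 0
    have "vec_norm2 v \<le> N 0 (transpose_mat (U 1) *\<^sub>v v) + 1 / \<gamma> * vec_norm2 (P 1 *\<^sub>v v)"
      if v: "v \<in> carrier_vec D" for v
    proof -
      have a: "transpose_mat (U 1) *\<^sub>v v \<in> carrier_vec d" and b: "P 1 *\<^sub>v v \<in> carrier_vec r"
        using UT_carrier[of 1] P_carrier[of 1] v by auto
      have "vec_norm2 v = vec_norm2 (U 1 *\<^sub>v (transpose_mat (U 1) *\<^sub>v v) + pinv (P 1) *\<^sub>v (P 1 *\<^sub>v v))"
        using decomposition[of 1 v] v by simp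
      also have "\<dots> \<le> vec_norm2 (U 1 *\<^sub>v (transpose_mat (U 1) *\<^sub>v v)) + vec_norm2 (pinv (P 1) *\<^sub>v (P 1 *\<^sub>v v))"
        using U_carrier[of 1] pinv_carrier[of 1] a b by (intro vec_norm2_triangle[of _ D]) auto
      also have "\<dots> \<le> N 0 (transpose_mat (U 1) *\<^sub>v v) + 1 / \<gamma> * vec_norm2 (P 1 *\<^sub>v v)"
        using U_isometry[of 1, OF _ a] pinv_norm[of 1, OF _ b] N_ge[of "transpose_mat (U 1) *\<^sub>v v" 0] by simp
      finally show ?thesis .
    qed
    then show ?case
      using \<gamma> s0 W1 by (intro exI[of _ 1] exI[of _ "1 / \<gamma>"]) (auto simp: E_def c0_def)
  next
    case (Suc n)
    then obtain u w where u: "0 \<le> u" and w: "0 \<le> w" and uw: "w + s * u \<le> E n"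
      and u_le: "u \<le> W * discounted_sum q \<delta> n"
      and bound: "\<And>es v. length es = n \<Longrightarrow> set es \<subseteq> {0, 1} \<Longrightarrow> v \<in> carrier_vec D \<Longrightarrow>
        vec_norm2 (chrono_prod D T 1 es *\<^sub>v v) \<le>
        u * N n (transpose_mat (U (Suc n)) *\<^sub>v v) + w * vec_norm2 (P (Suc n) *\<^sub>v v)"
      by blast
    let ?\<delta> = "\<delta> (Suc n)"
    have \<delta>0: "0 \<le> ?\<delta>" by (rule defect_nonneg) simp
    have wW: "w \<le> W" using uw EW[of n] mult_nonneg_nonneg[OF s0 u] by linarith
    define u' where "u' = q * u + ?\<delta> * w"
    define w' where "w' = \<beta> * u + (1 + ?\<delta>) * w"
    have "0 \<le> u'" "0 \<le> w'" using q0 u w \<delta>0 \<beta>0 by (auto simp: u'_def w'_def)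
    moreover have "w' + s * u' \<le> E (Suc n)"
    proof -
      have "w' + s * u' = (w + s * u) + (\<beta> - s * (1 - q)) * u + (1 + s) * ?\<delta> * w"
        by (simp add: u'_def w'_def algebra_simps)
      also have "\<dots> = (w + s * u) + (1 + s) * ?\<delta> * w" by (simp add: sq)
      also have "\<dots> \<le> (w + s * u) + (1 + s) * ?\<delta> * (w + s * u)"
        using s0 u \<delta>0 by (intro add_left_mono mult_left_mono) auto
      also have "\<dots> = (1 + (1 + s) * ?\<delta>) * (w + s * u)" by (simp add: algebra_simps)
      also have "\<dots> \<le> exp ((1 + s) * ?\<delta>) * E n"
        using uw u w s0 \<delta>0 exp_ge_add_one_self[of "(1 + s) * ?\<delta>"] by (intro mult_mono) auto
      also have "\<dots> = E (Suc n)" by (simp add: E_def exp_add[symmetric] algebra_simps)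
      finally show ?thesis .
    qed
    moreover have "u' \<le> W * discounted_sum q \<delta> (Suc n)"
    proof -
      have "u' \<le> q * (W * discounted_sum q \<delta> n) + ?\<delta> * W"
        unfolding u'_def using u_le wW q0 \<delta>0 by (intro add_mono mult_left_mono) auto
      then show ?thesis by (simp add: discounted_sum_Suc algebra_simps)
    qed
    moreover have "vec_norm2 (chrono_prod D T 1 es *\<^sub>v v) \<le>
        u' * N (Suc n) (transpose_mat (U (Suc (Suc n))) *\<^sub>v v) + w' * vec_norm2 (P (Suc (Suc n)) *\<^sub>v v)"
      if es: "length es = Suc n" "set es \<subseteq> {0, 1}" and v: "v \<in> carrier_vec D" for es v
    proof -
      \<comment> \<open>The new factor is the innermost one, so the list is split at its end and the
        old bound is applied to the image under \<open>T (Suc n) e\<close>.\<close>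
      obtain fs e where fs: "es = fs @ [e]" using es(1) by (metis length_Suc_conv_rev)
      have e: "e \<in> {0, 1}" and fs01: "set fs \<subseteq> {0, 1}" and len: "length fs = n" using es fs by auto
      define a where "a = transpose_mat (U (Suc (Suc n))) *\<^sub>v v"
      define b where "b = P (Suc (Suc n)) *\<^sub>v v"
      define v' where "v' = T (Suc n) e *\<^sub>v v"
      have v': "v' \<in> carrier_vec D" unfolding v'_def by (rule mult_mat_vec_carrier[OF transition_carrier v])
      have a: "a \<in> carrier_vec d" and b: "b \<in> carrier_vec r"
        using UT_carrier[of "Suc (Suc n)"] P_carrier[of "Suc (Suc n)"] v by (auto simp: a_def b_def)
      have "chrono_prod D T 1 es *\<^sub>v v = (chrono_prod D T 1 fs * T (Suc n) e) *\<^sub>v v"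
        using chrono_prod_append[OF binary_family_T, of 1 fs "[e]"] fs01 e len transition_carrier[of "Suc n" e]
        by (simp add: fs)
      also have "\<dots> = chrono_prod D T 1 fs *\<^sub>v v'"
        unfolding v'_def using chrono_prod_carrier[OF binary_family_T _ fs01, of 1]
        by (intro assoc_mult_mat_vec[OF _ transition_carrier v]) simp
      finally have "vec_norm2 (chrono_prod D T 1 es *\<^sub>v v) \<le>
          u * N n (transpose_mat (U (Suc n)) *\<^sub>v v') + w * vec_norm2 (P (Suc n) *\<^sub>v v')"
        using bound[OF len fs01 v'] by simp
      also have "N n (transpose_mat (U (Suc n)) *\<^sub>v v') \<le> q * N (Suc n) a + \<beta> * vec_norm2 b"
      proof -
        obtain z where z: "z \<in> carrier_vec d" "vec_norm2 z \<le> \<tau> / \<gamma> * vec_norm2 b"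
          "transpose_mat (U (Suc n)) *\<^sub>v v' = Cm (Suc n) e *\<^sub>v a + z"
          using U_step[of "Suc n" e v] e v unfolding a_def b_def v'_def by auto
        have Ca: "Cm (Suc n) e *\<^sub>v a \<in> carrier_vec d"
          by (rule mult_mat_vec_carrier[OF binary_familyD[OF Cm_family _ e] a]) simp
        have "N n (Cm (Suc n) e *\<^sub>v a + z) \<le> N n (Cm (Suc n) e *\<^sub>v a) + N n z"
          unfolding N_def by (rule adapted_norm_triangle[OF Cm_family q0 Ca z(1)])
        also have "\<dots> \<le> q * N (Suc n) a + K * vec_norm2 z"
          unfolding N_def
          using adapted_norm_contract[OF q0 e, of Cm n a] N_le[OF z(1), of n] by (simp add: N_def)
        also have "\<dots> \<le> q * N (Suc n) a + K * (\<tau> / \<gamma> * vec_norm2 b)"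
          using z(2) K(1) by (intro add_left_mono mult_left_mono) auto
        finally show ?thesis by (simp add: z(3) \<beta>_def)
      qed
      also have "vec_norm2 (P (Suc n) *\<^sub>v v') \<le> ?\<delta> * N (Suc n) a + (1 + ?\<delta>) * vec_norm2 b"
      proof -
        have Pv': "P (Suc n) *\<^sub>v v' \<in> carrier_vec r" using P_carrier[of "Suc n"] v' by auto
        have "P (Suc n) *\<^sub>v v' = (P (Suc n) *\<^sub>v v' - b) + b" using Pv' b P_carrier[of "Suc n"] by (auto intro!: eq_vecI)
        then have "vec_norm2 (P (Suc n) *\<^sub>v v') \<le> vec_norm2 (P (Suc n) *\<^sub>v v' - b) + vec_norm2 b"
          using vec_norm2_triangle[of "P (Suc n) *\<^sub>v v' - b" r b] Pv' b by simp
        also have "vec_norm2 (P (Suc n) *\<^sub>v v' - b) \<le> ?\<delta> * (vec_norm2 a + vec_norm2 b)"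
          using P_step[of "Suc n" e v] e v by (simp add: a_def b_def v'_def)
        also have "\<dots> \<le> ?\<delta> * (N (Suc n) a + vec_norm2 b)"
          using \<delta>0 N_ge[of a "Suc n"] by (intro mult_left_mono) auto
        finally show ?thesis by (simp add: algebra_simps)
      qed
      finally have "vec_norm2 (chrono_prod D T 1 es *\<^sub>v v) \<le>
          u * (q * N (Suc n) a + \<beta> * vec_norm2 b) + w * (?\<delta> * N (Suc n) a + (1 + ?\<delta>) * vec_norm2 b)"
        using u w by (simp add: mult_left_mono)
      also have "\<dots> = u' * N (Suc n) a + w' * vec_norm2 b" by (simp add: u'_def w'_def algebra_simps)
      finally show ?thesis by (simp add: a_def b_def)
    qed
    ultimately show ?case by blast
  qed
  \<comment> \<open>The adapted norm is traded for the Euclidean one at the cost of the factor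
    \<open>K\<close>.\<close>
  have "vec_norm2 (chrono_prod D T 1 es *\<^sub>v v) \<le>
      (W * K) * (discounted_sum q \<delta> (length es) * vec_norm2 v + vec_norm2 (P (Suc (length es)) *\<^sub>v v))"
    if es: "set es \<subseteq> {0, 1}" and v: "v \<in> carrier_vec D" for es v
  proof -
    let ?n = "length es"
    let ?\<omega> = "discounted_sum q \<delta> ?n"
    obtain u w where u: "0 \<le> u" and w: "0 \<le> w" and uw: "w + s * u \<le> E ?n" and u_le: "u \<le> W * ?\<omega>"
      and b: "vec_norm2 (chrono_prod D T 1 es *\<^sub>v v) \<le>
        u * N ?n (transpose_mat (U (Suc ?n)) *\<^sub>v v) + w * vec_norm2 (P (Suc ?n) *\<^sub>v v)"
      using main[of ?n] es v by blast
    have wW: "w \<le> W" using uw EW[of ?n] mult_nonneg_nonneg[OF s0 u] by linarith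
    have a: "transpose_mat (U (Suc ?n)) *\<^sub>v v \<in> carrier_vec d" using UT_carrier[of "Suc ?n"] v by auto
    have "N ?n (transpose_mat (U (Suc ?n)) *\<^sub>v v) \<le> K * vec_norm2 (transpose_mat (U (Suc ?n)) *\<^sub>v v)"
      by (rule N_le[OF a])
    also have "\<dots> \<le> K * vec_norm2 v" using UT_norm[of "Suc ?n" v] v K(1) by (intro mult_left_mono) auto
    finally have "N ?n (transpose_mat (U (Suc ?n)) *\<^sub>v v) \<le> K * vec_norm2 v" .
    then have "u * N ?n (transpose_mat (U (Suc ?n)) *\<^sub>v v) \<le> (W * ?\<omega>) * (K * vec_norm2 v)"
      using u u_le order_trans[OF vec_norm2_nonneg N_ge] K(1) W1
      by (intro mult_mono) auto
    moreover have "w * vec_norm2 (P (Suc ?n) *\<^sub>v v) \<le> (W * K) * vec_norm2 (P (Suc ?n) *\<^sub>v v)"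
    proof (rule mult_right_mono)
      have "w \<le> W * 1" using wW by simp
      also have "\<dots> \<le> W * K" using W1 K(1) by (intro mult_left_mono) auto
      finally show "w \<le> W * K" .
    qed simp
    ultimately show ?thesis using b by (simp add: algebra_simps)
  qed
  then show ?thesis using W1 K(1) by (intro exI[of _ "W * K"]) auto
qed

text \<open>The difference of consecutive iterates is V 1 ... V n applied to V (n + 1) g - g. In the
  stability bound the size of this function is discounted; its image under \<open>P (Suc n)\<close>
  is not, but is at most the defect.\<close>

lemma cascade_increment:
  assumes summable: "summable (\<lambda>k. \<delta> (Suc k))" and q: "\<rho> < q" "q < 1"
  shows "\<exists>C\<ge>0. \<forall>n x. \<forall>c<p.
    \<bar>cascade p J A g (Suc n) x $ c - cascade p J A g n x $ c\<bar> \<le>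
      C * (discounted_sum q \<delta> n + \<delta> (Suc n))"
proof -
  obtain W where W: "W \<ge> 0" and bound: "\<And>es v. set es \<subseteq> {0, 1} \<Longrightarrow> v \<in> carrier_vec D \<Longrightarrow>
      vec_norm2 (chrono_prod D T 1 es *\<^sub>v v) \<le>
      W * (discounted_sum q \<delta> (length es) * vec_norm2 v + vec_norm2 (P (Suc (length es)) *\<^sub>v v))"
    using cascade_stability[OF assms] by blast
  obtain M where M: "M \<ge> 0"
    "\<And>k t. k \<ge> 1 \<Longrightarrow> t \<in> {0..1} \<Longrightarrow> vec_norm2 (G (\<lambda>x. V k g x - g x) t) \<le> M"
    using stack_V_minus_g_bounded by metis
  have q0: "0 < q" using chrono_radius_decay(1)[OF Cm_family Cm_bounded q(1)] q by linarith
  define F where "F = cascade p J A g"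
  have wF: "windowed p lm lp (F n)" for n
    unfolding F_def cascade_eq_from by (rule windowed_cascade_from[OF g_windowed]) simp
  have "\<bar>F (Suc n) x $ c - F n x $ c\<bar> \<le> (W * (M + 1)) * (discounted_sum q \<delta> n + \<delta> (Suc n))"
    if c: "c < p" for n x c
  proof -
    let ?\<omega> = "discounted_sum q \<delta> n"
    have \<omega>0: "0 \<le> ?\<omega>" using q0 defect_nonneg by (intro discounted_sum_nonneg) auto
    have \<delta>0: "0 \<le> \<delta> (Suc n)" by (rule defect_nonneg) simp
    have "\<bar>(F (Suc n) x - F n x) $ c\<bar> \<le> W * (?\<omega> * M + \<delta> (Suc n))"
    proof (rule windowed_abs_le_stack[OF windowed_minus[OF wF wF] lm_less_lp c])
      fix t :: real assume t: "t \<in> {0..1}"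
      let ?es = "binary_digits n t" and ?y = "(doubling ^^ n) t"
      let ?h = "G (\<lambda>x. V (Suc n) g x - g x) ?y"
      have y: "?y \<in> {0..1}" by (rule doubling_funpow_unit_interval[OF t])
      have Pes: "chrono_prod D T 1 ?es \<in> carrier_mat D D"
        by (rule chrono_prod_carrier[OF binary_family_T _ set_binary_digits]) simp
      have "G (\<lambda>x. F (Suc n) x - F n x) t = G (F (Suc n)) t - G (F n) t"
        by (rule stack_minus[OF windowed_carrier[OF wF] windowed_carrier[OF wF]])
      also have "G (F (Suc n)) t = chrono_prod D T 1 ?es *\<^sub>v G (V (Suc n) g) ?y"
        using stack_cascade_from[OF windowed_V[OF g_windowed] _ t, of "Suc n" 1 n]
        by (simp add: F_def cascade_eq_from cascade_from_Suc')
      also have "G (F n) t = chrono_prod D T 1 ?es *\<^sub>v G g ?y"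
        using stack_cascade_from[OF g_windowed _ t, of 1 n] by (simp add: F_def cascade_eq_from)
      also have "chrono_prod D T 1 ?es *\<^sub>v G (V (Suc n) g) ?y - chrono_prod D T 1 ?es *\<^sub>v G g ?y =
          chrono_prod D T 1 ?es *\<^sub>v ?h"
        unfolding stack_V_minus_g
        by (rule mult_minus_distrib_mat_vec[symmetric, OF Pes stack_carrier stack_carrier])
      finally have "vec_norm2 (G (\<lambda>x. F (Suc n) x - F n x) t) \<le>
          W * (?\<omega> * vec_norm2 ?h + vec_norm2 (P (Suc n) *\<^sub>v ?h))"
        using bound[OF set_binary_digits stack_carrier, of n t "\<lambda>x. V (Suc n) g x - g x" ?y] by simp
      also have "\<dots> \<le> W * (?\<omega> * M + \<delta> (Suc n))"
        using W \<omega>0 M(2)[of "Suc n" ?y] defect_stack[of "Suc n" ?y] y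
        by (intro mult_left_mono add_mono) auto
      finally show "vec_norm2 (G (\<lambda>x. F (Suc n) x - F n x) t) \<le> W * (?\<omega> * M + \<delta> (Suc n))" .
    qed
    also have "\<dots> \<le> W * ((M + 1) * (?\<omega> + \<delta> (Suc n)))"
      using W M(1) \<omega>0 \<delta>0 by (intro mult_left_mono) (auto simp: algebra_simps)
    finally show ?thesis using c windowed_carrier[OF wF, of n x] by (simp add: mult.assoc)
  qed
  then show ?thesis using W M(1) by (intro exI[of _ "W * (M + 1)"]) (auto simp: F_def)
qed

end

section \<open>Convergence and rates\<close>

lemma sup_norm_le:
  assumes p: "p \<ge> 1" and b: "\<And>x c. c < p \<Longrightarrow> \<bar>f x $ c\<bar> \<le> b"
  shows "sup_norm p f \<le> ereal b"
  unfolding sup_norm_def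
proof (rule SUP_least)
  fix x
  have "Max ((\<lambda>i. \<bar>f x $ i\<bar>) ` {..<p}) \<le> b"
    using p b by (subst Max_le_iff) (auto simp: lessThan_empty_iff)
  then show "ereal (Max ((\<lambda>i. \<bar>f x $ i\<bar>) ` {..<p})) \<le> ereal b" by simp
qed

section \<open>Rates of the discounted sum and of the tail of the defects\<close>

lemma affine_recursion_bounded:
  fixes s :: "nat \<Rightarrow> real"
  assumes q: "0 \<le> q" "q < 1" and c: "0 \<le> c" and nonneg: "\<And>n. 0 \<le> s n"
    and step: "\<And>n. n \<ge> n0 \<Longrightarrow> s (Suc n) \<le> q * s n + c"
  obtains K where "K \<ge> 0" "\<And>n. s n \<le> K"
proof -
  \<comment> \<open>The fixed point c / (1 - q) of the recursion, plus the terms before the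
    recursion takes effect.\<close>
  define K where "K = (\<Sum>i\<le>n0. s i) + c / (1 - q)"
  have c': "0 \<le> c / (1 - q)" using q c by simp
  have small: "s n \<le> K" if "n \<le> n0" for n
  proof -
    have "s n \<le> (\<Sum>i\<le>n0. s i)" using that nonneg by (intro member_le_sum) auto
    then show ?thesis using c' by (simp add: K_def)
  qed
  have K0: "K \<ge> 0" using small[of n0] nonneg[of n0] by linarith
  have cK: "c \<le> (1 - q) * K"
  proof -
    have "c / (1 - q) \<le> K" using nonneg by (auto simp: K_def intro!: sum_nonneg)
    then show ?thesis using q by (simp add: divide_le_eq mult.commute)
  qed
  have "s n \<le> K" for n
  proof (cases "n \<le> n0")
    case False
    have "s (n0 + m) \<le> K" for m
    proof (induction m)
      case (Suc m)
      have "s (n0 + Suc m) \<le> q * s (n0 + m) + c" using step[of "n0 + m"] by simp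
      also have "\<dots> \<le> q * K + (1 - q) * K" using Suc q cK by (intro add_mono mult_left_mono) auto
      finally show ?case by (simp add: algebra_simps)
    qed (use small[of n0] in simp)
    from this[of "n - n0"] False show ?thesis by simp
  qed (rule small)
  then show ?thesis using that K0 by blast
qed

text \<open>A mean value estimate that provides a telescoping majorant, so that polynomial tails can
  be summed.\<close>

lemma powr_tail_step:
  fixes \<alpha> :: real
  assumes "\<alpha> > 1"
  shows "(\<alpha> - 1) * (real k + 2) powr (- \<alpha>) \<le> (real k + 1) powr (1 - \<alpha>) - (real k + 2) powr (1 - \<alpha>)"
proof -
  have "\<exists>z>real k + 1. z < real k + 2 \<and>
      (real k + 2) powr (1 - \<alpha>) - (real k + 1) powr (1 - \<alpha>) =
      (real k + 2 - (real k + 1)) * ((1 - \<alpha>) * z powr (1 - \<alpha> - 1))"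
    by (rule MVT2) (auto intro!: derivative_eq_intros)
  then obtain z where z: "real k + 1 < z" "z < real k + 2"
    "(real k + 2) powr (1 - \<alpha>) - (real k + 1) powr (1 - \<alpha>) = (1 - \<alpha>) * z powr (- \<alpha>)"
    by auto
  have "(real k + 2) powr (- \<alpha>) \<le> z powr (- \<alpha>)"
    using z assms by (intro powr_mono2') auto
  then have "(\<alpha> - 1) * (real k + 2) powr (- \<alpha>) \<le> (\<alpha> - 1) * z powr (- \<alpha>)"
    using assms by (intro mult_left_mono) auto
  also have "\<dots> = (real k + 1) powr (1 - \<alpha>) - (real k + 2) powr (1 - \<alpha>)"
    using z(3) by (simp add: algebra_simps)
  finally show ?thesis .
qed

definition defect_tail :: "(nat \<Rightarrow> real) \<Rightarrow> nat \<Rightarrow> real" where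
  "defect_tail \<delta> n = (\<Sum>j. \<delta> (n + 1 + j))"

lemma defect_tail_Suc:
  assumes "summable (\<lambda>k. \<delta> (Suc k))"
  shows "defect_tail \<delta> n = \<delta> (Suc n) + defect_tail \<delta> (Suc n)"
proof -
  have "summable (\<lambda>j. \<delta> (n + 1 + j))"
    using summable_ignore_initial_segment[OF assms, of n] by (simp add: add.commute)
  from suminf_split_head[OF this] show ?thesis by (simp add: defect_tail_def)
qed

lemma defect_tail_nonneg:
  assumes "summable (\<lambda>k. \<delta> (Suc k))" "\<And>j. j \<ge> 1 \<Longrightarrow> 0 \<le> \<delta> j"
  shows "0 \<le> defect_tail \<delta> n"
  unfolding defect_tail_def
  using summable_ignore_initial_segment[OF assms(1), of n] assms(2)
  by (intro suminf_nonneg) (auto simp: add.commute)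

text \<open>Partial sums of the decrements of \<open>h\<close> telescope and stay below
  \<open>h n\<close>. Both tail rates below come from a choice of \<open>h\<close>.\<close>

lemma defect_tail_le:
  assumes sm: "summable (\<lambda>k. \<delta> (Suc k))" and nonneg: "\<And>n. 0 \<le> h n"
    and step: "\<And>n. \<delta> (Suc n) \<le> h n - h (Suc n)"
  shows "defect_tail \<delta> n \<le> h n"
proof -
  have s: "summable (\<lambda>j. \<delta> (n + 1 + j))"
    using summable_ignore_initial_segment[OF sm, of n] by (simp add: add.commute)
  have "(\<Sum>j<m. \<delta> (n + 1 + j)) \<le> h n" for m
  proof -
    have "(\<Sum>j<m. \<delta> (n + 1 + j)) \<le> h n - h (n + m)"
    proof (induction m)
      case (Suc m)
      then show ?case using step[of "n + m"] by simp
    qed simp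
    then show ?thesis using nonneg[of "n + m"] by linarith
  qed
  then show ?thesis unfolding defect_tail_def by (rule suminf_le_const[OF s])
qed

text \<open>After division by the expected rate \<open>e n\<close> the discounted sum still
  contracts eventually, by \<open>q'\<close> between \<open>q\<close> and 1, since e n / e (n + 1)
  tends to 1. The constant absorbs the finitely many indices before that.\<close>

lemma polynomial_rate:
  fixes \<delta> :: "nat \<Rightarrow> real"
  assumes sm: "summable (\<lambda>k. \<delta> (Suc k))" and nonneg: "\<And>j. j \<ge> 1 \<Longrightarrow> 0 \<le> \<delta> j"
    and \<alpha>: "\<alpha> > 1" and le: "\<forall>k\<ge>1. \<delta> k \<le> c * (real k + 1) powr (- \<alpha>)" and q: "0 < q" "q < 1"
  shows "\<exists>K\<ge>0. \<forall>n. discounted_sum q \<delta> n + defect_tail \<delta> n \<le> K * (real n + 1) powr (1 - \<alpha>)"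
proof -
  define c' where "c' = max c 0"
  have le': "\<delta> (Suc n) \<le> c' * (real n + 2) powr (- \<alpha>)" for n
  proof -
    have "\<delta> (Suc n) \<le> c * (real (Suc n) + 1) powr (- \<alpha>)" using le[rule_format, of "Suc n"] by simp
    also have "\<dots> \<le> c' * (real (Suc n) + 1) powr (- \<alpha>)" by (intro mult_right_mono) (auto simp: c'_def)
    finally show ?thesis by (simp add: add.commute)
  qed
  have tail: "defect_tail \<delta> n \<le> c' / (\<alpha> - 1) * (real n + 1) powr (1 - \<alpha>)" for n
  proof (rule defect_tail_le[OF sm])
    fix n
    show "0 \<le> c' / (\<alpha> - 1) * (real n + 1) powr (1 - \<alpha>)" using \<alpha> by (simp add: c'_def)
    have "c' * (real n + 2) powr (- \<alpha>) \<le> c' / (\<alpha> - 1) * ((real n + 1) powr (1 - \<alpha>) - (real n + 2) powr (1 - \<alpha>))"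
    proof -
      have "c' * (real n + 2) powr (- \<alpha>) = c' / (\<alpha> - 1) * ((\<alpha> - 1) * (real n + 2) powr (- \<alpha>))"
        using \<alpha> by simp
      also have "\<dots> \<le> c' / (\<alpha> - 1) * ((real n + 1) powr (1 - \<alpha>) - (real n + 2) powr (1 - \<alpha>))"
        using \<alpha> by (intro mult_left_mono powr_tail_step) (auto simp: c'_def)
      finally show ?thesis .
    qed
    then show "\<delta> (Suc n) \<le> c' / (\<alpha> - 1) * (real n + 1) powr (1 - \<alpha>) -
        c' / (\<alpha> - 1) * (real (Suc n) + 1) powr (1 - \<alpha>)"
      using le'[of n] by (simp add: algebra_simps)
  qed
  define e where "e n = (real n + 1) powr (1 - \<alpha>)" for n
  have e0: "0 < e n" for n by (simp add: e_def)
  define q' where "q' = (1 + q) / 2"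
  have q': "q < q'" "0 \<le> q'" "q' < 1" using q by (auto simp: q'_def)
  have "((\<lambda>n. q * (e n / e (Suc n))) \<longlongrightarrow> q * 1) sequentially"
  proof (intro tendsto_mult tendsto_const)
    have "(\<lambda>n. real (Suc n) / real (Suc (Suc n))) \<longlonglongrightarrow> 1"
      using LIMSEQ_n_over_Suc_n by (rule LIMSEQ_Suc)
    then have "(\<lambda>n. (real (Suc n) / real (Suc (Suc n))) powr (1 - \<alpha>)) \<longlonglongrightarrow> 1 powr (1 - \<alpha>)"
      by (intro tendsto_powr tendsto_const) auto
    moreover have "(real (Suc n) / real (Suc (Suc n))) powr (1 - \<alpha>) = e n / e (Suc n)" for n
      unfolding e_def by (subst powr_divide) (auto simp: add.commute)
    ultimately show "(\<lambda>n. e n / e (Suc n)) \<longlonglongrightarrow> 1" by simp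
  qed
  then have "eventually (\<lambda>n. q * (e n / e (Suc n)) < q') sequentially"
    using q' by (intro order_tendstoD(2)[of _ "q * 1"]) auto
  then obtain n0 where n0: "\<And>n. n \<ge> n0 \<Longrightarrow> q * (e n / e (Suc n)) < q'"
    by (auto simp: eventually_sequentially)
  define s where "s n = discounted_sum q \<delta> n / e n" for n
  have \<omega>0: "0 \<le> discounted_sum q \<delta> n" for n using q nonneg by (intro discounted_sum_nonneg) auto
  have s0: "0 \<le> s n" for n using \<omega>0 e0[of n] by (simp add: s_def)
  have "s (Suc n) \<le> q' * s n + c'" if "n \<ge> n0" for n
  proof -
    have "s (Suc n) = q * (e n / e (Suc n)) * s n + \<delta> (Suc n) / e (Suc n)"
      using e0[of n] e0[of "Suc n"] by (simp add: s_def discounted_sum_Suc field_simps)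
    also have "q * (e n / e (Suc n)) * s n \<le> q' * s n"
      using n0[OF that] s0 by (intro mult_right_mono) auto
    \<comment> \<open>One power is given away here; the tail already fixes the exponent at 1 -
      \<alpha>.\<close>
    also have "\<delta> (Suc n) / e (Suc n) \<le> c'"
    proof -
      have "\<delta> (Suc n) \<le> c' * (real n + 2) powr (- \<alpha>)" by (rule le')
      also have "\<dots> \<le> c' * e (Suc n)"
        unfolding e_def by (intro mult_left_mono) (auto simp: c'_def add.commute intro!: powr_mono)
      finally show ?thesis using e0[of "Suc n"] by (simp add: divide_le_eq)
    qed
    finally show ?thesis by simp
  qed
  then obtain K where K: "K \<ge> 0" "\<And>n. s n \<le> K"
    using affine_recursion_bounded[of q' c' s n0] q' s0 by (metis c'_def max.cobounded2)
  have "discounted_sum q \<delta> n \<le> K * e n" for n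
    using K(2)[of n] e0[of n] by (simp add: s_def divide_le_eq)
  then have "discounted_sum q \<delta> n + defect_tail \<delta> n \<le> (K + c' / (\<alpha> - 1)) * (real n + 1) powr (1 - \<alpha>)" for n
    using tail[of n] add_mono by (fastforce simp: e_def algebra_simps)
  moreover have "0 \<le> K + c' / (\<alpha> - 1)" using K(1) \<alpha> by (simp add: c'_def)
  ultimately show ?thesis by blast
qed

lemma geometric_tail:
  fixes \<delta> :: "nat \<Rightarrow> real"
  assumes sm: "summable (\<lambda>k. \<delta> (Suc k))"
    and \<theta>: "0 < \<theta>" "\<theta> < 1" and le: "\<forall>k\<ge>1. \<delta> k \<le> c * \<theta> ^ k"
  shows "defect_tail \<delta> n \<le> max c 0 / (1 - \<theta>) * \<theta> ^ n"
proof (rule defect_tail_le[OF sm])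
  fix n
  show "0 \<le> max c 0 / (1 - \<theta>) * \<theta> ^ n" using \<theta> by simp
  have "\<delta> (Suc n) \<le> c * \<theta> ^ Suc n" using le[rule_format, of "Suc n"] by simp
  also have "\<dots> \<le> max c 0 * \<theta> ^ Suc n" using \<theta> by (intro mult_right_mono) auto
  also have "\<dots> \<le> max c 0 * \<theta> ^ n" using \<theta> by (intro mult_left_mono power_decreasing) auto
  also have "\<dots> = max c 0 / (1 - \<theta>) * ((1 - \<theta>) * \<theta> ^ n)" using \<theta> by simp
  also have "\<dots> = max c 0 / (1 - \<theta>) * \<theta> ^ n - max c 0 / (1 - \<theta>) * \<theta> ^ Suc n"
    by (simp only: left_diff_distrib right_diff_distrib mult_1 power_Suc)
  finally show "\<delta> (Suc n) \<le> max c 0 / (1 - \<theta>) * \<theta> ^ n - max c 0 / (1 - \<theta>) * \<theta> ^ Suc n" .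
qed

lemma geometric_rate:
  fixes \<delta> :: "nat \<Rightarrow> real"
  assumes sm: "summable (\<lambda>k. \<delta> (Suc k))"
    and \<theta>: "0 < \<theta>" "\<theta> < 1" and le: "\<forall>k\<ge>1. \<delta> k \<le> c * \<theta> ^ k" and \<kappa>: "\<theta> < \<kappa>" "\<kappa> < 1"
  shows "\<exists>K\<ge>0. \<forall>n. discounted_sum \<kappa> \<delta> n + defect_tail \<delta> n \<le> K * \<kappa> ^ n"
proof -
  define c' where "c' = max c 0"
  have c0: "0 \<le> c'" by (simp add: c'_def)
  have le': "\<delta> (Suc n) \<le> c' * \<theta> ^ Suc n" for n
  proof -
    have "\<delta> (Suc n) \<le> c * \<theta> ^ Suc n" using le[rule_format, of "Suc n"] by simp
    also have "\<dots> \<le> c' * \<theta> ^ Suc n" using \<theta> by (intro mult_right_mono) (auto simp: c'_def)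
    finally show ?thesis .
  qed
  \<comment> \<open>With this \<open>m\<close> the right-hand side below solves the recursion with
    forcing c' \<theta> ^ (n + 1) and initial value 1 exactly; \<theta> < \<kappa> excludes
    resonance.\<close>
  define m where "m = c' * \<theta> / (\<kappa> - \<theta>)"
  have m0: "0 \<le> m" using c0 \<theta> \<kappa> by (simp add: m_def)
  have "discounted_sum \<kappa> \<delta> n \<le> (1 + m) * \<kappa> ^ n - m * \<theta> ^ n" for n
  proof (induction n)
    case (Suc n)
    have "discounted_sum \<kappa> \<delta> (Suc n) \<le> \<kappa> * ((1 + m) * \<kappa> ^ n - m * \<theta> ^ n) + c' * \<theta> ^ Suc n"
      unfolding discounted_sum_Suc using Suc \<theta> \<kappa> le'[of n] by (intro add_mono mult_left_mono) auto
    also have "c' * \<theta> ^ Suc n = m * (\<kappa> - \<theta>) * \<theta> ^ n" using \<kappa> by (simp add: m_def)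
    finally show ?case by (simp add: algebra_simps)
  qed simp
  then have "discounted_sum \<kappa> \<delta> n \<le> (1 + m) * \<kappa> ^ n" for n
    by (rule order_trans) (use m0 \<theta> in simp)
  moreover have "defect_tail \<delta> n \<le> c' / (1 - \<theta>) * \<kappa> ^ n" for n
  proof -
    have "defect_tail \<delta> n \<le> c' / (1 - \<theta>) * \<theta> ^ n"
      unfolding c'_def by (rule geometric_tail[OF sm \<theta> le])
    also have "\<dots> \<le> c' / (1 - \<theta>) * \<kappa> ^ n" using c0 \<theta> \<kappa> by (intro mult_left_mono power_mono) auto
    finally show ?thesis .
  qed
  ultimately have "discounted_sum \<kappa> \<delta> n + defect_tail \<delta> n \<le> (1 + m + c' / (1 - \<theta>)) * \<kappa> ^ n" for n
    using add_mono by (fastforce simp: algebra_simps)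
  moreover have "0 \<le> 1 + m + c' / (1 - \<theta>)" using m0 c0 \<theta> by simp
  ultimately show ?thesis by blast
qed

section \<open>Uniform convergence of the iterates\<close>

context matched_cascade
begin

lemma cascade_windowed: "windowed p lm lp (cascade p J A g n)"
  unfolding cascade_eq_from by (rule windowed_cascade_from[OF g_windowed]) simp

text \<open>A bound by decrements of a single sequence \<open>h\<close> yields the Cauchy property
  and, on passing to the limit, the rate as well.\<close>

lemma cascade_increment_telescope:
  assumes sm: "summable (\<lambda>k. \<delta> (Suc k))" and q: "\<rho> < q" "q < 1"
  shows "\<exists>h C. decseq h \<and> (\<forall>n. 0 \<le> h n) \<and> C \<ge> 0 \<and>
    (\<forall>n. h n \<le> C * (discounted_sum q \<delta> n + defect_tail \<delta> n)) \<and>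
    (\<forall>n m x. \<forall>c<p. \<bar>cascade p J A g (n + m) x $ c - cascade p J A g n x $ c\<bar> \<le> h n - h (n + m))"
proof -
  let ?F = "cascade p J A g"
  obtain C where C: "C \<ge> 0" and inc: "\<And>n x c. c < p \<Longrightarrow>
      \<bar>?F (Suc n) x $ c - ?F n x $ c\<bar> \<le> C * (discounted_sum q \<delta> n + \<delta> (Suc n))"
    using cascade_increment[OF assms] by blast
  have q0: "0 < q" using chrono_radius_decay(1)[OF Cm_family Cm_bounded q(1)] q by linarith
  let ?\<omega> = "discounted_sum q \<delta>" and ?\<tau> = "defect_tail \<delta>"
  have \<omega>0: "0 \<le> ?\<omega> n" for n using q0 defect_nonneg by (intro discounted_sum_nonneg) auto
  have \<tau>0: "0 \<le> ?\<tau> n" for n using defect_nonneg by (intro defect_tail_nonneg[OF sm])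
  have \<delta>0: "0 \<le> \<delta> (Suc n)" for n by (rule defect_nonneg) simp
  \<comment> \<open>Adding the tail to the discounted sum removes the defect from its recursion:
    together they drop by exactly 1 - q times the discounted sum at each step. The second tail
    accounts for the term \<delta> (n + 1).\<close>
  define h where "h n = C * ((?\<omega> n + ?\<tau> n) / (1 - q) + ?\<tau> n)" for n
  have h_step: "h n - h (Suc n) = C * (?\<omega> n + \<delta> (Suc n))" for n
  proof -
    have "(?\<omega> n + ?\<tau> n) - (?\<omega> (Suc n) + ?\<tau> (Suc n)) = (1 - q) * ?\<omega> n"
      using defect_tail_Suc[OF sm, of n] by (simp add: discounted_sum_Suc algebra_simps)
    then have "(?\<omega> n + ?\<tau> n) / (1 - q) - (?\<omega> (Suc n) + ?\<tau> (Suc n)) / (1 - q) = ?\<omega> n"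
      using q by (simp add: diff_divide_distrib[symmetric])
    moreover have "?\<tau> n - ?\<tau> (Suc n) = \<delta> (Suc n)" using defect_tail_Suc[OF sm, of n] by simp
    moreover have "h n - h (Suc n) = C * (((?\<omega> n + ?\<tau> n) / (1 - q) - (?\<omega> (Suc n) + ?\<tau> (Suc n)) / (1 - q)) +
        (?\<tau> n - ?\<tau> (Suc n)))" unfolding h_def right_diff_distrib[symmetric] by (simp add: algebra_simps)
    ultimately show ?thesis by simp
  qed
  show ?thesis
  proof (intro exI conjI allI impI)
    show "decseq h"
    proof (rule decseq_SucI)
      fix n
      have "0 \<le> C * (?\<omega> n + \<delta> (Suc n))" using C \<omega>0 \<delta>0 by simp
      then show "h (Suc n) \<le> h n" using h_step[of n] by linarith
    qed
    show "0 \<le> h n" for n using C \<omega>0[of n] \<tau>0[of n] q by (simp add: h_def)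
    show "0 \<le> C * (1 / (1 - q) + 1)" using C q by simp
    show "h n \<le> C * (1 / (1 - q) + 1) * (?\<omega> n + ?\<tau> n)" for n
    proof -
      have "(?\<omega> n + ?\<tau> n) / (1 - q) + ?\<tau> n \<le> (1 / (1 - q) + 1) * (?\<omega> n + ?\<tau> n)"
        using \<omega>0[of n] by (simp add: algebra_simps add_divide_distrib)
      then show ?thesis unfolding h_def mult.assoc using C by (intro mult_left_mono) auto
    qed
    show "\<bar>?F (n + m) x $ c - ?F n x $ c\<bar> \<le> h n - h (n + m)" if c: "c < p" for n m x c
    proof (induction m)
      case (Suc m)
      have "\<bar>?F (Suc (n + m)) x $ c - ?F (n + m) x $ c\<bar> \<le> h (n + m) - h (Suc (n + m))"
        using inc[OF c, of "n + m" x] h_step[of "n + m"] by simp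
      then show ?case using Suc by simp
    qed simp
  qed
qed

lemma cascade_limit:
  assumes sm: "summable (\<lambda>k. \<delta> (Suc k))" and radius: "\<rho> < 1"
  shows "\<exists>\<Phi>. windowed p lm lp \<Phi> \<and> uniformly_converges p (cascade p J A g) \<Phi> \<and>
    (\<forall>q. \<rho> < q \<longrightarrow> q < 1 \<longrightarrow> (\<exists>C\<ge>0. \<forall>n x. \<forall>c<p. \<bar>cascade p J A g n x $ c - \<Phi> x $ c\<bar> \<le>
        C * (discounted_sum q \<delta> n + defect_tail \<delta> n)))"
proof -
  let ?F = "cascade p J A g"
  define \<Phi> where "\<Phi> x = Matrix.vec p (\<lambda>c. lim (\<lambda>n. ?F n x $ c))" for x
  have *: "\<exists>h C. decseq h \<and> (\<forall>n. 0 \<le> h n) \<and> C \<ge> 0 \<and>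
      (\<forall>n. h n \<le> C * (discounted_sum q \<delta> n + defect_tail \<delta> n)) \<and>
      (\<forall>c<p. \<forall>x n. \<bar>?F n x $ c - \<Phi> x $ c\<bar> \<le> h n - lim h) \<and>
      (\<forall>c<p. \<forall>x. (\<lambda>n. ?F n x $ c) \<longlonglongrightarrow> \<Phi> x $ c) \<and> h \<longlonglongrightarrow> lim h" if q: "\<rho> < q" "q < 1" for q
  proof -
    obtain h C where h: "decseq h" "\<And>n. 0 \<le> h n" "C \<ge> 0"
      "\<And>n. h n \<le> C * (discounted_sum q \<delta> n + defect_tail \<delta> n)"
      "\<And>n m x c. c < p \<Longrightarrow> \<bar>?F (n + m) x $ c - ?F n x $ c\<bar> \<le> h n - h (n + m)"
      using cascade_increment_telescope[OF sm q] by blast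
    have lim_h: "h \<longlonglongrightarrow> lim h"
      using decseq_convergent[OF h(1), of 0] h(2) by (metis limI)
    have conv: "(\<lambda>n. ?F n x $ c) \<longlonglongrightarrow> \<Phi> x $ c" if c: "c < p" for x c
    proof -
      have "Cauchy (\<lambda>n. ?F n x $ c)"
      proof (rule metric_CauchyI)
        fix e :: real assume "e > 0"
        have "Cauchy h" using lim_h by (rule LIMSEQ_imp_Cauchy)
        then obtain N where N: "\<And>m n. m \<ge> N \<Longrightarrow> n \<ge> N \<Longrightarrow> dist (h m) (h n) < e"
          using \<open>e > 0\<close> by (metis metric_CauchyD)
        have "dist (?F m x $ c) (?F n x $ c) < e" if "m \<ge> n" "n \<ge> N" for m n
        proof -
          have "\<bar>?F m x $ c - ?F n x $ c\<bar> \<le> h n - h m" using h(5)[OF c, of n "m - n" x] that by simp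
          also have "\<dots> < e" using N[of m n] that by (auto simp: dist_real_def)
          finally show ?thesis by (simp add: dist_real_def)
        qed
        then show "\<exists>M. \<forall>m\<ge>M. \<forall>n\<ge>M. dist (?F m x $ c) (?F n x $ c) < e"
          by (metis dist_commute nat_le_linear)
      qed
      then have "convergent (\<lambda>n. ?F n x $ c)" by (simp add: Cauchy_convergent_iff)
      then show ?thesis using c by (simp add: \<Phi>_def convergent_LIMSEQ_iff)
    qed
    have "\<bar>?F n x $ c - \<Phi> x $ c\<bar> \<le> h n - lim h" if c: "c < p" for x c n
    proof (rule LIMSEQ_le)
      show "(\<lambda>m. \<bar>?F n x $ c - ?F (m + n) x $ c\<bar>) \<longlonglongrightarrow> \<bar>?F n x $ c - \<Phi> x $ c\<bar>"
        by (intro tendsto_intros LIMSEQ_ignore_initial_segment conv[OF c])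
      show "(\<lambda>m. h n - h (m + n)) \<longlonglongrightarrow> h n - lim h"
        by (intro tendsto_intros LIMSEQ_ignore_initial_segment lim_h)
      show "\<exists>N. \<forall>m\<ge>N. \<bar>?F n x $ c - ?F (m + n) x $ c\<bar> \<le> h n - h (m + n)"
        using h(5)[OF c, of n _ x] by (auto simp: abs_minus_commute add.commute)
    qed
    then show ?thesis using h(1-4) conv lim_h by blast
  qed
  \<comment> \<open>Any admissible rate serves for existence: \<Phi> is the pointwise limit and does
    not depend on the rate.\<close>
  obtain q0 where q0: "\<rho> < q0" "q0 < 1" using dense[OF radius] by blast
  from *[OF q0] obtain h where h: "\<forall>c<p. \<forall>x n. \<bar>?F n x $ c - \<Phi> x $ c\<bar> \<le> h n - lim h"
      "\<forall>c<p. \<forall>x. (\<lambda>n. ?F n x $ c) \<longlonglongrightarrow> \<Phi> x $ c" "h \<longlonglongrightarrow> lim h" by blast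
  show ?thesis
  proof (intro exI[of _ \<Phi>] conjI allI impI)
    show "windowed p lm lp \<Phi>"
      unfolding windowed_def
    proof (intro conjI allI impI)
      fix x :: real
      show "\<Phi> x \<in> carrier_vec p" by (simp add: \<Phi>_def)
      assume x: "x \<le> real_of_int lm \<or> real_of_int lp \<le> x"
      show "\<Phi> x = 0\<^sub>v p"
        using windowed_zero[OF cascade_windowed x] by (intro eq_vecI) (auto simp: \<Phi>_def)
    qed
    show "uniformly_converges p ?F \<Phi>"
      unfolding uniformly_converges_def
    proof (intro allI impI uniform_limitI)
      fix c and e :: real assume c: "c < p" and e: "e > 0"
      have "eventually (\<lambda>n. h n < lim h + e) sequentially"
        using e by (intro order_tendstoD(2)[OF h(3)]) simp
      then show "\<forall>\<^sub>F n in sequentially. \<forall>x\<in>UNIV. dist (?F n x $ c) (\<Phi> x $ c) < e"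
      proof eventually_elim
        case (elim n)
        have "\<bar>?F n x $ c - \<Phi> x $ c\<bar> < e" for x
          using h(1)[rule_format, OF c, where x = x and n = n] elim by linarith
        then show ?case by (simp add: dist_real_def)
      qed
    qed
    fix q assume q: "\<rho> < q" "q < 1"
    from *[OF q] obtain h C where h: "\<forall>n. 0 \<le> h n" "C \<ge> 0"
        "\<forall>n. h n \<le> C * (discounted_sum q \<delta> n + defect_tail \<delta> n)"
        "\<forall>c<p. \<forall>x n. \<bar>?F n x $ c - \<Phi> x $ c\<bar> \<le> h n - lim h" "h \<longlonglongrightarrow> lim h" by blast
    have "0 \<le> lim h" using h(1) by (intro LIMSEQ_le_const[OF h(5)]) auto
    then have "\<bar>?F n x $ c - \<Phi> x $ c\<bar> \<le> C * (discounted_sum q \<delta> n + defect_tail \<delta> n)"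
      if "c < p" for n x c
      using h(3)[rule_format, of n] h(4)[rule_format, OF that, where x = x and n = n] by linarith
    then show "\<exists>C\<ge>0. \<forall>n x. \<forall>c<p. \<bar>?F n x $ c - \<Phi> x $ c\<bar> \<le>
        C * (discounted_sum q \<delta> n + defect_tail \<delta> n)" using h(2) by blast
  qed
qed

end

section \<open>Regularity of the limit\<close>

text \<open>The two terms balance when (\<Lambda> / \<kappa>) ^ n is about 1 / h. Rounding the real
  solution s down keeps \<Lambda> ^ n h below \<kappa> ^ n and costs one factor 1 / \<kappa>; the
  claimed power of h is \<kappa> to the s.\<close>

lemma holder_from_approximation_rates:
  fixes \<kappa> \<Lambda> :: real
  assumes \<kappa>: "0 < \<kappa>" "\<kappa> < 1" and \<Lambda>: "1 \<le> \<Lambda>" and a: "0 \<le> a" and b: "0 \<le> b" and h: "0 < h" "h < 1"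
    and bound: "\<And>n. y \<le> a * \<kappa> ^ n + b * \<Lambda> ^ n * h"
  shows "y \<le> (a + b) / \<kappa> * h powr (ln (1 / \<kappa>) / ln (\<Lambda> / \<kappa>))"
proof -
  have "1 < \<Lambda> / \<kappa>" using \<kappa> \<Lambda> by simp
  then have lnpos: "0 < ln (\<Lambda> / \<kappa>)" by simp
  define s where "s = ln (1 / h) / ln (\<Lambda> / \<kappa>)"
  have s0: "0 \<le> s" unfolding s_def using lnpos h by (intro divide_nonneg_pos ln_ge_zero) auto
  define n where "n = nat \<lfloor>s\<rfloor>"
  have n: "real n \<le> s" "s \<le> real n + 1" using s0 unfolding n_def by linarith+
  have \<Lambda>h: "\<Lambda> ^ n * h \<le> \<kappa> ^ n"
  proof -
    have "real n * ln (\<Lambda> / \<kappa>) \<le> ln (1 / h)"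
      using n(1) lnpos by (simp add: s_def le_divide_eq)
    then have "ln ((\<Lambda> / \<kappa>) ^ n) \<le> ln (1 / h)" using \<kappa> \<Lambda> by (simp add: ln_realpow)
    then have "(\<Lambda> / \<kappa>) ^ n \<le> 1 / h" using \<kappa> \<Lambda> h by (subst (asm) ln_le_cancel_iff) auto
    then show ?thesis using \<kappa> h by (simp add: power_divide field_simps)
  qed
  have "\<kappa> * \<kappa> ^ n \<le> h powr (ln (1 / \<kappa>) / ln (\<Lambda> / \<kappa>))"
  proof -
    have "\<kappa> * \<kappa> ^ n = \<kappa> powr (real n + 1)" using \<kappa> by (simp add: powr_add powr_realpow)
    also have "\<dots> \<le> \<kappa> powr s" using n(2) \<kappa> by (intro powr_mono') auto
    also have "\<dots> = h powr (ln (1 / \<kappa>) / ln (\<Lambda> / \<kappa>))"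
      using \<kappa> h \<Lambda> by (simp add: powr_def s_def ln_div)
    finally show ?thesis .
  qed
  then have \<kappa>n: "\<kappa> ^ n \<le> h powr (ln (1 / \<kappa>) / ln (\<Lambda> / \<kappa>)) / \<kappa>" using \<kappa> by (simp add: field_simps)
  have "y \<le> a * \<kappa> ^ n + b * (\<Lambda> ^ n * h)" using bound[of n] by (simp add: mult.assoc)
  also have "\<dots> \<le> a * \<kappa> ^ n + b * \<kappa> ^ n" using b \<Lambda>h by (intro add_left_mono mult_left_mono)
  also have "\<dots> = (a + b) * \<kappa> ^ n" by (simp add: algebra_simps)
  also have "\<dots> \<le> (a + b) * (h powr (ln (1 / \<kappa>) / ln (\<Lambda> / \<kappa>)) / \<kappa>)"
    using a b \<kappa>n by (intro mult_left_mono) auto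
  finally show ?thesis by simp
qed

section \<open>Piecewise linear interpolation at the integers\<close>

definition hat :: "real \<Rightarrow> real" where
  "hat t = max 0 (1 - \<bar>t\<bar>)"

lemma hat_lipschitz: "\<bar>hat s - hat t\<bar> \<le> \<bar>s - t\<bar>"
  by (auto simp: hat_def max_def)

lemma hat_integer_shift:
  assumes "t \<in> {0..1}"
  shows "hat (t + real_of_int m - real_of_int i) = (if i = m then 1 - t else 0) + (if i = m + 1 then t else 0)"
proof -
  consider "i \<le> m - 1" | "i = m" | "i = m + 1" | "i \<ge> m + 2" by linarith
  then show ?thesis
  proof cases
    case 1
    then have "real_of_int i \<le> real_of_int m - 1" by linarith
    then show ?thesis using assms 1 by (auto simp: hat_def)
  next
    case 4
    then have "real_of_int i \<ge> real_of_int m + 2" by linarith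
    then show ?thesis using assms 4 by (auto simp: hat_def)
  qed (use assms in \<open>auto simp: hat_def\<close>)
qed

definition interpolant :: "nat \<Rightarrow> int \<Rightarrow> int \<Rightarrow> (real \<Rightarrow> real vec) \<Rightarrow> real \<Rightarrow> real vec" where
  "interpolant p lm lp g x =
     Matrix.vec p (\<lambda>c. \<Sum>i\<in>{lm..lp}. hat (x - real_of_int i) * g (real_of_int i) $ c)"

lemma interpolant_on_cell:
  assumes t: "t \<in> {0..1}" and m: "lm \<le> m" "m < lp" and c: "c < p"
  shows "interpolant p lm lp g (t + real_of_int m) $ c =
    (1 - t) * g (real_of_int m) $ c + t * g (real_of_int m + 1) $ c"
proof -
  have "interpolant p lm lp g (t + real_of_int m) $ c =
      (\<Sum>i\<in>{lm..lp}. (if i = m then (1 - t) * g (real_of_int i) $ c else 0) +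
        (if i = m + 1 then t * g (real_of_int i) $ c else 0))"
    using c unfolding interpolant_def
    by (simp only: index_vec hat_integer_shift[OF t]) (intro sum.cong; auto)
  also have "\<dots> = (1 - t) * g (real_of_int m) $ c + t * g (real_of_int (m + 1)) $ c"
    using m by (simp add: sum.distrib sum.delta)
  finally show ?thesis by simp
qed

lemma windowed_interpolant:
  assumes g: "windowed p lm lp g"
  shows "windowed p lm lp (interpolant p lm lp g)"
  unfolding windowed_def
proof (intro conjI allI impI)
  fix x :: real
  show "interpolant p lm lp g x \<in> carrier_vec p" by (simp add: interpolant_def)
  assume x: "x \<le> real_of_int lm \<or> real_of_int lp \<le> x"
  have "hat (x - real_of_int i) * g (real_of_int i) $ c = 0" if "i \<in> {lm..lp}" "c < p" for i c
  proof (cases "i = lm \<or> i = lp")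
    case True
    then have "g (real_of_int i) = 0\<^sub>v p" by (intro windowed_zero[OF g]) auto
    then show ?thesis using that by simp
  next
    case False
    then have "real_of_int lm + 1 \<le> real_of_int i" "real_of_int i \<le> real_of_int lp - 1"
      using that by (auto simp: of_int_le_iff[symmetric, where 'a=real] simp del: of_int_le_iff)
    then have "hat (x - real_of_int i) = 0" using x by (auto simp: hat_def)
    then show ?thesis by simp
  qed
  then show "interpolant p lm lp g x = 0\<^sub>v p" by (intro eq_vecI) (auto simp: interpolant_def intro!: sum.neutral)
qed

lemma interpolant_lipschitz:
  assumes M: "\<And>x c. c < p \<Longrightarrow> \<bar>g x $ c\<bar> \<le> M" and "0 \<le> M"
  shows "vec_norm2 (interpolant p lm lp g x - interpolant p lm lp g y) \<le>
    real p * (real (card {lm..lp}) * M) * \<bar>x - y\<bar>"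
proof -
  have "\<bar>(interpolant p lm lp g x - interpolant p lm lp g y) $ c\<bar> \<le> real (card {lm..lp}) * M * \<bar>x - y\<bar>"
    if c: "c < p" for c
  proof -
    have "\<bar>(interpolant p lm lp g x - interpolant p lm lp g y) $ c\<bar> =
        \<bar>\<Sum>i\<in>{lm..lp}. (hat (x - real_of_int i) - hat (y - real_of_int i)) * g (real_of_int i) $ c\<bar>"
      using c by (simp add: interpolant_def left_diff_distrib sum_subtractf)
    also have "\<dots> \<le> (\<Sum>i\<in>{lm..lp}. \<bar>x - y\<bar> * M)"
    proof (rule order_trans[OF sum_abs sum_mono])
      fix i
      show "\<bar>(hat (x - real_of_int i) - hat (y - real_of_int i)) * g (real_of_int i) $ c\<bar> \<le> \<bar>x - y\<bar> * M"
        unfolding abs_mult using hat_lipschitz[of "x - real_of_int i" "y - real_of_int i"] M[OF c]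
        by (intro mult_mono) auto
    qed
    finally show ?thesis by (simp add: mult_ac)
  qed
  then show ?thesis
    using vec_norm2_le_bound[of "interpolant p lm lp g x - interpolant p lm lp g y"
        "real (card {lm..lp}) * M * \<bar>x - y\<bar>"]
    by (simp add: interpolant_def mult.assoc)
qed

context cascade_window
begin

text \<open>Each operator multiplies a Lipschitz constant by the sum of the mask norms and, by
  dilating the argument, by 2.\<close>

lemma cascade_from_lipschitz:
  assumes f: "windowed p lm lp f" and L: "\<And>x y. vec_norm2 (f x - f y) \<le> L * \<bar>x - y\<bar>" "0 \<le> L"
    and \<Lambda>: "\<And>k. k \<ge> 1 \<Longrightarrow> 2 * (\<Sum>j\<in>J. mat_norm2 (A k j)) \<le> \<Lambda>" "0 \<le> \<Lambda>" and a: "a \<ge> 1"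
  shows "vec_norm2 (cascade_from a m f x - cascade_from a m f y) \<le> L * \<Lambda> ^ m * \<bar>x - y\<bar>"
  using a
proof (induction m arbitrary: a x y)
  case 0
  then show ?case using L by simp
next
  case (Suc m)
  let ?f = "cascade_from (Suc a) m f"
  have wf: "windowed p lm lp ?f" by (rule windowed_cascade_from[OF f]) simp
  have fc: "?f x \<in> carrier_vec p" for x by (rule windowed_carrier[OF wf])
  let ?d = "\<lambda>j. A a j *\<^sub>v (?f (2 * x - real_of_int j) - ?f (2 * y - real_of_int j))"
  have dj: "?d j \<in> carrier_vec p" if "j \<in> J" for j
    using A_carrier[OF Suc.prems that] fc by (intro mult_mat_vec_carrier[of _ p p] minus_carrier_vec) auto
  have eq: "V a ?f x - V a ?f y = Matrix.vec p (\<lambda>c. \<Sum>j\<in>J. ?d j $ c)"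
  proof (rule eq_vecI)
    fix c assume "c < dim_vec (Matrix.vec p (\<lambda>c. \<Sum>j\<in>J. ?d j $ c))"
    then have c: "c < p" by simp
    have "?d j $ c = (A a j *\<^sub>v ?f (2 * x - real_of_int j)) $ c - (A a j *\<^sub>v ?f (2 * y - real_of_int j)) $ c"
      if "j \<in> J" for j
      using mult_minus_distrib_mat_vec[OF A_carrier[OF Suc.prems that] fc fc] A_carrier[OF Suc.prems that] c
      by simp
    then show "(V a ?f x - V a ?f y) $ c = Matrix.vec p (\<lambda>c. \<Sum>j\<in>J. ?d j $ c) $ c"
      using c by (simp add: cascade_op_def sum_subtractf)
  qed (simp add: cascade_op_def)
  have "vec_norm2 (V a ?f x - V a ?f y) \<le> (\<Sum>j\<in>J. mat_norm2 (A a j) * (L * \<Lambda> ^ m * (2 * \<bar>x - y\<bar>)))"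
    unfolding eq
  proof (rule vec_norm2_sum_bounded[OF finite_J dj])
    fix j assume j: "j \<in> J"
    have "vec_norm2 (?d j) \<le> mat_norm2 (A a j) * vec_norm2 (?f (2 * x - real_of_int j) - ?f (2 * y - real_of_int j))"
      using fc by (intro vec_norm2_mult_mat_vec_le[OF A_carrier[OF Suc.prems j]] minus_carrier_vec) auto
    also have "\<dots> \<le> mat_norm2 (A a j) * (L * \<Lambda> ^ m * \<bar>(2 * x - real_of_int j) - (2 * y - real_of_int j)\<bar>)"
      by (intro mult_left_mono Suc.IH) auto
    also have "(2 * x - real_of_int j) - (2 * y - real_of_int j) = 2 * (x - y)" by simp
    also have "\<bar>2 * (x - y)\<bar> = 2 * \<bar>x - y\<bar>" by (simp only: abs_mult abs_numeral)
    finally show "vec_norm2 (?d j) \<le> mat_norm2 (A a j) * (L * \<Lambda> ^ m * (2 * \<bar>x - y\<bar>))" .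
  qed
  also have "\<dots> = (2 * (\<Sum>j\<in>J. mat_norm2 (A a j))) * (L * \<Lambda> ^ m * \<bar>x - y\<bar>)"
    unfolding sum_distrib_right[symmetric] by simp
  also have "\<dots> \<le> \<Lambda> * (L * \<Lambda> ^ m * \<bar>x - y\<bar>)"
    using \<Lambda> L Suc.prems by (intro mult_right_mono) auto
  finally show ?case by (simp add: cascade_from_Suc mult_ac)
qed

end

section \<open>Oscillation of the generator under \<open>P\<close> and the Hoelder estimate\<close>

context matched_cascade
begin

text \<open>Both halves of the defect meet in \<open>P k\<close> applied to the stack of V k g at (y
  + e) / 2. By the matrix half this is close to \<open>P (Suc k)\<close> applied to the stack of
  \<open>g\<close> at y, by the function half to \<open>P k\<close> applied to the stack of
  \<open>g\<close> at (y + e) / 2.\<close>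

lemma P_stack_step:
  obtains C where "C \<ge> 0" "\<And>k e y. k \<ge> 1 \<Longrightarrow> e \<in> {0, 1} \<Longrightarrow> y \<in> {0..1} \<Longrightarrow>
    vec_norm2 (P (Suc k) *\<^sub>v G g y - P k *\<^sub>v G g ((y + real e) / 2)) \<le> C * \<delta> k"
proof -
  obtain M where M: "M \<ge> 0" "\<And>t. vec_norm2 (G g t) \<le> M" using g_bounded by blast
  have "vec_norm2 (P (Suc k) *\<^sub>v G g y - P k *\<^sub>v G g ((y + real e) / 2)) \<le> (1 + (1 + \<Gamma>) * M) * \<delta> k"
    if k: "k \<ge> 1" and e: "e \<in> {0, 1}" and y: "y \<in> {0..1}" for k e y
  proof -
    let ?x = "(y + real e) / 2"
    have x: "?x \<in> {0..1}" using y e by auto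
    have Pk: "P k \<in> carrier_mat r D" and PSk: "P (Suc k) \<in> carrier_mat r D" using P_carrier k by auto
    have v: "P (Suc k) *\<^sub>v G g y \<in> carrier_vec r" "P k *\<^sub>v G (V k g) ?x \<in> carrier_vec r"
      "P k *\<^sub>v G g ?x \<in> carrier_vec r"
      using mult_mat_vec_carrier[OF Pk stack_carrier] mult_mat_vec_carrier[OF PSk stack_carrier] by auto
    have "vec_norm2 (P (Suc k) *\<^sub>v G g y - P k *\<^sub>v G (V k g) ?x) =
        vec_norm2 (P k *\<^sub>v (T k e *\<^sub>v G g y) - P (Suc k) *\<^sub>v G g y)"
      unfolding stack_V[OF g_windowed k y e, symmetric]
      by (rule vec_norm2_minus_commute[OF v(1,2)])
    also have "\<dots> \<le> \<delta> k * (vec_norm2 (transpose_mat (U (Suc k)) *\<^sub>v G g y) + vec_norm2 (P (Suc k) *\<^sub>v G g y))"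
      by (rule P_step[OF k e stack_carrier])
    also have "\<dots> \<le> \<delta> k * (M + \<Gamma> * M)"
    proof (intro mult_left_mono add_mono defect_nonneg k)
      show "vec_norm2 (transpose_mat (U (Suc k)) *\<^sub>v G g y) \<le> M"
        using UT_norm[OF _ stack_carrier, of "Suc k" g y] M(2)[of y] by simp
      show "vec_norm2 (P (Suc k) *\<^sub>v G g y) \<le> \<Gamma> * M"
        using P_mult_norm[OF _ stack_carrier, of "Suc k" g y] mult_left_mono[OF M(2)[of y] \<Gamma>_nonneg] by simp
    qed
    finally have 1: "vec_norm2 (P (Suc k) *\<^sub>v G g y - P k *\<^sub>v G (V k g) ?x) \<le> \<delta> k * (M + \<Gamma> * M)" .
    have "P k *\<^sub>v G (V k g) ?x - P k *\<^sub>v G g ?x = P k *\<^sub>v G (\<lambda>x. V k g x - g x) ?x"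
      unfolding stack_V_minus_g
      by (rule mult_minus_distrib_mat_vec[symmetric, OF Pk stack_carrier stack_carrier])
    then have 2: "vec_norm2 (P k *\<^sub>v G (V k g) ?x - P k *\<^sub>v G g ?x) \<le> \<delta> k"
      using defect_stack[OF k x] by simp
    show ?thesis
      using vec_norm2_triangle_via[OF v] 1 2 by (simp add: algebra_simps)
  qed
  moreover have "0 \<le> 1 + (1 + \<Gamma>) * M" using M(1) \<Gamma>_nonneg by simp
  ultimately show ?thesis using that by blast
qed

text \<open>
  Going \<open>m\<close> levels up and back down along the all-zero digits, \<open>P\<^sub>k G\<^sub>g\<close> changes only by defects,
  while both arguments are moved to within \<open>2\<^sup>-\<^sup>m\<close> of \<open>0\<close>. Hence \<open>P\<^sub>k G\<^sub>g\<close> is almost constant on the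
  unit interval.
\<close>
lemma P_stack_oscillation:
  assumes sm: "summable (\<lambda>k. \<delta> (Suc k))"
  shows "\<exists>C\<ge>0. \<forall>n. \<forall>t\<in>{0..1}. \<forall>t'\<in>{0..1}.
    vec_norm2 (P (Suc n) *\<^sub>v G g t - P (Suc n) *\<^sub>v G g t') \<le> C * defect_tail \<delta> n"
proof -
  obtain C where C: "C \<ge> 0" and step: "\<And>k e y. k \<ge> 1 \<Longrightarrow> e \<in> {0, 1} \<Longrightarrow> y \<in> {0..1} \<Longrightarrow>
      vec_norm2 (P (Suc k) *\<^sub>v G g y - P k *\<^sub>v G g ((y + real e) / 2)) \<le> C * \<delta> k"
    using P_stack_step by metis
  define b where "b k t = P k *\<^sub>v G g t" for k t
  have bc: "b k t \<in> carrier_vec r" if "k \<ge> 1" for k t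
    unfolding b_def by (rule mult_mat_vec_carrier[OF P_carrier[OF that] stack_carrier])
  define dist where "dist k t t' = vec_norm2 (b k t - b k t')" for k t t'
  \<comment> \<open>The digits of the two points are independent, since on the way up each point
    follows its own expansion.\<close>
  have move: "\<bar>dist (Suc k) y y' - dist k ((y + real e) / 2) ((y' + real e') / 2)\<bar> \<le> 2 * C * \<delta> k"
    if "k \<ge> 1" "e \<in> {0, 1}" "e' \<in> {0, 1}" "y \<in> {0..1}" "y' \<in> {0..1}" for k e e' y y'
  proof -
    let ?x = "(y + real e) / 2" and ?x' = "(y' + real e') / 2"
    have s: "vec_norm2 (b (Suc k) y - b k ?x) \<le> C * \<delta> k" "vec_norm2 (b (Suc k) y' - b k ?x') \<le> C * \<delta> k"
      using step that by (auto simp: b_def)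
    note c = bc[of "Suc k" y] bc[of "Suc k" y'] bc[OF that(1), of ?x] bc[OF that(1), of ?x']
    have sym: "vec_norm2 (b k ?x - b (Suc k) y) = vec_norm2 (b (Suc k) y - b k ?x)"
      "vec_norm2 (b k ?x' - b (Suc k) y') = vec_norm2 (b (Suc k) y' - b k ?x')"
      using c by (auto intro: vec_norm2_minus_commute)
    have "dist (Suc k) y y' \<le> vec_norm2 (b (Suc k) y - b k ?x) + (dist k ?x ?x' + vec_norm2 (b k ?x' - b (Suc k) y'))"
      unfolding dist_def
      using vec_norm2_triangle_via[of "b (Suc k) y" r "b k ?x" "b (Suc k) y'"]
        vec_norm2_triangle_via[of "b k ?x" r "b k ?x'" "b (Suc k) y'"] c by simp
    moreover have "dist k ?x ?x' \<le> vec_norm2 (b k ?x - b (Suc k) y) + (dist (Suc k) y y' + vec_norm2 (b (Suc k) y' - b k ?x'))"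
      unfolding dist_def
      using vec_norm2_triangle_via[of "b k ?x" r "b (Suc k) y" "b k ?x'"]
        vec_norm2_triangle_via[of "b (Suc k) y" r "b (Suc k) y'" "b k ?x'"] c by simp
    ultimately show ?thesis using s sym by linarith
  qed
  have up: "dist k t t' \<le> 2 * C * (\<Sum>j<m. \<delta> (k + j)) + dist (k + m) ((doubling ^^ m) t) ((doubling ^^ m) t')"
    if "k \<ge> 1" "t \<in> {0..1}" "t' \<in> {0..1}" for k t t' m
  proof (induction m)
    case (Suc m)
    let ?s = "(doubling ^^ m) t" and ?s' = "(doubling ^^ m) t'"
    have tt: "?s = (doubling ?s + real (binary_digit ?s)) / 2" "?s' = (doubling ?s' + real (binary_digit ?s')) / 2"
      by (simp_all add: doubling_def)
    have "dist (k + m) ?s ?s' \<le> 2 * C * \<delta> (k + m) + dist (Suc (k + m)) (doubling ?s) (doubling ?s')"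
      using move[of "k + m" "binary_digit ?s" "binary_digit ?s'" "doubling ?s" "doubling ?s'"]
        that binary_digit_01 doubling_unit_interval doubling_funpow_unit_interval tt by force
    then show ?case using Suc by (simp add: algebra_simps)
  qed simp
  have down: "dist (k + m) y y' \<le> 2 * C * (\<Sum>j<m. \<delta> (k + j)) + dist k (y / 2 ^ m) (y' / 2 ^ m)"
    if k: "k \<ge> 1" and y: "y \<in> {0..1}" "y' \<in> {0..1}" for k y y' m
    using y
  proof (induction m arbitrary: y y')
    case (Suc m)
    have "dist (k + Suc m) y y' \<le> 2 * C * \<delta> (k + m) + dist (k + m) (y / 2) (y' / 2)"
      using move[of "k + m" 0 0 y y'] k Suc.prems by simp
    also have "dist (k + m) (y / 2) (y' / 2) \<le>
        2 * C * (\<Sum>j<m. \<delta> (k + j)) + dist k (y / 2 / 2 ^ m) (y' / 2 / 2 ^ m)"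
      using Suc.prems by (intro Suc.IH) auto
    finally show ?case by (simp add: algebra_simps)
  qed simp
  have partial: "(\<Sum>j<m. \<delta> (Suc n + j)) \<le> defect_tail \<delta> n" for n m
  proof -
    have "summable (\<lambda>j. \<delta> (n + 1 + j))"
      using summable_ignore_initial_segment[OF sm, of n] by (simp add: add.commute)
    then have "(\<Sum>j<m. \<delta> (n + 1 + j)) \<le> defect_tail \<delta> n"
      unfolding defect_tail_def using defect_nonneg by (intro sum_le_suminf) auto
    then show ?thesis by simp
  qed
  \<comment> \<open>Continuity of \<open>g\<close> closes the gap: at a fixed level both arguments
    tend to 0.\<close>
  have small: "(\<lambda>m. dist k (s m) (s' m)) \<longlonglongrightarrow> 0"
    if k: "k \<ge> 1" and s: "s \<longlonglongrightarrow> 0" "s' \<longlonglongrightarrow> 0" for k s s'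
  proof -
    have co: "(\<lambda>m. \<bar>(G g (s m) - G g (s' m)) $ a\<bar>) \<longlonglongrightarrow> 0" if a: "a < D" for a
    proof -
      let ?f = "\<lambda>x. g (x + real_of_int lm + real (a div p)) $ (a mod p)"
      have "continuous_on UNIV ?f"
        using g_cont stack_index_less(2)[OF a] unfolding continuous_vec_def
        by (intro continuous_on_compose2[of UNIV "\<lambda>x. g x $ (a mod p)" _ "\<lambda>x. x + real_of_int lm + real (a div p)"]
            continuous_intros) auto
      then have "isCont ?f 0" by (simp add: continuous_on_eq_continuous_at)
      then have "(\<lambda>m. ?f (s m)) \<longlonglongrightarrow> ?f 0" "(\<lambda>m. ?f (s' m)) \<longlonglongrightarrow> ?f 0"
        using isCont_tendsto_compose[OF _ s(1)] isCont_tendsto_compose[OF _ s(2)] by blast+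
      then have "(\<lambda>m. \<bar>?f (s m) - ?f (s' m)\<bar>) \<longlonglongrightarrow> \<bar>?f 0 - ?f 0\<bar>" by (intro tendsto_intros)
      then show ?thesis using a by (simp add: stack_def)
    qed
    have "(\<lambda>m. \<Gamma> * (\<Sum>a<D. \<bar>(G g (s m) - G g (s' m)) $ a\<bar>)) \<longlonglongrightarrow> \<Gamma> * (\<Sum>a<D. 0)"
      using co by (intro tendsto_intros) auto
    then have lim: "(\<lambda>m. \<Gamma> * (\<Sum>a<D. \<bar>(G g (s m) - G g (s' m)) $ a\<bar>)) \<longlonglongrightarrow> 0" by simp
    have le: "dist k (s m) (s' m) \<le> \<Gamma> * (\<Sum>a<D. \<bar>(G g (s m) - G g (s' m)) $ a\<bar>)" for m
    proof -
      have mc: "G g (s m) - G g (s' m) \<in> carrier_vec D" by (simp add: stack_def)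
      have "dist k (s m) (s' m) = vec_norm2 (P k *\<^sub>v (G g (s m) - G g (s' m)))"
        unfolding dist_def b_def
        using mult_minus_distrib_mat_vec[OF P_carrier[OF k] stack_carrier stack_carrier, of g "s m" g "s' m"] by simp
      also have "\<dots> \<le> \<Gamma> * vec_norm2 (G g (s m) - G g (s' m))" by (rule P_mult_norm[OF k mc])
      also have "\<dots> \<le> \<Gamma> * (\<Sum>a<D. \<bar>(G g (s m) - G g (s' m)) $ a\<bar>)"
        using vec_norm2_le_sum_abs[of "G g (s m) - G g (s' m)"] \<Gamma>_nonneg
        by (intro mult_left_mono) (auto simp: stack_def)
      finally show ?thesis .
    qed
    show ?thesis
    proof (rule tendsto_sandwich[OF _ _ tendsto_const lim])
      show "\<forall>\<^sub>F m in sequentially. 0 \<le> dist k (s m) (s' m)" by (simp add: dist_def)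
      show "\<forall>\<^sub>F m in sequentially. dist k (s m) (s' m) \<le> \<Gamma> * (\<Sum>a<D. \<bar>(G g (s m) - G g (s' m)) $ a\<bar>)"
        by (rule always_eventually) (use le in blast)
    qed
  qed
  \<comment> \<open>Each of the two passes moves two points, hence the factor 4.\<close>
  have "dist (Suc n) t t' \<le> 4 * C * defect_tail \<delta> n" if t: "t \<in> {0..1}" "t' \<in> {0..1}" for n t t'
  proof -
    define s where "s m = (doubling ^^ m) t / 2 ^ m" for m
    define s' where "s' m = (doubling ^^ m) t' / 2 ^ m" for m
    have lim0: "(\<lambda>m. (doubling ^^ m) u / 2 ^ m) \<longlonglongrightarrow> 0" if "u \<in> {0..1}" for u
    proof (rule tendsto_sandwich[of "\<lambda>_. 0"])
      show "(\<lambda>m. (1 / 2 :: real) ^ m) \<longlonglongrightarrow> 0" by (rule LIMSEQ_realpow_zero) auto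
      show "\<forall>\<^sub>F m in sequentially. (doubling ^^ m) u / 2 ^ m \<le> (1 / 2) ^ m"
        using doubling_funpow_unit_interval[OF that] by (auto simp: power_one_over divide_simps)
      show "\<forall>\<^sub>F m in sequentially. 0 \<le> (doubling ^^ m) u / 2 ^ m"
        using doubling_funpow_unit_interval[OF that] by auto
    qed simp
    have "dist (Suc n) t t' \<le> 4 * C * defect_tail \<delta> n + dist (Suc n) (s m) (s' m)" for m
    proof -
      have "dist (Suc n) t t' \<le> 4 * C * (\<Sum>j<m. \<delta> (Suc n + j)) + dist (Suc n) (s m) (s' m)"
        using up[of "Suc n" t t' m] down[of "Suc n" "(doubling ^^ m) t" "(doubling ^^ m) t'" m]
          doubling_funpow_unit_interval t by (simp add: s_def s'_def)
      moreover have "4 * C * (\<Sum>j<m. \<delta> (Suc n + j)) \<le> 4 * C * defect_tail \<delta> n"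
        using partial C by (intro mult_left_mono) auto
      ultimately show ?thesis by linarith
    qed
    moreover have "(\<lambda>m. 4 * C * defect_tail \<delta> n + dist (Suc n) (s m) (s' m)) \<longlonglongrightarrow> 4 * C * defect_tail \<delta> n + 0"
    proof (intro tendsto_intros small)
      show "s \<longlonglongrightarrow> 0" "s' \<longlonglongrightarrow> 0" unfolding s_def s'_def by (rule lim0, rule t)+
    qed simp
    ultimately show ?thesis by (intro LIMSEQ_le_const[of _ "4 * C * defect_tail \<delta> n"]) auto
  qed
  then show ?thesis using C by (intro exI[of _ "4 * C"]) (auto simp: dist_def b_def)
qed

lemma stack_interpolant:
  assumes t: "t \<in> {0..1}"
  shows "G (interpolant p lm lp g) t = (1 - t) \<cdot>\<^sub>v G g 0 + t \<cdot>\<^sub>v G g 1"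
proof (rule eq_vecI)
  fix a assume "a < dim_vec ((1 - t) \<cdot>\<^sub>v G g 0 + t \<cdot>\<^sub>v G g 1)"
  then have a: "a < D" by (simp add: stack_def)
  note i = stack_index_less[OF a]
  have "interpolant p lm lp g (t + real_of_int (lm + int (a div p))) $ (a mod p) =
      (1 - t) * g (real_of_int (lm + int (a div p))) $ (a mod p) +
      t * g (real_of_int (lm + int (a div p)) + 1) $ (a mod p)"
    using i by (intro interpolant_on_cell[OF t]) auto
  then show "G (interpolant p lm lp g) t $ a = ((1 - t) \<cdot>\<^sub>v G g 0 + t \<cdot>\<^sub>v G g 1) $ a"
    using a by (simp add: stack_def add_ac)
qed (simp add: stack_def)

text \<open>On each cell the interpolation error is a convex combination of G g t - G g 0 and G g t
  - G g 1. Its image under \<open>P\<close> is therefore bounded by the oscillation, and the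
  stability bound applies.\<close>

lemma interpolant_cascade_close:
  assumes sm: "summable (\<lambda>k. \<delta> (Suc k))" and q: "\<rho> < q" "q < 1"
  shows "\<exists>C\<ge>0. \<forall>n x. \<forall>c<p.
    \<bar>cascade p J A g n x $ c - cascade p J A (interpolant p lm lp g) n x $ c\<bar> \<le>
      C * (discounted_sum q \<delta> n + defect_tail \<delta> n)"
proof -
  let ?g = "interpolant p lm lp g"
  have wg: "windowed p lm lp ?g" by (rule windowed_interpolant[OF g_windowed])
  obtain W where W: "W \<ge> 0" and bound: "\<And>es v. set es \<subseteq> {0, 1} \<Longrightarrow> v \<in> carrier_vec D \<Longrightarrow>
      vec_norm2 (chrono_prod D T 1 es *\<^sub>v v) \<le>
      W * (discounted_sum q \<delta> (length es) * vec_norm2 v + vec_norm2 (P (Suc (length es)) *\<^sub>v v))"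
    using cascade_stability[OF assms] by blast
  obtain C where C: "C \<ge> 0" and osc: "\<And>n t t'. t \<in> {0..1} \<Longrightarrow> t' \<in> {0..1} \<Longrightarrow>
      vec_norm2 (P (Suc n) *\<^sub>v G g t - P (Suc n) *\<^sub>v G g t') \<le> C * defect_tail \<delta> n"
    using P_stack_oscillation[OF sm] by blast
  obtain M where M: "M \<ge> 0" "\<And>t. vec_norm2 (G g t) \<le> M" using g_bounded by blast
  have q0: "0 < q" using chrono_radius_decay(1)[OF Cm_family Cm_bounded q(1)] q by linarith
  have split: "G g t - G ?g t = (1 - t) \<cdot>\<^sub>v (G g t - G g 0) + t \<cdot>\<^sub>v (G g t - G g 1)" if "t \<in> {0..1}" for t
    unfolding stack_interpolant[OF that] by (rule eq_vecI) (auto simp: stack_def algebra_simps)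
  have norm: "vec_norm2 (G g t - G ?g t) \<le> 2 * M" if t: "t \<in> {0..1}" for t
  proof -
    have d: "G g t - G g s \<in> carrier_vec D" "vec_norm2 (G g t - G g s) \<le> 2 * M" for s
      using vec_norm2_triangle_minus[OF stack_carrier stack_carrier, of p lm lp g t g s] M(2)[of t] M(2)[of s]
      by (auto simp: stack_def)
    have "vec_norm2 (G g t - G ?g t) \<le> (1 - t) * (2 * M) + t * (2 * M)"
      unfolding split[OF t]
      using t d vec_norm2_triangle[of "(1 - t) \<cdot>\<^sub>v (G g t - G g 0)" D "t \<cdot>\<^sub>v (G g t - G g 1)"]
        mult_left_mono[OF d(2), of "1 - t" 0] mult_left_mono[OF d(2), of t 1]
      by (simp add: vec_norm2_smult)
    then show ?thesis by (simp add: algebra_simps)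
  qed
  have Pnorm: "vec_norm2 (P (Suc n) *\<^sub>v (G g t - G ?g t)) \<le> C * defect_tail \<delta> n" if t: "t \<in> {0..1}" for t n
  proof -
    have Pn: "P (Suc n) \<in> carrier_mat r D" using P_carrier by simp
    have d: "G g t - G g s \<in> carrier_vec D" for s by (simp add: stack_def)
    have Pd: "P (Suc n) *\<^sub>v (G g t - G g s) = P (Suc n) *\<^sub>v G g t - P (Suc n) *\<^sub>v G g s" for s
      by (rule mult_minus_distrib_mat_vec[OF Pn stack_carrier stack_carrier])
    have o: "vec_norm2 (P (Suc n) *\<^sub>v (G g t - G g s)) \<le> C * defect_tail \<delta> n" if "s \<in> {0..1}" for s
      unfolding Pd by (rule osc[OF t that])
    have "P (Suc n) *\<^sub>v (G g t - G ?g t) =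
        (1 - t) \<cdot>\<^sub>v (P (Suc n) *\<^sub>v (G g t - G g 0)) + t \<cdot>\<^sub>v (P (Suc n) *\<^sub>v (G g t - G g 1))"
      unfolding split[OF t]
      using mult_add_distrib_mat_vec[OF Pn smult_carrier_vec[THEN iffD2, OF d] smult_carrier_vec[THEN iffD2, OF d]]
        mult_mat_vec[OF Pn d] by simp
    moreover have "P (Suc n) *\<^sub>v (G g t - G g s) \<in> carrier_vec r" for s
      by (rule mult_mat_vec_carrier[OF Pn d])
    ultimately have "vec_norm2 (P (Suc n) *\<^sub>v (G g t - G ?g t)) \<le>
        (1 - t) * (C * defect_tail \<delta> n) + t * (C * defect_tail \<delta> n)"
      using t vec_norm2_triangle[of "(1 - t) \<cdot>\<^sub>v (P (Suc n) *\<^sub>v (G g t - G g 0))" r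
          "t \<cdot>\<^sub>v (P (Suc n) *\<^sub>v (G g t - G g 1))"]
        mult_left_mono[OF o[of 0], of "1 - t"] mult_left_mono[OF o[of 1], of t]
      by (simp add: vec_norm2_smult)
    then show ?thesis by (simp add: algebra_simps)
  qed
  define F where "F = cascade p J A g"
  define F' where "F' = cascade p J A ?g"
  have wF: "windowed p lm lp (F n)" "windowed p lm lp (F' n)" for n
    unfolding F_def F'_def cascade_eq_from by (simp_all add: windowed_cascade_from g_windowed wg)
  have "\<bar>F n x $ c - F' n x $ c\<bar> \<le> (W * (2 * M + C)) * (discounted_sum q \<delta> n + defect_tail \<delta> n)"
    if c: "c < p" for n x c
  proof -
    let ?\<omega> = "discounted_sum q \<delta> n"
    have \<omega>0: "0 \<le> ?\<omega>" using q0 defect_nonneg by (intro discounted_sum_nonneg) auto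
    have \<tau>0: "0 \<le> defect_tail \<delta> n" using defect_nonneg by (intro defect_tail_nonneg[OF sm])
    have "\<bar>(F n x - F' n x) $ c\<bar> \<le> W * (?\<omega> * (2 * M) + C * defect_tail \<delta> n)"
    proof (rule windowed_abs_le_stack[OF windowed_minus[OF wF] lm_less_lp c])
      fix t :: real assume t: "t \<in> {0..1}"
      let ?es = "binary_digits n t" and ?y = "(doubling ^^ n) t"
      have y: "?y \<in> {0..1}" by (rule doubling_funpow_unit_interval[OF t])
      have Pes: "chrono_prod D T 1 ?es \<in> carrier_mat D D"
        by (rule chrono_prod_carrier[OF binary_family_T _ set_binary_digits]) simp
      have "G (\<lambda>x. F n x - F' n x) t = G (F n) t - G (F' n) t"
        by (rule stack_minus[OF windowed_carrier[OF wF(1)] windowed_carrier[OF wF(2)]])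
      also have "G (F n) t = chrono_prod D T 1 ?es *\<^sub>v G g ?y"
        using stack_cascade_from[OF g_windowed _ t, of 1 n] by (simp add: F_def cascade_eq_from)
      also have "G (F' n) t = chrono_prod D T 1 ?es *\<^sub>v G ?g ?y"
        using stack_cascade_from[OF wg _ t, of 1 n] by (simp add: F'_def cascade_eq_from)
      also have "chrono_prod D T 1 ?es *\<^sub>v G g ?y - chrono_prod D T 1 ?es *\<^sub>v G ?g ?y =
          chrono_prod D T 1 ?es *\<^sub>v (G g ?y - G ?g ?y)"
        by (rule mult_minus_distrib_mat_vec[symmetric, OF Pes stack_carrier stack_carrier])
      finally have "vec_norm2 (G (\<lambda>x. F n x - F' n x) t) \<le>
          W * (?\<omega> * vec_norm2 (G g ?y - G ?g ?y) + vec_norm2 (P (Suc n) *\<^sub>v (G g ?y - G ?g ?y)))"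
        using bound[OF set_binary_digits, of "G g ?y - G ?g ?y" n t] by (simp add: stack_def)
      also have "\<dots> \<le> W * (?\<omega> * (2 * M) + C * defect_tail \<delta> n)"
        using W \<omega>0 norm[OF y] Pnorm[OF y, of n] by (intro mult_left_mono add_mono) auto
      finally show "vec_norm2 (G (\<lambda>x. F n x - F' n x) t) \<le> W * (?\<omega> * (2 * M) + C * defect_tail \<delta> n)" .
    qed
    also have "\<dots> \<le> W * ((2 * M + C) * (?\<omega> + defect_tail \<delta> n))"
      using W M(1) C \<omega>0 \<tau>0 by (intro mult_left_mono) (auto simp: algebra_simps)
    finally show ?thesis using c windowed_carrier[OF wF(2), of n x] by (simp add: mult.assoc)
  qed
  then show ?thesis using W M(1) C by (intro exI[of _ "W * (2 * M + C)"]) (auto simp: F_def F'_def)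
qed

lemma limit_holder_continuous:
  assumes sm: "summable (\<lambda>k. \<delta> (Suc k))" and \<kappa>: "\<rho> < \<kappa>" "\<kappa> < 1"
    and rate: "\<And>n. discounted_sum \<kappa> \<delta> n + defect_tail \<delta> n \<le> K0 * \<kappa> ^ n" and K0: "0 \<le> K0"
    and \<Phi>: "windowed p lm lp \<Phi>"
    and close: "\<And>n x c. c < p \<Longrightarrow> \<bar>cascade p J A g n x $ c - \<Phi> x $ c\<bar> \<le> K1 * \<kappa> ^ n" and K1: "0 \<le> K1"
    and \<Lambda>: "\<And>k. k \<ge> 1 \<Longrightarrow> 2 * (\<Sum>j\<in>J. mat_norm2 (A k j)) \<le> \<Lambda>" "1 \<le> \<Lambda>"
  shows "holder_continuous (ln (1 / \<kappa>) / ln (\<Lambda> / \<kappa>)) \<Phi>"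
proof -
  let ?g = "interpolant p lm lp g"
  let ?\<beta> = "ln (1 / \<kappa>) / ln (\<Lambda> / \<kappa>)"
  have \<kappa>0: "0 < \<kappa>" using chrono_radius_decay(1)[OF Cm_family Cm_bounded \<kappa>(1)] \<kappa> by linarith
  have wg: "windowed p lm lp ?g" by (rule windowed_interpolant[OF g_windowed])
  obtain C where C: "C \<ge> 0" and close': "\<And>n x c. c < p \<Longrightarrow>
      \<bar>cascade p J A g n x $ c - cascade p J A ?g n x $ c\<bar> \<le> C * (discounted_sum \<kappa> \<delta> n + defect_tail \<delta> n)"
    using interpolant_cascade_close[OF sm \<kappa>] by blast
  obtain M where M: "M \<ge> 0" "\<And>x c. c < p \<Longrightarrow> \<bar>g x $ c\<bar> \<le> M"
    using continuous_windowed_bounded[OF g_windowed g_cont] by metis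
  define L where "L = real p * (real (card {lm..lp}) * M)"
  have L0: "0 \<le> L" using M(1) by (simp add: L_def)
  define a where "a = real p * (K1 + C * K0)"
  have a0: "0 \<le> a" using K1 C K0 by (simp add: a_def)
  have near: "vec_norm2 (\<Phi> x - cascade p J A ?g n x) \<le> a * \<kappa> ^ n" for n x
  proof -
    have wF: "windowed p lm lp (cascade p J A ?g n)"
      unfolding cascade_eq_from by (rule windowed_cascade_from[OF wg]) simp
    have "\<bar>(\<Phi> x - cascade p J A ?g n x) $ c\<bar> \<le> (K1 + C * K0) * \<kappa> ^ n" if c: "c < p" for c
    proof -
      have "C * (discounted_sum \<kappa> \<delta> n + defect_tail \<delta> n) \<le> C * (K0 * \<kappa> ^ n)"
        using rate C by (intro mult_left_mono) auto
      then have "\<bar>\<Phi> x $ c - cascade p J A ?g n x $ c\<bar> \<le> K1 * \<kappa> ^ n + C * (K0 * \<kappa> ^ n)"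
        using close[OF c, of n x] close'[OF c, of n x] by linarith
      then show ?thesis using c windowed_carrier[OF wF, of x] by (simp add: algebra_simps)
    qed
    then show ?thesis
      using vec_norm2_le_bound[of "\<Phi> x - cascade p J A ?g n x" "(K1 + C * K0) * \<kappa> ^ n"]
        windowed_carrier[OF wF, of x] by (simp add: a_def mult.assoc)
  qed
  have diff: "vec_norm2 (\<Phi> x - \<Phi> y) \<le> (2 * a) * \<kappa> ^ n + L * \<Lambda> ^ n * \<bar>x - y\<bar>" for x y n
  proof -
    let ?F = "cascade p J A ?g n"
    have wF: "windowed p lm lp ?F"
      unfolding cascade_eq_from by (rule windowed_cascade_from[OF wg]) simp
    note c = windowed_carrier[OF \<Phi>, of x] windowed_carrier[OF \<Phi>, of y]
      windowed_carrier[OF wF, of x] windowed_carrier[OF wF, of y]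
    have lip: "vec_norm2 (?g x - ?g y) \<le> L * \<bar>x - y\<bar>" for x y
      unfolding L_def using M by (intro interpolant_lipschitz) auto
    have "vec_norm2 (?F x - ?F y) \<le> L * \<Lambda> ^ n * \<bar>x - y\<bar>"
      unfolding cascade_eq_from using \<Lambda>
      by (intro cascade_from_lipschitz[OF wg lip L0]) auto
    moreover have "vec_norm2 (?F y - \<Phi> y) \<le> a * \<kappa> ^ n"
      using near[of y n] vec_norm2_minus_commute[OF c(2) c(4)] by simp
    ultimately show ?thesis
      using vec_norm2_triangle_via[OF c(1) c(3) c(2)] vec_norm2_triangle_via[OF c(3) c(4) c(2)] near[of x n]
      by linarith
  qed
  define B where "B = real p * (M + K1)"
  have \<Phi>B: "vec_norm2 (\<Phi> x) \<le> B" for x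
  proof -
    have "\<bar>\<Phi> x $ c\<bar> \<le> M + K1" if "c < p" for c
      using close[OF that, of 0 x] M(2)[OF that, of x] by (simp add: cascade_def)
    then show ?thesis
      using vec_norm2_le_bound[of "\<Phi> x" "M + K1"] windowed_carrier[OF \<Phi>, of x] by (simp add: B_def)
  qed
  have B0: "0 \<le> B" using M(1) K1 by (simp add: B_def)
  \<comment> \<open>The summand 2 B settles the case |x - y| >= 1, where the power is at least
    1.\<close>
  define H where "H = (2 * a + L) / \<kappa> + 2 * B"
  have H: "(2 * a + L) / \<kappa> \<le> H" "2 * B \<le> H" using B0 a0 L0 \<kappa>0 by (auto simp: H_def)
  have \<beta>0: "0 \<le> ?\<beta>" using \<kappa>0 \<kappa>(2) \<Lambda>(2) by (intro divide_nonneg_nonneg) auto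
  have "vec_norm2 (\<Phi> x - \<Phi> y) \<le> H * \<bar>x - y\<bar> powr ?\<beta>" for x y
  proof -
    consider "x = y" | "0 < \<bar>x - y\<bar>" "\<bar>x - y\<bar> < 1" | "1 \<le> \<bar>x - y\<bar>" by fastforce
    then show ?thesis
    proof cases
      case 1
      then have "\<Phi> x - \<Phi> y = 0\<^sub>v p" using windowed_carrier[OF \<Phi>, of x] by auto
      then show ?thesis using 1 by simp
    next
      case 2
      have "vec_norm2 (\<Phi> x - \<Phi> y) \<le> (2 * a + L) / \<kappa> * \<bar>x - y\<bar> powr ?\<beta>"
        using a0 by (intro holder_from_approximation_rates \<kappa>0 \<kappa> \<Lambda> L0 2 diff) auto
      also have "\<dots> \<le> H * \<bar>x - y\<bar> powr ?\<beta>" using H by (intro mult_right_mono) auto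
      finally show ?thesis .
    next
      case 3
      have "vec_norm2 (\<Phi> x - \<Phi> y) \<le> 2 * B"
        using vec_norm2_triangle_minus[OF windowed_carrier[OF \<Phi>] windowed_carrier[OF \<Phi>], of x y] \<Phi>B[of x] \<Phi>B[of y]
        by linarith
      also have "\<dots> \<le> H * 1" using H by simp
      also have "\<dots> \<le> H * \<bar>x - y\<bar> powr ?\<beta>"
        using 3 \<beta>0 H(2) B0 by (intro mult_left_mono ge_one_powr_ge_zero) auto
      finally show ?thesis .
    qed
  qed
  then show ?thesis unfolding holder_continuous_def by blast
qed

end

section \<open>Networks as register machines\<close>

text \<open>The span of \<open>X\<close> and the constants, with functions of the network input as
  vectors. Closure rules instead of coefficient lists let affine updates be verified by
  introduction.\<close>

inductive_set aff :: "(real \<Rightarrow> real) set \<Rightarrow> (real \<Rightarrow> real) set" for X where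
  aff_const: "(\<lambda>_. c) \<in> aff X"
| aff_mem: "f \<in> X \<Longrightarrow> f \<in> aff X"
| aff_add: "f \<in> aff X \<Longrightarrow> g \<in> aff X \<Longrightarrow> (\<lambda>x. f x + g x) \<in> aff X"
| aff_cmult: "f \<in> aff X \<Longrightarrow> (\<lambda>x. c * f x) \<in> aff X"

lemma aff_diff:
  assumes "f \<in> aff X" "g \<in> aff X"
  shows "(\<lambda>x. f x - g x) \<in> aff X"
  using aff_add[OF assms(1) aff_cmult[OF assms(2), of "-1"]] by simp

lemma aff_uminus: "f \<in> aff X \<Longrightarrow> (\<lambda>x. - f x) \<in> aff X"
  using aff_cmult[of f X "-1"] by simp

lemma aff_divide: "f \<in> aff X \<Longrightarrow> (\<lambda>x. f x / c) \<in> aff X"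
  using aff_cmult[of f X "1 / c"] by simp

lemma aff_sum: "(\<And>i. i \<in> I \<Longrightarrow> f i \<in> aff X) \<Longrightarrow> (\<lambda>x. \<Sum>i\<in>I. f i x) \<in> aff X"
  by (induction I rule: infinite_finite_induct) (auto intro: aff.intros)

lemma aff_trans:
  assumes "f \<in> aff X" "X \<subseteq> aff Y"
  shows "f \<in> aff Y"
  using assms by induction (auto intro: aff.intros)

lemma aff_linear_form:
  assumes "f \<in> aff (set xs)"
  shows "\<exists>a c. \<forall>x. f x = (\<Sum>i<length xs. a i * (xs ! i) x) + c"
  using assms
proof induction
  case (aff_const c)
  show ?case by (intro exI[of _ "\<lambda>_. 0"] exI[of _ c]) simp
next
  case (aff_mem f)
  then obtain j where j: "j < length xs" "xs ! j = f" by (auto simp: in_set_conv_nth)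
  have "f x = (\<Sum>i<length xs. (if i = j then 1 else 0) * (xs ! i) x) + 0" for x
    using j by (simp add: if_distrib[where f = "\<lambda>c. c * _"] sum.delta cong: if_cong)
  then show ?case by (intro exI[of _ "\<lambda>i. if i = j then 1 else 0"] exI[of _ 0] allI)
next
  case (aff_add f g)
  then obtain a b c d where f: "\<forall>x. f x = (\<Sum>i<length xs. a i * (xs ! i) x) + c"
    and g: "\<forall>x. g x = (\<Sum>i<length xs. b i * (xs ! i) x) + d" by blast
  have "f x + g x = (\<Sum>i<length xs. (a i + b i) * (xs ! i) x) + (c + d)" for x
    using f[rule_format, of x] g[rule_format, of x] by (simp add: algebra_simps sum.distrib)
  then show ?case by (intro exI[of _ "\<lambda>i. a i + b i"] exI[of _ "c + d"] allI)
next
  case (aff_cmult f k)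
  then obtain a c where f: "\<forall>x. f x = (\<Sum>i<length xs. a i * (xs ! i) x) + c" by blast
  have "k * f x = (\<Sum>i<length xs. (k * a i) * (xs ! i) x) + k * c" for x
    using f[rule_format, of x] by (simp add: algebra_simps sum_distrib_left)
  then show ?case by (intro exI[of _ "\<lambda>i. k * a i"] exI[of _ "k * c"] allI)
qed

lemma aff_family_matrix:
  assumes "\<And>i. i < m \<Longrightarrow> f i \<in> aff (set xs)"
  obtains M b where "M \<in> carrier_mat m (length xs)" "b \<in> carrier_vec m"
    "\<And>x. M *\<^sub>v Matrix.vec (length xs) (\<lambda>i. (xs ! i) x) + b = Matrix.vec m (\<lambda>i. f i x)"
proof -
  from assms have "\<forall>i. \<exists>a c. i < m \<longrightarrow> (\<forall>x. f i x = (\<Sum>j<length xs. a j * (xs ! j) x) + c)"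
    using aff_linear_form by blast
  then obtain a c where ac: "\<And>i x. i < m \<Longrightarrow> f i x = (\<Sum>j<length xs. a i j * (xs ! j) x) + c i" by metis
  show ?thesis
  proof (rule that)
    show "mat m (length xs) (\<lambda>(i, j). a i j) \<in> carrier_mat m (length xs)" "Matrix.vec m c \<in> carrier_vec m" by simp_all
    show "mat m (length xs) (\<lambda>(i, j). a i j) *\<^sub>v Matrix.vec (length xs) (\<lambda>i. (xs ! i) x) + Matrix.vec m c =
        Matrix.vec m (\<lambda>i. f i x)" for x
      by (rule eq_vecI) (auto simp: ac scalar_prod_def atLeast0LessThan)
  qed
qed

section \<open>Lists of affine maps and their layers\<close>

lemma sum_list_map_le_length:
  fixes f :: "'a \<Rightarrow> nat"
  shows "(\<And>x. x \<in> set xs \<Longrightarrow> f x \<le> c) \<Longrightarrow> sum_list (map f xs) \<le> length xs * c"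
  by (induction xs) (auto intro: add_mono)

text \<open>Networks without their output layer: these can be extended at the end, whereas the last
  affine map of a network is followed by no activation.\<close>

fun hidden_wf :: "nat \<Rightarrow> relu_net \<Rightarrow> nat \<Rightarrow> bool" where
  "hidden_wf d [] d' \<longleftrightarrow> d = d'"
| "hidden_wf d ((W, b) # Hs) d' \<longleftrightarrow>
     0 < dim_vec b \<and> W \<in> carrier_mat (dim_vec b) d \<and> hidden_wf (dim_vec b) Hs d'"

fun hidden_eval :: "relu_net \<Rightarrow> real vec \<Rightarrow> real vec" where
  "hidden_eval [] x = x"
| "hidden_eval ((W, b) # Hs) x = hidden_eval Hs (map_vec (\<lambda>t. max t 0) (W *\<^sub>v x + b))"

lemma hidden_wf_snoc:
  "hidden_wf d (Hs @ [(W, b)]) d' \<longleftrightarrow>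
    (\<exists>e. hidden_wf d Hs e \<and> 0 < dim_vec b \<and> W \<in> carrier_mat (dim_vec b) e \<and> d' = dim_vec b)"
  by (induction Hs arbitrary: d) auto

lemma hidden_eval_snoc:
  "hidden_eval (Hs @ [(W, b)]) x = map_vec (\<lambda>t. max t 0) (W *\<^sub>v hidden_eval Hs x + b)"
  by (induction Hs arbitrary: x) auto

lemma net_wf_snoc:
  "hidden_wf d Hs e \<Longrightarrow> W \<in> carrier_mat p e \<Longrightarrow> b \<in> carrier_vec p \<Longrightarrow> net_wf d (Hs @ [(W, b)]) p"
proof (induction Hs arbitrary: d)
  case (Cons l Hs)
  obtain W' b' where l: "l = (W', b')" by (cases l)
  obtain l' ls where ls: "Hs @ [(W, b)] = l' # ls" by (cases Hs) auto
  have "net_wf (dim_vec b') (Hs @ [(W, b)]) p" using Cons by (simp add: l)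
  then show ?case using Cons.prems by (simp add: l ls)
qed simp

lemma net_eval_snoc: "net_eval (Hs @ [(W, b)]) x = W *\<^sub>v hidden_eval Hs x + b"
proof (induction Hs arbitrary: x)
  case (Cons l Hs)
  obtain W' b' where l: "l = (W', b')" by (cases l)
  obtain l' ls where ls: "Hs @ [(W, b)] = l' # ls" by (cases Hs) auto
  show ?case using Cons[of "map_vec (\<lambda>t. max t 0) (W' *\<^sub>v x + b')"] by (simp add: l ls)
qed simp

text \<open>\<open>layer w l S\<close>: the set \<open>S\<close> consists of the activations of the \<open>l\<close>-th hidden layer of a network with
  one real input and width at most \<open>w\<close>, as functions of the input.\<close>
primrec layer :: "nat \<Rightarrow> nat \<Rightarrow> (real \<Rightarrow> real) set \<Rightarrow> bool" where
  "layer w 0 S \<longleftrightarrow> S = {\<lambda>x. x}"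
| "layer w (Suc l) S \<longleftrightarrow> finite S \<and> S \<noteq> {} \<and> card S \<le> w \<and>
     (\<exists>S'. layer w l S' \<and> S \<subseteq> (\<lambda>\<alpha> x. max (\<alpha> x) 0) ` aff S')"

text \<open>The bounds w + 1 instead of w allow for the input layer, which has one coordinate even
  for w = 0.\<close>

lemma layer_hidden_net:
  assumes "layer w l S"
  shows "\<exists>Hs xs. set xs = S \<and> length xs \<le> w + 1 \<and> length Hs = l \<and> hidden_wf 1 Hs (length xs) \<and>
    (\<forall>(W, b)\<in>set Hs. dim_row W \<le> w \<and> dim_col W \<le> w + 1 \<and> dim_vec b \<le> w) \<and>
    (\<forall>x. hidden_eval Hs (Matrix.vec 1 (\<lambda>_. x)) = Matrix.vec (length xs) (\<lambda>i. (xs ! i) x))"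
  using assms
proof (induction l arbitrary: S)
  case 0
  then show ?case by (intro exI[of _ "[]"] exI[of _ "[\<lambda>x. x]"]) auto
next
  case (Suc l)
  then obtain S' where S: "finite S" "S \<noteq> {}" "card S \<le> w" and S': "layer w l S'"
    and sub: "S \<subseteq> (\<lambda>\<alpha> x. max (\<alpha> x) 0) ` aff S'" by auto
  from Suc.IH[OF S'] obtain Hs xs where IH: "set xs = S'" "length xs \<le> w + 1" "length Hs = l"
    "hidden_wf 1 Hs (length xs)"
    "\<forall>(W, b)\<in>set Hs. dim_row W \<le> w \<and> dim_col W \<le> w + 1 \<and> dim_vec b \<le> w"
    "\<forall>x. hidden_eval Hs (Matrix.vec 1 (\<lambda>_. x)) = Matrix.vec (length xs) (\<lambda>i. (xs ! i) x)" by blast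
  obtain ys where ys: "set ys = S" "distinct ys" using finite_distinct_list[OF S(1)] by blast
  let ?m = "length ys"
  have m: "?m = card S" using distinct_card[OF ys(2)] ys(1) by simp
  have m0: "0 < ?m" using S m by (simp add: card_gt_0_iff)
  have "\<forall>i. \<exists>\<alpha>. i < ?m \<longrightarrow> \<alpha> \<in> aff (set xs) \<and> ys ! i = (\<lambda>x. max (\<alpha> x) 0)"
    using sub ys IH(1) nth_mem by blast
  then obtain \<alpha> where \<alpha>: "\<And>i. i < ?m \<Longrightarrow> \<alpha> i \<in> aff (set xs)" "\<And>i. i < ?m \<Longrightarrow> ys ! i = (\<lambda>x. max (\<alpha> i x) 0)"
    by metis
  obtain W b where Wb: "W \<in> carrier_mat ?m (length xs)" "b \<in> carrier_vec ?m"
    "\<And>x. W *\<^sub>v Matrix.vec (length xs) (\<lambda>i. (xs ! i) x) + b = Matrix.vec ?m (\<lambda>i. \<alpha> i x)"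
    using aff_family_matrix[of ?m \<alpha> xs] \<alpha>(1) by metis
  show ?case
  proof (intro exI[of _ "Hs @ [(W, b)]"] exI[of _ ys] conjI allI)
    show "set ys = S" by (rule ys)
    show "length ys \<le> w + 1" using m S by simp
    show "length (Hs @ [(W, b)]) = Suc l" using IH by simp
    show "hidden_wf 1 (Hs @ [(W, b)]) ?m" using IH(4) Wb m0 by (auto simp: hidden_wf_snoc)
    show "\<forall>(W, b)\<in>set (Hs @ [(W, b)]). dim_row W \<le> w \<and> dim_col W \<le> w + 1 \<and> dim_vec b \<le> w"
      using IH(2,5) Wb m S(3) by auto
    fix x
    have "hidden_eval (Hs @ [(W, b)]) (Matrix.vec 1 (\<lambda>_. x)) = map_vec (\<lambda>t. max t 0) (Matrix.vec ?m (\<lambda>i. \<alpha> i x))"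
      using IH(6) Wb(3) by (simp add: hidden_eval_snoc)
    also have "\<dots> = Matrix.vec ?m (\<lambda>i. (ys ! i) x)" by (rule eq_vecI) (auto simp: \<alpha>(2))
    finally show "hidden_eval (Hs @ [(W, b)]) (Matrix.vec 1 (\<lambda>_. x)) = Matrix.vec ?m (\<lambda>i. (ys ! i) x)" .
  qed
qed

text \<open>Registers are affine in the activations. They may thus be negative, and an affine update
  costs no layer because it merges with the next affine map.\<close>

definition stage :: "nat \<Rightarrow> nat \<Rightarrow> (real \<Rightarrow> real) set \<Rightarrow> bool" where
  "stage w l X \<longleftrightarrow> (\<exists>S. layer w l S \<and> X \<subseteq> aff S)"

lemma stage_initial: "stage w 0 {\<lambda>x. x}"
  unfolding stage_def by (auto intro: aff_mem)

text \<open>There are l + 1 affine maps, counting the output, and each has at most (w + p + 1)^2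
  parameters.\<close>

lemma stage_realizable:
  assumes st: "stage w l X" and f: "\<And>x. f x \<in> carrier_vec p" and X: "\<And>c. c < p \<Longrightarrow> (\<lambda>x. f x $ c) \<in> aff X"
  shows "relu_realizable p w (real (l + 1) * real ((w + p + 1) * (w + p + 1))) f"
proof -
  obtain S where S: "layer w l S" "X \<subseteq> aff S" using st by (auto simp: stage_def)
  from layer_hidden_net[OF S(1)] obtain Hs xs where H: "set xs = S" "length xs \<le> w + 1" "length Hs = l"
    "hidden_wf 1 Hs (length xs)"
    "\<forall>(W, b)\<in>set Hs. dim_row W \<le> w \<and> dim_col W \<le> w + 1 \<and> dim_vec b \<le> w"
    "\<forall>x. hidden_eval Hs (Matrix.vec 1 (\<lambda>_. x)) = Matrix.vec (length xs) (\<lambda>i. (xs ! i) x)" by blast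
  have "(\<lambda>x. f x $ c) \<in> aff (set xs)" if "c < p" for c using aff_trans[OF X[OF that]] S(2) H(1) by blast
  then obtain W b where Wb: "W \<in> carrier_mat p (length xs)" "b \<in> carrier_vec p"
    "\<And>x. W *\<^sub>v Matrix.vec (length xs) (\<lambda>i. (xs ! i) x) + b = Matrix.vec p (\<lambda>i. f x $ i)"
    using aff_family_matrix[of p "\<lambda>c x. f x $ c" xs] by metis
  let ?N = "Hs @ [(W, b)]"
  let ?m = "w + p + 1"
  have "net_wf 1 ?N p" by (rule net_wf_snoc[OF H(4) Wb(1,2)])
  moreover have "net_width ?N \<le> w"
    unfolding net_width_def using H(5) by (subst Max_le_iff) auto
  moreover have "real (net_params ?N) \<le> real (l + 1) * real (?m * ?m)"
  proof -
    have "(case l of (W, b) \<Rightarrow> dim_row W * dim_col W + dim_vec b) \<le> ?m * ?m" if "l \<in> set ?N" for l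
    proof -
      obtain W' b' where l: "l = (W', b')" by (cases l)
      have "dim_row W' \<le> w + p \<and> dim_col W' \<le> w + 1 \<and> dim_vec b' \<le> w + p"
        using that H(2,5) Wb unfolding l by fastforce
      then have "dim_row W' * dim_col W' + dim_vec b' \<le> (w + p) * (w + p + 1) + (w + p)"
        by (intro add_mono mult_mono) auto
      also have "\<dots> \<le> ?m * ?m" by simp
      finally show ?thesis by (simp add: l)
    qed
    then have "net_params ?N \<le> length ?N * (?m * ?m)"
      unfolding net_params_def by (intro sum_list_map_le_length) auto
    also have "length ?N = l + 1" using H(3) by simp
    finally show ?thesis by (metis of_nat_le_iff of_nat_mult)
  qed
  moreover have "net_eval ?N (Matrix.vec 1 (\<lambda>_. x)) = f x" for x
    using H(6) Wb(3) f[of x] by (auto simp: net_eval_snoc intro!: eq_vecI)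
  ultimately show ?thesis unfolding relu_realizable_def by blast
qed

text \<open>A register machine view of networks: \<open>computes w n X Y\<close> says that \<open>n\<close> further layers of width at most
  \<open>w\<close> suffice to pass from the functions \<open>X\<close> to the functions \<open>Y\<close>. Values are carried through a layer as
  \<open>t = max t 0 - max (- t) 0\<close>.\<close>
definition computes :: "nat \<Rightarrow> nat \<Rightarrow> (real \<Rightarrow> real) set \<Rightarrow> (real \<Rightarrow> real) set \<Rightarrow> bool" where
  "computes w n X Y \<longleftrightarrow> (\<forall>l. stage w l X \<longrightarrow> stage w (l + n) Y)"

lemma computes_trans: "computes w n X Y \<Longrightarrow> computes w m Y Z \<Longrightarrow> computes w (n + m) X Z"
  unfolding computes_def by (metis add.assoc)

lemma computes_aff: "Y \<subseteq> aff X \<Longrightarrow> computes w 0 X Y"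
  unfolding computes_def stage_def using aff_trans by fastforce

text \<open>A kept register occupies two units, for its positive and its negative part, and the new
  value one; hence the bound 2 card X + 1.\<close>

lemma computes_relu:
  assumes X: "finite X" "2 * card X + 1 \<le> w" and \<alpha>: "\<alpha> \<in> aff X"
  shows "computes w 1 X (insert (\<lambda>x. max (\<alpha> x) 0) X)"
  unfolding computes_def stage_def
proof (intro allI impI, elim exE conjE)
  fix l S assume S: "layer w l S" "X \<subseteq> aff S"
  let ?r = "\<lambda>\<alpha> x. max (\<alpha> x) (0::real)"
  let ?A = "insert \<alpha> (X \<union> (\<lambda>f x. - f x) ` X)"
  let ?S = "?r ` ?A"
  have A: "?A \<subseteq> aff S" using \<alpha> S(2) aff_trans by (auto intro: aff_uminus)
  have "card ?S \<le> card ?A" using X by (intro card_image_le) simp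
  also have "\<dots> \<le> Suc (card (X \<union> (\<lambda>f x. - f x) ` X))" by (rule card_insert_le_m1) auto
  also have "\<dots> \<le> Suc (card X + card ((\<lambda>f x. - f x) ` X))" using card_Un_le by simp
  also have "\<dots> \<le> w" using card_image_le[OF X(1), of "\<lambda>f x. - f x"] X(2) by simp
  finally have "card ?S \<le> w" .
  moreover have "?S \<subseteq> ?r ` aff S" using A by (rule image_mono)
  ultimately have "layer w (l + 1) ?S" using S(1) X(1) by (auto simp del: image_insert)
  moreover have "insert (?r \<alpha>) X \<subseteq> aff ?S"
  proof (intro insert_subsetI subsetI)
    show "?r \<alpha> \<in> aff ?S" by (intro aff_mem imageI) simp
    fix f assume "f \<in> X"
    then have "?r f \<in> aff ?S" "?r (\<lambda>x. - f x) \<in> aff ?S" by (auto intro!: aff_mem)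
    from aff_diff[OF this] have "(\<lambda>x. max (f x) 0 - max (- f x) 0) \<in> aff ?S" .
    moreover have "(\<lambda>x. max (f x) 0 - max (- f x) 0) = f" by (auto simp: max_def)
    ultimately show "f \<in> aff ?S" by simp
  qed
  ultimately show "\<exists>S. layer w (l + 1) S \<and> insert (?r \<alpha>) X \<subseteq> aff S" by blast
qed

text \<open>The values are produced one after the other; while the last one is computed, at most
  card X + card I - 1 registers are kept.\<close>

lemma computes_relus:
  assumes "finite I" "finite X" "2 * (card X + card I) \<le> w" "\<And>i. i \<in> I \<Longrightarrow> \<alpha> i \<in> aff X"
  shows "computes w (card I) X (X \<union> (\<lambda>i x. max (\<alpha> i x) 0) ` I)"
  using assms
proof (induction I rule: finite_induct)
  case empty
  show ?case by (auto intro!: computes_aff aff_mem)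
next
  case (insert i I)
  let ?Y = "X \<union> (\<lambda>i x. max (\<alpha> i x) 0) ` I"
  have 1: "computes w (card I) X ?Y" using insert by (intro insert.IH) auto
  have "card ?Y \<le> card X + card I"
    using card_Un_le[of X] card_image_le[OF insert.hyps(1)] by (meson add_left_mono order_trans)
  moreover have "2 * (card X + Suc (card I)) \<le> w" using insert.prems(2) insert.hyps by simp
  ultimately have card: "2 * card ?Y + 1 \<le> w" using mult_le_mono2[of "card ?Y" _ 2] by fastforce
  have "X \<subseteq> aff ?Y" by (auto intro: aff_mem)
  then have "\<alpha> i \<in> aff ?Y" using aff_trans insert.prems(3)[of i] by blast
  then have "computes w 1 ?Y (insert (\<lambda>x. max (\<alpha> i x) 0) ?Y)"
    using insert.hyps(1) insert.prems(1) card by (intro computes_relu) auto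
  from computes_trans[OF 1 this] show ?case using insert by simp
qed

text \<open>The rules mirror the operations of the register machine, so that programs for piecewise
  linear functions arise by induction.\<close>

inductive_set pwl :: "(real \<Rightarrow> real) set" where
  pwl_id: "(\<lambda>x. x) \<in> pwl"
| pwl_const: "(\<lambda>_. c) \<in> pwl"
| pwl_add: "f \<in> pwl \<Longrightarrow> g \<in> pwl \<Longrightarrow> (\<lambda>x. f x + g x) \<in> pwl"
| pwl_cmult: "f \<in> pwl \<Longrightarrow> (\<lambda>x. c * f x) \<in> pwl"
| pwl_relu: "f \<in> pwl \<Longrightarrow> (\<lambda>x. max (f x) 0) \<in> pwl"

lemma pwl_diff: "f \<in> pwl \<Longrightarrow> g \<in> pwl \<Longrightarrow> (\<lambda>x. f x - g x) \<in> pwl"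
  using pwl_add[of f, OF _ pwl_cmult[of g "-1"]] by simp

lemma pwl_uminus: "f \<in> pwl \<Longrightarrow> (\<lambda>x. - f x) \<in> pwl"
  using pwl_cmult[of f "-1"] by simp

lemma pwl_shift: "f \<in> pwl \<Longrightarrow> (\<lambda>x. f (x + a)) \<in> pwl"
  by (induction rule: pwl.induct) (auto intro: pwl.intros)

lemma card_insert_le_Suc: "card (insert x A) \<le> Suc (card A)"
  by (cases "finite A") (auto simp: card_insert_if)

definition computable_family :: "nat \<Rightarrow> nat \<Rightarrow> nat \<Rightarrow> (nat \<Rightarrow> real \<Rightarrow> real) \<Rightarrow> bool" where
  "computable_family n k m \<phi> \<longleftrightarrow> (\<forall>w X y. finite X \<longrightarrow> y \<in> aff X \<longrightarrow> 2 * (card X + k) \<le> w \<longrightarrow>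
    computes w n X (X \<union> (\<lambda>a x. \<phi> a (y x)) ` {..<m}))"

definition computable_fun :: "nat \<Rightarrow> nat \<Rightarrow> (real \<Rightarrow> real) \<Rightarrow> bool" where
  "computable_fun n k \<phi> \<longleftrightarrow> (\<forall>w X y. finite X \<longrightarrow> y \<in> aff X \<longrightarrow> 2 * (card X + k) \<le> w \<longrightarrow>
    computes w n X (insert (\<lambda>x. \<phi> (y x)) X))"

lemma computable_funD:
  "computable_fun n k \<phi> \<Longrightarrow> finite X \<Longrightarrow> y \<in> aff X \<Longrightarrow> 2 * (card X + k) \<le> w \<Longrightarrow>
    computes w n X (insert (\<lambda>x. \<phi> (y x)) X)"
  unfolding computable_fun_def by blast

lemma computable_familyD:
  "computable_family n k m \<phi> \<Longrightarrow> finite X \<Longrightarrow> y \<in> aff X \<Longrightarrow> 2 * (card X + k) \<le> w \<Longrightarrow>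
    computes w n X (X \<union> (\<lambda>a x. \<phi> a (y x)) ` {..<m})"
  unfolding computable_family_def by blast

lemma pwl_computable:
  assumes "\<phi> \<in> pwl"
  shows "\<exists>n k. computable_fun n k \<phi>"
  using assms
proof induction
  case pwl_id
  show ?case unfolding computable_fun_def
    by (intro exI[of _ 0] allI impI computes_aff) (auto intro: aff_mem)
next
  case (pwl_const c)
  show ?case unfolding computable_fun_def
    by (intro exI[of _ 0] allI impI computes_aff) (auto intro: aff_mem aff_const)
next
  case (pwl_add f g)
  then obtain n k n' k' where f: "computable_fun n k f" and g: "computable_fun n' k' g" by blast
  show ?case unfolding computable_fun_def
  proof (rule exI[of _ "n + n' + 0"], rule exI[of _ "k + k' + 1"], intro allI impI)
    fix w X y assume X: "finite X" "y \<in> aff X" "2 * (card X + (k + k' + 1)) \<le> w"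
    let ?Y = "insert (\<lambda>x. f (y x)) X"
    have 1: "computes w n X ?Y" using X by (intro computable_funD[OF f]) auto
    have 2: "computes w n' ?Y (insert (\<lambda>x. g (y x)) ?Y)"
      using X card_insert_le_Suc[of "\<lambda>x. f (y x)" X]
      by (intro computable_funD[OF g] aff_trans[OF X(2)]) (auto intro: aff_mem)
    have 3: "computes w 0 (insert (\<lambda>x. g (y x)) ?Y) (insert (\<lambda>x. f (y x) + g (y x)) X)"
      by (rule computes_aff) (auto intro: aff_mem aff_add)
    show "computes w (n + n' + 0) X (insert (\<lambda>x. f (y x) + g (y x)) X)"
      by (rule computes_trans[OF computes_trans[OF 1 2] 3])
  qed
next
  case (pwl_cmult f c)
  then obtain n k where f: "computable_fun n k f" by blast
  show ?case unfolding computable_fun_def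
  proof (rule exI[of _ "n + 0"], rule exI[of _ k], intro allI impI)
    fix w X y assume X: "finite X" "y \<in> aff X" "2 * (card X + k) \<le> w"
    have "computes w 0 (insert (\<lambda>x. f (y x)) X) (insert (\<lambda>x. c * f (y x)) X)"
      by (rule computes_aff) (auto intro: aff_mem aff_cmult)
    then show "computes w (n + 0) X (insert (\<lambda>x. c * f (y x)) X)"
      using computable_funD[OF f X] by (rule computes_trans[rotated])
  qed
next
  case (pwl_relu f)
  then obtain n k where f: "computable_fun n k f" by blast
  show ?case unfolding computable_fun_def
  proof (rule exI[of _ "n + 1 + 0"], rule exI[of _ "k + 2"], intro allI impI)
    fix w X y assume X: "finite X" "y \<in> aff X" "2 * (card X + (k + 2)) \<le> w"
    let ?Y = "insert (\<lambda>x. f (y x)) X"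
    have 1: "computes w n X ?Y" using X by (intro computable_funD[OF f]) auto
    have 2: "computes w 1 ?Y (insert (\<lambda>x. max (f (y x)) 0) ?Y)"
      using X card_insert_le_Suc[of "\<lambda>x. f (y x)" X] by (intro computes_relu) (auto intro: aff_mem)
    have 3: "computes w 0 (insert (\<lambda>x. max (f (y x)) 0) ?Y) (insert (\<lambda>x. max (f (y x)) 0) X)"
      by (rule computes_aff) (auto intro: aff_mem)
    show "computes w (n + 1 + 0) X (insert (\<lambda>x. max (f (y x)) 0) X)"
      by (rule computes_trans[OF computes_trans[OF 1 2] 3])
  qed
qed

lemma pwl_family_computable:
  assumes "\<And>a. a < m \<Longrightarrow> \<phi> a \<in> pwl"
  shows "\<exists>n k. computable_family n k m \<phi>"
  using assms
proof (induction m)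
  case 0
  show ?case unfolding computable_family_def by (intro exI[of _ 0] allI impI computes_aff) (auto intro: aff_mem)
next
  case (Suc m)
  obtain n k where f: "computable_family n k m \<phi>"
    using Suc.IH Suc.prems by (metis less_Suc_eq)
  obtain n' k' where g: "computable_fun n' k' (\<phi> m)"
    using pwl_computable[OF Suc.prems[of m]] by blast
  show ?case unfolding computable_family_def
  proof (rule exI[of _ "n + n'"], rule exI[of _ "k + k' + m"], intro allI impI)
    fix w X y assume X: "finite X" "y \<in> aff X" "2 * (card X + (k + k' + m)) \<le> w"
    let ?Y = "X \<union> (\<lambda>a x. \<phi> a (y x)) ` {..<m}"
    have 1: "computes w n X ?Y" using X by (intro computable_familyD[OF f]) auto
    have "card ?Y \<le> card X + m"
      using card_Un_le[of X "(\<lambda>a x. \<phi> a (y x)) ` {..<m}"] card_image_le[of "{..<m}" "\<lambda>a x. \<phi> a (y x)"] by simp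
    then have 2: "computes w n' ?Y (insert (\<lambda>x. \<phi> m (y x)) ?Y)"
      using X by (intro computable_funD[OF g] aff_trans[OF X(2)]) (auto intro: aff_mem)
    from computes_trans[OF 1 2] show "computes w (n + n') X (X \<union> (\<lambda>a x. \<phi> a (y x)) ` {..<Suc m})"
      by (simp add: lessThan_Suc Un_insert_right)
  qed
qed

section \<open>Digit extraction\<close>

definition clamp :: "real \<Rightarrow> real" where
  "clamp t = max t 0 - max (t - 1) 0"

text \<open>For \<open>0 \<le> m\<close> this truncates \<open>t\<close> to the interval from -m to
  m, using only activations and sums.\<close>

definition clip :: "real \<Rightarrow> real \<Rightarrow> real" where
  "clip t m = t - max (t - m) 0 + max (- t - m) 0"

lemma clamp_eq_0: "t \<le> 0 \<Longrightarrow> clamp t = 0"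
  and clamp_eq_1: "1 \<le> t \<Longrightarrow> clamp t = 1"
  and clamp_nonneg: "0 \<le> clamp t"
  by (auto simp: clamp_def)

lemma clip_0_right [simp]: "clip t 0 = 0"
  and clip_0_left: "0 \<le> m \<Longrightarrow> clip 0 m = 0"
  and clip_id: "\<bar>t\<bar> \<le> m \<Longrightarrow> clip t m = t"
  by (auto simp: clip_def)

text \<open>A ramp that equals the digit wherever |y - 1/2| >= 2 ^ -(N + 5). A folded distance above
  1/16 after N steps guarantees this at every earlier step, whence the exponent N + 4.\<close>

definition soft_digit :: "nat \<Rightarrow> real \<Rightarrow> real" where
  "soft_digit N y = clamp (2 ^ (N + 4) * (y - 1 / 2) + 1 / 2)"

primrec soft_orbit :: "nat \<Rightarrow> nat \<Rightarrow> real \<Rightarrow> real" where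
  "soft_orbit N 0 u = u"
| "soft_orbit N (Suc k) u = 2 * soft_orbit N k u - soft_digit N (soft_orbit N k u)"

text \<open>The digits found so far, stored as the binary expansion of a single number, the latest digit first.\<close>
primrec digit_stack :: "nat \<Rightarrow> nat \<Rightarrow> real \<Rightarrow> real" where
  "digit_stack N 0 u = 0"
| "digit_stack N (Suc k) u = (digit_stack N k u + soft_digit N (soft_orbit N k u)) / 2"

text \<open>Unlike \<open>soft_digit\<close>, this ramp meets no ambiguous input: a nonempty stack
  of at most N genuine digits is either at least 1/2 or at most 1/2 - 2 ^ -N, and the ramp rises in
  between.\<close>

definition pop_digit :: "nat \<Rightarrow> real \<Rightarrow> real" where
  "pop_digit N s = clamp (2 ^ N * (s - 1 / 2) + 1)"

primrec popped_stack :: "nat \<Rightarrow> nat \<Rightarrow> real \<Rightarrow> real" where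
  "popped_stack N 0 u = digit_stack N N u"
| "popped_stack N (Suc j) u = 2 * popped_stack N j u - pop_digit N (popped_stack N j u)"

text \<open>The distance of \<open>2\<^sup>k u\<close> to the nearest integer, obtained exactly by iterating the tent map.\<close>
primrec fold_dist :: "nat \<Rightarrow> real \<Rightarrow> real" where
  "fold_dist 0 u = u - max (2 * u - 1) 0"
| "fold_dist (Suc k) u = 2 * fold_dist k u - max (4 * fold_dist k u - 1) 0"

lemma fold_dist_eq:
  assumes "u \<in> {0..1}"
  shows "fold_dist k u = min ((doubling ^^ k) u) (1 - (doubling ^^ k) u)"
proof (induction k)
  case 0
  show ?case by (auto simp: min_def max_def)
next
  case (Suc k)
  define t where "t = (doubling ^^ k) u"
  have "t \<in> {0..1}" unfolding t_def using assms by (rule doubling_funpow_unit_interval)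
  then show ?case unfolding fold_dist.simps(2) Suc funpow.simps o_apply t_def[symmetric]
    by (auto simp: doubling_def binary_digit_def min_def max_def)
qed

lemma fold_dist_add_le: "fold_dist (k + m) u \<le> 2 ^ m * fold_dist k u"
proof (induction m)
  case (Suc m)
  have "fold_dist (k + Suc m) u \<le> 2 * fold_dist (k + m) u" by simp
  also have "\<dots> \<le> 2 * (2 ^ m * fold_dist k u)" using Suc by simp
  finally show ?case by simp
qed simp

text \<open>A step at most doubles the folded distance, so a value above 1/16 after N steps forces
  one above 2 ^ -(N + 4) after k + 1 steps, and this keeps the k-th point away from 1/2.\<close>

lemma soft_digit_exact:
  assumes u: "u \<in> {0..1}" and good: "1 / 16 < fold_dist N u" and k: "k < N"
  shows "soft_digit N ((doubling ^^ k) u) = real (binary_digit ((doubling ^^ k) u))"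
proof -
  let ?t = "(doubling ^^ k) u"
  have "fold_dist N u \<le> 2 ^ (N - Suc k) * fold_dist (Suc k) u"
    using fold_dist_add_le[of "Suc k" "N - Suc k" u] k by simp
  moreover have "0 \<le> fold_dist (Suc k) u"
    using fold_dist_eq[OF u, of "Suc k"] doubling_funpow_unit_interval[OF u, of "Suc k"] by auto
  then have "2 ^ (N - Suc k) * fold_dist (Suc k) u \<le> 2 ^ N * fold_dist (Suc k) u"
    by (intro mult_right_mono power_increasing) auto
  ultimately have "1 / 16 < 2 ^ N * fold_dist (Suc k) u" using good by linarith
  moreover have "fold_dist (Suc k) u \<le> 2 * \<bar>?t - 1 / 2\<bar>"
    by (simp only: fold_dist.simps(2) fold_dist_eq[OF u, of k]) (auto simp: min_def max_def)
  then have "2 ^ N * fold_dist (Suc k) u \<le> 2 ^ N * (2 * \<bar>?t - 1 / 2\<bar>)" by (intro mult_left_mono) auto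
  ultimately have "1 / 16 < 2 ^ N * (2 * \<bar>?t - 1 / 2\<bar>)" by linarith
  then have far: "1 / 2 \<le> 2 ^ (N + 4) * \<bar>?t - 1 / 2\<bar>" by (simp add: power_add)
  show ?thesis
  proof (cases "1 / 2 \<le> ?t")
    case True
    then have "1 \<le> 2 ^ (N + 4) * (?t - 1 / 2) + 1 / 2" using far by simp
    then show ?thesis using True by (simp add: soft_digit_def clamp_eq_1 binary_digit_def)
  next
    case False
    then have "\<bar>?t - 1 / 2\<bar> = - (?t - 1 / 2)" by simp
    then have "2 ^ (N + 4) * (?t - 1 / 2) + 1 / 2 \<le> 0" using far by (simp only: mult_minus_right)
    then show ?thesis using False by (simp add: soft_digit_def clamp_eq_0 binary_digit_def)
  qed
qed

lemma soft_orbit_exact: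
  assumes u: "u \<in> {0..1}" and good: "1 / 16 < fold_dist N u" and k: "k \<le> N"
  shows "soft_orbit N k u = (doubling ^^ k) u"
  using k
proof (induction k)
  case (Suc k)
  then show ?case using soft_digit_exact[OF u good, of k] by (simp add: doubling_def[of "(doubling ^^ k) u"])
qed simp

primrec exact_stack :: "nat \<Rightarrow> real \<Rightarrow> real" where
  "exact_stack 0 u = 0"
| "exact_stack (Suc k) u = (exact_stack k u + real (binary_digit ((doubling ^^ k) u))) / 2"

lemma exact_stack_bounds: "0 \<le> exact_stack k u \<and> exact_stack k u \<le> 1 - 1 / 2 ^ k"
proof (induction k)
  case (Suc k)
  have "real (binary_digit ((doubling ^^ k) u)) \<in> {0, 1}" using binary_digit_01[of "(doubling ^^ k) u"] by auto
  then show ?case using Suc by auto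
qed simp

lemma digit_stack_exact:
  assumes u: "u \<in> {0..1}" and good: "1 / 16 < fold_dist N u" and k: "k \<le> N"
  shows "digit_stack N k u = exact_stack k u"
  using k
proof (induction k)
  case (Suc k)
  then show ?case using soft_orbit_exact[OF u good, of k] soft_digit_exact[OF u good, of k] by simp
qed simp

lemma pop_digit_exact:
  assumes "k < N"
  shows "pop_digit N (exact_stack (Suc k) u) = real (binary_digit ((doubling ^^ k) u))"
proof (cases "binary_digit ((doubling ^^ k) u) = 0")
  case True
  have "exact_stack (Suc k) u - 1 / 2 \<le> - (1 / 2 ^ Suc k)"
    using exact_stack_bounds[of k u] True by simp
  also have "\<dots> \<le> - (1 / 2 ^ N)"
    using assms by (intro le_imp_neg_le divide_left_mono power_increasing) auto
  finally have "2 ^ N * (exact_stack (Suc k) u - 1 / 2) \<le> 2 ^ N * - (1 / 2 ^ N)" by (intro mult_left_mono) auto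
  then have "2 ^ N * (exact_stack (Suc k) u - 1 / 2) + 1 \<le> 0" by simp
  then show ?thesis using True by (simp add: pop_digit_def clamp_eq_0 del: exact_stack.simps)
next
  case False
  then have one: "binary_digit ((doubling ^^ k) u) = 1" using binary_digit_01[of "(doubling ^^ k) u"] by auto
  have "0 \<le> exact_stack (Suc k) u - 1 / 2" using exact_stack_bounds[of k u] one by simp
  then have "1 \<le> 2 ^ N * (exact_stack (Suc k) u - 1 / 2) + 1" by simp
  then show ?thesis using one by (simp add: pop_digit_def clamp_eq_1 del: exact_stack.simps)
qed

lemma popped_stack_exact:
  assumes u: "u \<in> {0..1}" and good: "1 / 16 < fold_dist N u" and j: "j \<le> N"
  shows "popped_stack N j u = exact_stack (N - j) u"
  using j
proof (induction j)
  case 0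
  then show ?case using digit_stack_exact[OF u good] by simp
next
  case (Suc j)
  then have eq: "popped_stack N j u = exact_stack (Suc (N - Suc j)) u" by (simp add: Suc_diff_Suc del: exact_stack.simps)
  have pop: "pop_digit N (popped_stack N j u) = real (binary_digit ((doubling ^^ (N - Suc j)) u))"
    unfolding eq using Suc.prems by (intro pop_digit_exact) simp
  show ?case unfolding popped_stack.simps pop unfolding eq by (simp add: field_simps)
qed

section \<open>Matrix products selected by popped digits\<close>

context cascade_window
begin

text \<open>
  Row products \<open>T\<^sub>\<epsilon> v\<close> are selected by the popped digits: \<open>clip\<close> multiplies by a digit exactly. The initial
  vector is cut off where some digit may be wrong, which is harmless if the data vanish there.
\<close>
primrec back_vec :: "nat \<Rightarrow> (nat \<Rightarrow> real \<Rightarrow> real) \<Rightarrow> real \<Rightarrow> nat \<Rightarrow> nat \<Rightarrow> real \<Rightarrow> real" where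
  "back_vec N \<phi> M 0 = (\<lambda>a u. clip (\<phi> a (soft_orbit N N u)) (M * clamp (16 * fold_dist N u - 1)))"
| "back_vec N \<phi> M (Suc j) = (\<lambda>a u. (\<Sum>b<D. T (N - j) 0 $$ (a, b) * back_vec N \<phi> M j b u) +
     clip (\<Sum>b<D. (T (N - j) 1 $$ (a, b) - T (N - j) 0 $$ (a, b)) * back_vec N \<phi> M j b u)
       (M * pop_digit N (popped_stack N j u)))"

lemma T_mult_index:
  assumes "v \<in> carrier_vec D" "a < D"
  shows "(T k e *\<^sub>v v) $ a = (\<Sum>b<D. T k e $$ (a, b) * v $ b)"
  using assms transition_carrier[of k e]
  by (auto simp: scalar_prod_def atLeast0LessThan transition_def intro!: sum.cong)

text \<open>The folded distance after N steps has three zones. Up to 1/16 the digits are unreliable,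
  but the cut-off makes the initial vector 0, which stays 0 whatever is popped because
  \<open>clip 0 m = 0\<close>; the true value is 0 too. From there to 1/8 the digits are right and
  the data vanish. Beyond 1/8 the cut-off has reached its full height \<open>M\<close>, at which
  clipping changes none of the vectors involved.\<close>

lemma back_vec_exact:
  assumes f: "windowed p lm lp f"
    and near: "\<And>t. t \<in> {0..1} \<Longrightarrow> min t (1 - t) \<le> 1 / 8 \<Longrightarrow> G f t = 0\<^sub>v D"
    and \<phi>: "\<And>a t. a < D \<Longrightarrow> t \<in> {0..1} \<Longrightarrow> \<phi> a t = G f t $ a"
    and M: "\<And>a t. a < D \<Longrightarrow> t \<in> {0..1} \<Longrightarrow> \<bar>G f t $ a\<bar> \<le> M"
      "\<And>a k j t. a < D \<Longrightarrow> 1 \<le> k \<Longrightarrow> j < N \<Longrightarrow> t \<in> {0..1} \<Longrightarrow>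
        \<bar>(T k 1 *\<^sub>v G (cascade_from (Suc k) j f) t) $ a - (T k 0 *\<^sub>v G (cascade_from (Suc k) j f) t) $ a\<bar> \<le> M"
    and u: "u \<in> {0..1}" and j: "j \<le> N" and a: "a < D"
  shows "back_vec N \<phi> M j a u = G (cascade_from (Suc (N - j)) j f) ((doubling ^^ (N - j)) u) $ a"
proof -
  have t01: "(doubling ^^ k) u \<in> {0..1}" for k by (rule doubling_funpow_unit_interval[OF u])
  have M0: "0 \<le> M" using order_trans[OF abs_ge_zero M(1)[OF a u]] .
  have bad: "G (cascade_from (Suc (N - j)) j f) ((doubling ^^ (N - j)) u) = 0\<^sub>v D"
    if "\<not> 1 / 16 < fold_dist N u" "j \<le> N" for j
  proof -
    have "(doubling ^^ j) ((doubling ^^ (N - j)) u) = (doubling ^^ N) u"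
      using that(2) by (metis funpow_add le_add_diff_inverse o_apply)
    moreover have "G f ((doubling ^^ N) u) = 0\<^sub>v D"
      using that fold_dist_eq[OF u, of N] by (intro near t01) auto
    ultimately show ?thesis
      using stack_cascade_from[OF f _ t01[of "N - j"], of "Suc (N - j)" j]
        mult_mat_vec_zero[OF chrono_prod_carrier[OF binary_family_T _ set_binary_digits]] by simp
  qed
  show ?thesis
    using j a
  proof (induction j arbitrary: a)
    case 0
    let ?t = "(doubling ^^ N) u"
    show ?case
    proof (cases "1 / 16 < fold_dist N u")
      case False
      then have "clamp (16 * fold_dist N u - 1) = 0" by (intro clamp_eq_0) auto
      then show ?thesis using bad[OF False, of 0] 0 by simp
    next
      case True
      then have val: "\<phi> a (soft_orbit N N u) = G f ?t $ a"
        using soft_orbit_exact[OF u True, of N] \<phi>[OF 0(2) t01] by simp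
      show ?thesis
      proof (cases "fold_dist N u \<le> 1 / 8")
        case True
        then have "G f ?t = 0\<^sub>v D" using fold_dist_eq[OF u, of N] by (intro near t01) auto
        then show ?thesis using val M0 0 by (simp add: clip_0_left clamp_nonneg)
      next
        case False
        then have "clamp (16 * fold_dist N u - 1) = 1" by (intro clamp_eq_1) auto
        then show ?thesis using val clip_id[OF M(1)[OF 0(2) t01[of N]]] by simp
      qed
    qed
  next
    case (Suc j)
    \<comment> \<open>Level k consumes the digit with number k - 1, as levels count from 1 and
      digits from 0.\<close>
    define k where "k = N - j"
    have k: "1 \<le> k" "N - Suc j = k - 1" "Suc (k - 1) = k" using Suc.prems by (auto simp: k_def)
    let ?h = "cascade_from (Suc k) j f"
    let ?t = "(doubling ^^ k) u" and ?s = "(doubling ^^ (k - 1)) u"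
    let ?e = "binary_digit ?s"
    define v where "v = G ?h ?t"
    have v: "v \<in> carrier_vec D" unfolding v_def by (rule stack_carrier)
    have t: "?t = doubling ?s" using k(1) by (cases k) auto
    have IH: "back_vec N \<phi> M j b u = v $ b" if "b < D" for b
      using Suc.IH[OF _ that] Suc.prems by (simp add: v_def k_def)
    have st: "(?t + real ?e) / 2 = ?s" unfolding t doubling_def[of ?s] by simp
    have "G (V k ?h) ((?t + real ?e) / 2) = T k ?e *\<^sub>v v"
      unfolding v_def by (rule stack_V[OF windowed_cascade_from[OF f] k(1) t01[of k] binary_digit_01[of ?s]]) simp
    then have "G (V k ?h) ?s = T k ?e *\<^sub>v v" by (simp only: st)
    then have rhs: "G (cascade_from (Suc (N - Suc j)) (Suc j) f) ((doubling ^^ (N - Suc j)) u) $ a =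
        (T k ?e *\<^sub>v v) $ a" by (simp only: cascade_from_Suc k(2,3))
    define w where "w = (T k 1 *\<^sub>v v) $ a - (T k 0 *\<^sub>v v) $ a"
    have lhs: "back_vec N \<phi> M (Suc j) a u = (T k 0 *\<^sub>v v) $ a + clip w (M * pop_digit N (popped_stack N j u))"
      using Suc.prems(2) v
      by (simp add: IH w_def T_mult_index k_def[symmetric] left_diff_distrib sum_subtractf)
    show ?case
    proof (cases "1 / 16 < fold_dist N u")
      case False
      have "v = 0\<^sub>v D" unfolding v_def k_def using bad[OF False, of j] Suc.prems by simp
      then have "(T k e *\<^sub>v v) $ a = 0" for e using mult_mat_vec_zero[OF transition_carrier] Suc.prems(2) by simp
      then show ?thesis unfolding lhs rhs using M0
        by (simp add: w_def clip_0_left pop_digit_def clamp_nonneg)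
    next
      case True
      have "popped_stack N j u = exact_stack k u"
        using popped_stack_exact[OF u True, of j] Suc.prems by (simp add: k_def)
      then have eq: "popped_stack N j u = exact_stack (Suc (k - 1)) u" by (simp only: k(3))
      have pop: "pop_digit N (popped_stack N j u) = real ?e"
        unfolding eq by (rule pop_digit_exact) (use Suc.prems k(1) in \<open>simp add: k_def\<close>)
      have w: "\<bar>w\<bar> \<le> M" unfolding w_def v_def using M(2) Suc.prems k(1) t01 by simp
      show ?thesis
      proof (cases "?e = 0")
        case True
        then show ?thesis unfolding lhs rhs pop by simp
      next
        case False
        then have e1: "?e = 1" using binary_digit_01[of ?s] by auto
        then have "clip w (M * real ?e) = w" using clip_id[OF w] by simp
        then show ?thesis unfolding lhs rhs pop e1 by (simp add: w_def)
      qed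
    qed
  qed
qed

end

section \<open>Layer and register counts of the digit machine\<close>

lemma computes_relu2:
  assumes X: "finite X" "2 * (card X + 2) \<le> w" and "\<alpha> \<in> aff X" "\<beta> \<in> aff X"
  shows "computes w 2 X (insert (\<lambda>x. max (\<alpha> x) 0) (insert (\<lambda>x. max (\<beta> x) 0) X))"
proof -
  have 1: "computes w 1 X (insert (\<lambda>x. max (\<beta> x) 0) X)" using assms by (intro computes_relu) auto
  have "X \<subseteq> aff (insert (\<lambda>x. max (\<beta> x) 0) X)" by (auto intro: aff_mem)
  then have "\<alpha> \<in> aff (insert (\<lambda>x. max (\<beta> x) 0) X)" using aff_trans assms(3) by blast
  then have 2: "computes w 1 (insert (\<lambda>x. max (\<beta> x) 0) X)
      (insert (\<lambda>x. max (\<alpha> x) 0) (insert (\<lambda>x. max (\<beta> x) 0) X))"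
    using X card_insert_le_Suc[of "\<lambda>x. max (\<beta> x) 0" X] by (intro computes_relu) auto
  from computes_trans[OF 1 2] show ?thesis by (simp only: one_add_one)
qed

text \<open>Each clipped value needs two activations; the Boolean index tells the upper truncation
  from the lower one.\<close>

lemma computes_clip_family:
  assumes X: "finite X" "2 * (card X + 2 * d) \<le> w"
    and v: "\<And>a. a < d \<Longrightarrow> v a \<in> aff X" and m: "m \<in> aff X"
  shows "computes w (2 * d) X (X \<union> (\<lambda>a x. clip (v a x) (m x)) ` {..<d})"
proof -
  define \<alpha> where "\<alpha> = (\<lambda>(a, b) x. if b then v a x - m x else - v a x - m x)"
  let ?I = "{..<d} \<times> (UNIV :: bool set)"
  have card: "card ?I = 2 * d" by (simp add: card_cartesian_product)
  have "\<alpha> i \<in> aff X" if "i \<in> ?I" for i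
  proof -
    obtain a b where i: "i = (a, b)" by (cases i)
    then have "a < d" using that by simp
    then show ?thesis using v m by (cases b) (auto simp: \<alpha>_def i intro!: aff_diff aff_uminus)
  qed
  then have "computes w (card ?I) X (X \<union> (\<lambda>i x. max (\<alpha> i x) 0) ` ?I)"
    using X by (intro computes_relus) (auto simp: card)
  moreover have "computes w 0 (X \<union> (\<lambda>i x. max (\<alpha> i x) 0) ` ?I) (X \<union> (\<lambda>a x. clip (v a x) (m x)) ` {..<d})"
  proof (rule computes_aff, safe)
    let ?Y = "X \<union> (\<lambda>i x. max (\<alpha> i x) 0) ` ?I"
    show "f \<in> aff ?Y" if "f \<in> X" for f using that by (auto intro: aff_mem)
    fix a assume a: "a < d"
    have "X \<subseteq> aff ?Y" by (auto intro: aff_mem)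
    then have "v a \<in> aff ?Y" using aff_trans v[OF a] by blast
    moreover have "(\<lambda>x. max (\<alpha> (a, True) x) 0) \<in> aff ?Y" "(\<lambda>x. max (\<alpha> (a, False) x) 0) \<in> aff ?Y"
      using a by (auto intro!: aff_mem)
    ultimately have "(\<lambda>x. v a x - max (\<alpha> (a, True) x) 0 + max (\<alpha> (a, False) x) 0) \<in> aff ?Y"
      by (intro aff_add aff_diff)
    then show "(\<lambda>x. clip (v a x) (m x)) \<in> aff ?Y" by (simp add: \<alpha>_def clip_def)
  qed
  ultimately show ?thesis using computes_trans card by fastforce
qed

text \<open>One layer starts the folding; each digit costs two layers for its ramp and one for the
  next fold.\<close>

lemma computes_forward:
  assumes X: "finite X" "2 * (card X + 6) \<le> w" and u: "u \<in> aff X"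
  shows "computes w (1 + k * 3) X
    (X \<union> {\<lambda>x. soft_orbit N k (u x), \<lambda>x. digit_stack N k (u x), \<lambda>x. fold_dist k (u x)})"
proof (induction k)
  case 0
  let ?r = "\<lambda>x. max (2 * u x - 1) 0"
  have "computes w 1 X (insert ?r X)"
    using X u by (intro computes_relu aff_diff aff_cmult aff_const) auto
  moreover have "computes w 0 (insert ?r X)
      (X \<union> {\<lambda>x. soft_orbit N 0 (u x), \<lambda>x. digit_stack N 0 (u x), \<lambda>x. fold_dist 0 (u x)})"
  proof (rule computes_aff)
    have "X \<subseteq> aff (insert ?r X)" by (auto intro: aff_mem)
    moreover from this have "u \<in> aff (insert ?r X)" using aff_trans u by blast
    moreover have "?r \<in> aff (insert ?r X)" by (auto intro: aff_mem)
    ultimately show "X \<union> {\<lambda>x. soft_orbit N 0 (u x), \<lambda>x. digit_stack N 0 (u x), \<lambda>x. fold_dist 0 (u x)} \<subseteq>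
        aff (insert ?r X)"
      by (auto intro: aff_const aff_diff)
  qed
  ultimately show ?case using computes_trans by fastforce
next
  case (Suc k)
  let ?y = "\<lambda>x. soft_orbit N k (u x)" and ?s = "\<lambda>x. digit_stack N k (u x)" and ?d = "\<lambda>x. fold_dist k (u x)"
  let ?Y = "X \<union> {?y, ?s, ?d}"
  define z where "z = (\<lambda>x. 2 ^ (N + 4) * (?y x - 1 / 2) + 1 / 2)"
  have fin: "finite ?Y" using X by simp
  have cY: "card ?Y \<le> card X + 3"
    using card_Un_le[of X "{?y, ?s, ?d}"] card_insert_le_Suc[of ?y "{?s, ?d}"] card_insert_le_Suc[of ?s "{?d}"] by simp
  have mem: "?y \<in> aff ?Y" "?s \<in> aff ?Y" "?d \<in> aff ?Y" by (auto intro: aff_mem)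
  have z: "z \<in> aff ?Y" unfolding z_def by (intro aff_add aff_cmult aff_diff aff_const mem)
  let ?Z = "insert (\<lambda>x. max (z x) 0) (insert (\<lambda>x. max (z x - 1) 0) ?Y)"
  have 1: "computes w 2 ?Y ?Z"
    using fin cY X(2) by (intro computes_relu2 z aff_diff aff_const) auto
  have dZ: "?d \<in> aff ?Z" by (auto intro: aff_mem)
  have cZ: "card ?Z \<le> card X + 5"
    using cY card_insert_le_Suc[of "\<lambda>x. max (z x) 0" "insert (\<lambda>x. max (z x - 1) 0) ?Y"]
      card_insert_le_Suc[of "\<lambda>x. max (z x - 1) 0" ?Y] by linarith
  let ?r = "\<lambda>x. max (4 * ?d x - 1) 0"
  have 2: "computes w 1 ?Z (insert ?r ?Z)"
    using fin cZ X(2) dZ by (intro computes_relu aff_diff aff_cmult aff_const) auto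
  have 3: "computes w 0 (insert ?r ?Z)
      (X \<union> {\<lambda>x. soft_orbit N (Suc k) (u x), \<lambda>x. digit_stack N (Suc k) (u x), \<lambda>x. fold_dist (Suc k) (u x)})"
  proof (rule computes_aff)
    let ?A = "aff (insert ?r ?Z)"
    have mem': "?y \<in> ?A" "?s \<in> ?A" "?d \<in> ?A" "?r \<in> ?A" "X \<subseteq> ?A"
      "(\<lambda>x. max (z x) 0) \<in> ?A" "(\<lambda>x. max (z x - 1) 0) \<in> ?A" by (auto intro: aff_mem)
    have digit: "(\<lambda>x. soft_digit N (?y x)) \<in> ?A"
      using aff_diff[OF mem'(6,7)] by (simp add: soft_digit_def clamp_def z_def)
    have "(\<lambda>x. 2 * ?y x - soft_digit N (?y x)) \<in> ?A" by (intro aff_diff aff_cmult mem' digit)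
    moreover have "(\<lambda>x. (?s x + soft_digit N (?y x)) / 2) \<in> ?A" by (intro aff_divide aff_add mem' digit)
    moreover have "(\<lambda>x. 2 * ?d x - max (4 * ?d x - 1) 0) \<in> ?A" by (intro aff_diff aff_cmult mem')
    ultimately show "X \<union> {\<lambda>x. soft_orbit N (Suc k) (u x), \<lambda>x. digit_stack N (Suc k) (u x),
        \<lambda>x. fold_dist (Suc k) (u x)} \<subseteq> ?A" using mem'(5) by simp
  qed
  have "1 + k * 3 + (2 + (1 + 0)) = 1 + Suc k * 3" by simp
  with computes_trans[OF Suc computes_trans[OF 1 computes_trans[OF 2 3]]] show ?case by (simp only:)
qed

context cascade_window
begin

lemma computes_back_step:
  fixes N j :: nat and u :: "real \<Rightarrow> real" and \<phi> :: "nat \<Rightarrow> real \<Rightarrow> real" and M :: real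
  assumes X: "finite X" "2 * (card X + (3 * D + 6)) \<le> w"
  defines "Y \<equiv> \<lambda>j :: nat. X \<union> {\<lambda>x. popped_stack N j (u x)} \<union> (\<lambda>a x. back_vec N \<phi> M j a (u x)) ` {..<D}"
  shows "computes w (2 + 2 * D) (Y j) (Y (Suc j))"
proof -
  let ?s = "\<lambda>x. popped_stack N j (u x)"
  let ?v = "\<lambda>a x. back_vec N \<phi> M j a (u x)"
  have fin: "finite (Y j)" using X by (simp add: Y_def)
  have "card (?v ` {..<D}) \<le> D" using card_image_le[of "{..<D}" ?v] by simp
  then have cY: "card (Y j) \<le> card X + 1 + D"
    unfolding Y_def using card_Un_le[of "X \<union> {?s}" "?v ` {..<D}"] card_Un_le[of X "{?s}"] by simp
  define z where "z = (\<lambda>x. 2 ^ N * (?s x - 1 / 2) + 1)"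
  have s: "?s \<in> aff (Y j)" by (auto simp: Y_def intro: aff_mem)
  have z: "z \<in> aff (Y j)" unfolding z_def by (intro aff_add aff_cmult aff_diff aff_const s)
  let ?Z = "insert (\<lambda>x. max (z x) 0) (insert (\<lambda>x. max (z x - 1) 0) (Y j))"
  have 1: "computes w 2 (Y j) ?Z"
    using fin cY X(2) by (intro computes_relu2 z aff_diff aff_const) auto
  have finZ: "finite ?Z" using fin by simp
  have cZ: "card ?Z \<le> card X + 3 + D"
    using cY card_insert_le_Suc[of "\<lambda>x. max (z x) 0" "insert (\<lambda>x. max (z x - 1) 0) (Y j)"]
      card_insert_le_Suc[of "\<lambda>x. max (z x - 1) 0" "Y j"] by linarith
  have rel: "(\<lambda>x. max (z x) 0) \<in> aff ?Z" "(\<lambda>x. max (z x - 1) 0) \<in> aff ?Z" by (auto intro: aff_mem)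
  have YZ: "Y j \<subseteq> aff ?Z" by (auto intro: aff_mem)
  have digit: "(\<lambda>x. pop_digit N (?s x)) \<in> aff ?Z"
    using aff_diff[OF rel] by (simp add: pop_digit_def clamp_def z_def)
  have v: "?v b \<in> aff ?Z" if "b < D" for b using YZ that by (auto simp: Y_def)
  let ?c = "\<lambda>a x. (\<Sum>b<D. (T (N - j) 1 $$ (a, b) - T (N - j) 0 $$ (a, b)) * ?v b x)"
  let ?m = "\<lambda>x. M * pop_digit N (?s x)"
  have 2: "computes w (2 * D) ?Z (?Z \<union> (\<lambda>a x. clip (?c a x) (?m x)) ` {..<D})"
    using finZ cZ X(2) by (intro computes_clip_family aff_sum aff_cmult v digit) auto
  have 3: "computes w 0 (?Z \<union> (\<lambda>a x. clip (?c a x) (?m x)) ` {..<D}) (Y (Suc j))"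
  proof (rule computes_aff)
    let ?A = "aff (?Z \<union> (\<lambda>a x. clip (?c a x) (?m x)) ` {..<D})"
    have ZA: "?Z \<subseteq> ?A" by (auto intro: aff_mem)
    then have lift: "h \<in> ?A" if "h \<in> aff ?Z" for h using aff_trans that by blast
    have clip: "(\<lambda>x. clip (?c a x) (?m x)) \<in> ?A" if "a < D" for a using that by (auto intro: aff_mem)
    have "X \<subseteq> ?A" using ZA by (auto simp: Y_def)
    moreover have "(\<lambda>x. 2 * ?s x - pop_digit N (?s x)) \<in> ?A"
      using YZ s by (intro aff_diff aff_cmult lift digit) (auto simp: Y_def)
    moreover have "(\<lambda>x. (\<Sum>b<D. T (N - j) 0 $$ (a, b) * ?v b x) + clip (?c a x) (?m x)) \<in> ?A" if "a < D" for a
      by (intro aff_add aff_sum aff_cmult lift v clip that) auto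
    ultimately show "Y (Suc j) \<subseteq> ?A" by (auto simp: Y_def)
  qed
  from computes_trans[OF 1 computes_trans[OF 2 3]] show ?thesis by simp
qed

lemma computes_back_vec:
  assumes \<phi>: "computable_family n k D \<phi>"
    and X: "finite X" "2 * (card X + (k + 3 * D + 12)) \<le> w" and u: "u \<in> aff X"
  shows "computes w ((1 + N * 3) + n + 2 + 2 * D + N * (2 + 2 * D)) X
    (X \<union> (\<lambda>a x. back_vec N \<phi> M N a (u x)) ` {..<D})"
proof -
  let ?y = "\<lambda>x. soft_orbit N N (u x)" and ?s = "\<lambda>x. digit_stack N N (u x)" and ?d = "\<lambda>x. fold_dist N (u x)"
  let ?Y1 = "X \<union> {?y, ?s, ?d}"
  have 1: "computes w (1 + N * 3) X ?Y1" using X u by (intro computes_forward) auto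
  have fin1: "finite ?Y1" using X by simp
  have c1: "card ?Y1 \<le> card X + 3"
    using card_Un_le[of X "{?y, ?s, ?d}"] card_insert_le_Suc[of ?y "{?s, ?d}"] card_insert_le_Suc[of ?s "{?d}"] by simp
  have mem1: "?y \<in> aff ?Y1" by (auto intro: aff_mem)
  let ?Y2 = "?Y1 \<union> (\<lambda>a x. \<phi> a (?y x)) ` {..<D}"
  have 2: "computes w n ?Y1 ?Y2" using fin1 c1 X(2) by (intro computable_familyD[OF \<phi>] mem1) auto
  have fin2: "finite ?Y2" using fin1 by simp
  have c2: "card ?Y2 \<le> card X + 3 + D"
    using card_Un_le[of ?Y1 "(\<lambda>a x. \<phi> a (?y x)) ` {..<D}"] c1
      card_image_le[of "{..<D}" "\<lambda>a x. \<phi> a (?y x)"] by simp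
  define z where "z = (\<lambda>x. 16 * ?d x - 1)"
  have z: "z \<in> aff ?Y2" unfolding z_def by (intro aff_diff aff_cmult aff_const) (auto intro: aff_mem)
  let ?Y3 = "insert (\<lambda>x. max (z x) 0) (insert (\<lambda>x. max (z x - 1) 0) ?Y2)"
  have 3: "computes w 2 ?Y2 ?Y3" using fin2 c2 X(2) by (intro computes_relu2 z aff_diff aff_const) auto
  have fin3: "finite ?Y3" using fin2 by simp
  have c3: "card ?Y3 \<le> card X + 5 + D"
    using c2 card_insert_le_Suc[of "\<lambda>x. max (z x) 0" "insert (\<lambda>x. max (z x - 1) 0) ?Y2"]
      card_insert_le_Suc[of "\<lambda>x. max (z x - 1) 0" ?Y2] by linarith
  have rel: "(\<lambda>x. max (z x) 0) \<in> aff ?Y3" "(\<lambda>x. max (z x - 1) 0) \<in> aff ?Y3" by (auto intro: aff_mem)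
  have cl: "(\<lambda>x. clamp (16 * ?d x - 1)) \<in> aff ?Y3"
    using aff_diff[OF rel] by (simp add: clamp_def z_def)
  have mem3: "(\<lambda>x. \<phi> a (?y x)) \<in> aff ?Y3" if "a < D" for a using that by (auto intro!: aff_mem)
  let ?c = "\<lambda>a x. clip (\<phi> a (?y x)) (M * clamp (16 * ?d x - 1))"
  have 4: "computes w (2 * D) ?Y3 (?Y3 \<union> ?c ` {..<D})"
    using fin3 c3 X(2) by (intro computes_clip_family mem3 aff_cmult cl) auto
  define Y where "Y j = X \<union> {\<lambda>x. popped_stack N j (u x)} \<union> (\<lambda>a x. back_vec N \<phi> M j a (u x)) ` {..<D}" for j
  have 5: "computes w 0 (?Y3 \<union> ?c ` {..<D}) (Y 0)"
    by (rule computes_aff) (auto simp: Y_def intro: aff_mem)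
  have step: "computes w (2 + 2 * D) (Y j) (Y (Suc j))" for j
    unfolding Y_def using X by (intro computes_back_step) auto
  have 6: "computes w (j * (2 + 2 * D)) (Y 0) (Y j)" for j
  proof (induction j)
    case 0
    show ?case by (simp, rule computes_aff) (auto intro: aff_mem)
  next
    case (Suc j)
    from computes_trans[OF Suc step] show ?case by (simp add: algebra_simps)
  qed
  have 7: "computes w 0 (Y N) (X \<union> (\<lambda>a x. back_vec N \<phi> M N a (u x)) ` {..<D})"
    by (rule computes_aff) (auto simp: Y_def intro: aff_mem)
  from computes_trans[OF 1 computes_trans[OF 2 computes_trans[OF 3 computes_trans[OF 4
      computes_trans[OF 5 computes_trans[OF 6 7]]]]]]
  show ?thesis by (simp add: algebra_simps)
qed

end

section \<open>Piecewise linear generators\<close>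

text \<open>Induction on the number of breakpoints: subtracting max (x - b) 0, weighted by the jump
  of the slope, removes the largest breakpoint \<open>b\<close>.\<close>

lemma piecewise_affine_imp_pwl:
  fixes f :: "real \<Rightarrow> real"
  assumes "finite B" "continuous_on UNIV f"
    and "\<And>I. is_interval I \<Longrightarrow> I \<inter> B = {} \<Longrightarrow> \<exists>u v. \<forall>x\<in>I. f x = u + x * v"
  shows "f \<in> pwl"
  using assms
proof (induction "card B" arbitrary: B f)
  case 0
  then have "B = {}" by simp
  with 0(4)[of UNIV] obtain u v where "\<forall>x. f x = u + x * v" by (auto simp: is_interval_univ)
  then have "f = (\<lambda>x. u + v * x)" by (auto simp: mult.commute)
  then show ?case by (simp only:) (intro pwl_add pwl_cmult pwl_const pwl_id)
next
  case (Suc n)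
  have ne: "B \<noteq> {}" using Suc(2) by auto
  define b where "b = Max B"
  have b: "b \<in> B" and bmax: "\<And>x. x \<in> B \<Longrightarrow> x \<le> b" using ne Suc.prems(1) by (auto simp: b_def)
  \<comment> \<open>The interval from \<open>l\<close> to \<open>b\<close> avoids all breakpoints,
    so \<open>f\<close> has a single affine form there; b - 1 is an arbitrary choice when
    \<open>b\<close> is the only breakpoint.\<close>
  obtain l where l: "l < b" "\<And>x. x \<in> B - {b} \<Longrightarrow> x \<le> l"
  proof (cases "B - {b} = {}")
    case True
    then show ?thesis using that[of "b - 1"] by auto
  next
    case False
    have "finite (B - {b})" using Suc.prems(1) by simp
    then have m: "Max (B - {b}) \<in> B - {b}" "\<And>x. x \<in> B - {b} \<Longrightarrow> x \<le> Max (B - {b})"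
      using Max_in[OF _ False] Max_ge by auto
    then have "Max (B - {b}) < b" using bmax[of "Max (B - {b})"] by auto
    then show ?thesis using that m(2) by blast
  qed
  have "{l<..<b} \<inter> B = {}" using l(2) by force
  then obtain u0 v0 where left: "\<And>x. l < x \<Longrightarrow> x < b \<Longrightarrow> f x = u0 + x * v0"
    using Suc.prems(3)[of "{l<..<b}"] by (auto simp: is_interval_1)
  have "{b<..} \<inter> B = {}" using bmax by force
  then obtain u1 v1 where right: "\<And>x. b < x \<Longrightarrow> f x = u1 + x * v1"
    using Suc.prems(3)[of "{b<..}"] by (auto simp: is_interval_1)
  have cont: "isCont f b" using Suc.prems(2) by (simp add: continuous_on_eq_continuous_at)
  have fb0: "f b = u0 + b * v0"
  proof (rule tendsto_unique[of "at_left b"])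
    show "(f \<longlongrightarrow> f b) (at_left b)" using cont by (simp add: isCont_def filterlim_at_split)
    have "((\<lambda>x. u0 + x * v0) \<longlongrightarrow> u0 + b * v0) (at_left b)" by (intro tendsto_intros)
    moreover have "\<forall>\<^sub>F x in at_left b. u0 + x * v0 = f x"
      using eventually_at_left_real[OF l(1)] by eventually_elim (use left in auto)
    ultimately show "(f \<longlongrightarrow> u0 + b * v0) (at_left b)" by (rule Lim_transform_eventually)
  qed simp
  have fb1: "f b = u1 + b * v1"
  proof (rule tendsto_unique[of "at_right b"])
    show "(f \<longlongrightarrow> f b) (at_right b)" using cont by (simp add: isCont_def filterlim_at_split)
    have "((\<lambda>x. u1 + x * v1) \<longlongrightarrow> u1 + b * v1) (at_right b)" by (intro tendsto_intros)
    moreover have "\<forall>\<^sub>F x in at_right b. u1 + x * v1 = f x"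
      using eventually_at_right_less[of b] by eventually_elim (use right in auto)
    ultimately show "(f \<longlongrightarrow> u1 + b * v1) (at_right b)" by (rule Lim_transform_eventually)
  qed simp
  define h where "h x = f x - (v1 - v0) * max (x - b) 0" for x
  have h_le: "h x = f x" if "x \<le> b" for x using that by (simp add: h_def max_def)
  have h_right: "h x = u0 + x * v0" if "l < x" for x
  proof (cases "x < b")
    case True
    then show ?thesis using left that h_le by simp
  next
    case False
    have "f x = u1 + x * v1" using right[of x] fb1 False by (cases "x = b") auto
    then show ?thesis using False fb0 fb1 by (simp add: h_def max_def algebra_simps)
  qed
  have "h \<in> pwl"
  proof (rule Suc.hyps(1)[of "B - {b}"])
    show "n = card (B - {b})" using Suc.hyps(2) Suc.prems(1) b by simp
    show "finite (B - {b})" using Suc.prems(1) by simp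
    show "continuous_on UNIV h" unfolding h_def using Suc.prems(2) by (intro continuous_intros)
    fix I :: "real set" assume I: "is_interval I" "I \<inter> (B - {b}) = {}"
    show "\<exists>u v. \<forall>x\<in>I. h x = u + x * v"
    proof (cases "b \<in> I")
      case False
      then have "I \<inter> B = {}" using I(2) by auto
      then obtain u v where uv: "\<forall>x\<in>I. f x = u + x * v" using Suc.prems(3)[OF I(1)] by blast
      have "(\<forall>x\<in>I. x < b) \<or> (\<forall>x\<in>I. b < x)"
        using I(1) False unfolding is_interval_1 by (metis linorder_neqE_linordered_idom less_imp_le)
      then show ?thesis
      proof
        assume "\<forall>x\<in>I. x < b"
        then show ?thesis using uv h_le by (metis less_imp_le)
      next
        assume "\<forall>x\<in>I. b < x"
        then have "\<forall>x\<in>I. h x = (u + (v1 - v0) * b) + x * (v - (v1 - v0))"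
          using uv by (auto simp: h_def max_def algebra_simps)
        then show ?thesis by blast
      qed
    next
      case True
      show ?thesis
      proof (cases "\<forall>x\<in>I. l < x")
        case True
        then show ?thesis using h_right by blast
      next
        case False
        then obtain x where x: "x \<in> I" "x \<le> l" by (auto simp: not_less)
        have below: "\<exists>u v. \<forall>y\<in>I. y < b \<longrightarrow> f y = u + y * v"
        proof -
          have "is_interval {..<b}" by (auto simp: is_interval_1)
          then have "is_interval (I \<inter> {..<b})" using I(1) by (intro is_interval_Int)
          moreover have "(I \<inter> {..<b}) \<inter> B = {}" using I(2) by auto
          ultimately show ?thesis using Suc.prems(3)[of "I \<inter> {..<b}"] by auto
        qed
        then obtain u2 v2 where uv2: "\<And>y. y \<in> I \<Longrightarrow> y < b \<Longrightarrow> f y = u2 + y * v2" by blast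
        \<comment> \<open>Two points of \<open>I\<close> between \<open>l\<close> and
          \<open>b\<close> identify the affine form of \<open>f\<close> on the part of
          \<open>I\<close> below \<open>b\<close> with the one found between \<open>l\<close> and
          \<open>b\<close>.\<close>
        define m1 where "m1 = (max l x + b) / 2"
        define m2 where "m2 = (m1 + b) / 2"
        have m: "l < m1" "m1 < m2" "m2 < b" "x < m1" using x l(1) by (auto simp: m1_def m2_def max_def)
        have "y \<in> I" if "x \<le> y" "y \<le> b" for y
          using I(1) x(1) \<open>b \<in> I\<close> that unfolding is_interval_1 by blast
        then have "m1 \<in> I" "m2 \<in> I" using m by auto
        then have e: "u2 + m1 * v2 = u0 + m1 * v0" "u2 + m2 * v2 = u0 + m2 * v0"
          using uv2 left m by (metis less_trans)+
        then have "(m2 - m1) * v2 = (m2 - m1) * v0" by (simp add: algebra_simps)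
        then have "v2 = v0" "u2 = u0" using m e by auto
        then have "h y = u0 + y * v0" if "y \<in> I" for y
          using that uv2 h_le h_right[of y] l(1) by (cases "y < b") auto
        then show ?thesis by blast
      qed
    qed
  qed
  then have "(\<lambda>x. h x + (v1 - v0) * max (x + (- b)) 0) \<in> pwl" by (intro pwl.intros)
  then show ?case by (simp add: h_def)
qed

lemma cpwl_component_pwl:
  assumes "cpwl p g" "c < p"
  shows "(\<lambda>x. g x $ c) \<in> pwl"
proof -
  obtain B where B: "finite B" "\<forall>I. is_interval I \<and> I \<inter> B = {} \<longrightarrow>
      (\<exists>u\<in>carrier_vec p. \<exists>v\<in>carrier_vec p. \<forall>x\<in>I. g x = u + x \<cdot>\<^sub>v v)"
    using assms(1) unfolding cpwl_def by (elim conjE exE)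
  show ?thesis
  proof (rule piecewise_affine_imp_pwl[OF B(1)])
    show "continuous_on UNIV (\<lambda>x. g x $ c)" using assms by (auto simp: cpwl_def continuous_vec_def)
    fix I :: "real set" assume "is_interval I" "I \<inter> B = {}"
    then obtain u v where "u \<in> carrier_vec p" "v \<in> carrier_vec p" "\<forall>x\<in>I. g x = u + x \<cdot>\<^sub>v v" using B(2) by blast
    then have "\<forall>x\<in>I. g x $ c = u $ c + x * v $ c" using assms(2) by auto
    then show "\<exists>u v. \<forall>x\<in>I. g x $ c = u + x * v" by blast
  qed
qed

lemma pwl_clamp: "f \<in> pwl \<Longrightarrow> (\<lambda>x. clamp (f x)) \<in> pwl"
  unfolding clamp_def by (intro pwl_diff pwl_relu pwl_const)

lemma pwl_clip: "f \<in> pwl \<Longrightarrow> m \<in> pwl \<Longrightarrow> (\<lambda>x. clip (f x) (m x)) \<in> pwl"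
  unfolding clip_def by (intro pwl_add pwl_diff pwl_relu pwl_uminus)

lemma clamp_unit_interval: "clamp t \<in> {0..1}"
  and clamp_id: "t \<in> {0..1} \<Longrightarrow> clamp t = t"
  by (auto simp: clamp_def max_def)

section \<open>Cells and distances to the integers\<close>

definition int_dist :: "real \<Rightarrow> real" where
  "int_dist x = min (frac x) (1 - frac x)"

lemma int_dist_cell:
  assumes "t \<in> {0..1}"
  shows "int_dist (t + real_of_int m) = min t (1 - t)"
proof (cases "t = 1")
  case True
  then have "frac (t + real_of_int m) = 0" by (simp add: frac_def)
  then show ?thesis using True by (simp add: int_dist_def)
next
  case False
  then have "frac (t + real_of_int m) = t" using assms by (subst frac_unique_iff) auto
  then show ?thesis by (simp add: int_dist_def)
qed

lemma int_dist_half_shift: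
  assumes "t \<in> {0..1}"
  shows "int_dist (t + real_of_int m + 1 / 2) = 1 / 2 - min t (1 - t)"
proof (cases "t \<le> 1 / 2")
  case True
  have eq: "t + real_of_int m + 1 / 2 = (t + 1 / 2) + real_of_int m" by simp
  show ?thesis unfolding eq using True assms by (subst int_dist_cell) (auto simp: min_def)
next
  case False
  have eq: "t + real_of_int m + 1 / 2 = (t - 1 / 2) + real_of_int (m + 1)" by simp
  show ?thesis unfolding eq using False assms by (subst int_dist_cell) (auto simp: min_def)
qed

lemma computes_sequence:
  assumes step: "\<And>i X. i < m \<Longrightarrow> finite X \<Longrightarrow> (\<lambda>x. x) \<in> aff X \<Longrightarrow> 2 * (card X + k) \<le> w \<Longrightarrow>
      computes w c X (X \<union> Out i)"
    and out: "\<And>i. i < m \<Longrightarrow> finite (Out i) \<and> card (Out i) \<le> d"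
    and X: "finite X" "(\<lambda>x. x) \<in> aff X" "2 * (card X + (m * d + k)) \<le> w"
  shows "computes w (m * c) X (X \<union> (\<Union>i<m. Out i))"
  using assms
proof (induction m)
  case 0
  show ?case by (simp, rule computes_aff) (auto intro: aff_mem)
next
  case (Suc m)
  let ?Y = "X \<union> (\<Union>i<m. Out i)"
  have out: "finite (Out i)" "card (Out i) \<le> d" if "i < m" for i using Suc.prems(2)[of i] that by auto
  have 1: "computes w (m * c) X ?Y"
  proof (rule Suc.IH)
    show "computes w c X (X \<union> Out i)" if "i < m" "finite X" "(\<lambda>x. x) \<in> aff X" "2 * (card X + k) \<le> w" for i X
      using Suc.prems(1)[of i X] that by simp
  qed (use Suc.prems out in auto)
  have "card (\<Union>i<m. Out i) \<le> (\<Sum>i<m. card (Out i))" by (rule card_UN_le) simp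
  also have "\<dots> \<le> m * d" using out sum_bounded_above[of "{..<m}" "\<lambda>i. card (Out i)" d] by simp
  finally have "card ?Y \<le> card X + m * d" using card_Un_le[of X "\<Union>i<m. Out i"] by linarith
  then have "card ?Y + k \<le> card X + (Suc m * d + k)" by simp
  then have cY: "2 * (card ?Y + k) \<le> w" by (rule order_trans[OF mult_le_mono2 Suc.prems(5)])
  have "X \<subseteq> aff ?Y" by (auto intro: aff_mem)
  then have "(\<lambda>x. x) \<in> aff ?Y" using Suc.prems(4) aff_trans by blast
  then have 2: "computes w c ?Y (?Y \<union> Out m)"
    using Suc.prems(3) out cY by (intro Suc.prems(1)) auto
  have "?Y \<union> Out m = X \<union> (\<Union>i<Suc m. Out i)" by (auto simp: less_Suc_eq)
  with computes_trans[OF 1 2] show ?case by (simp add: add.commute)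
qed

context cascade_window
begin

lemma cascade_from_add:
  assumes f: "\<And>x. f x \<in> carrier_vec p" and h: "\<And>x. h x \<in> carrier_vec p" and a: "a \<ge> 1"
  shows "cascade_from a m (\<lambda>x. f x + h x) = (\<lambda>x. cascade_from a m f x + cascade_from a m h x)"
  using f h
proof (induction m arbitrary: f h)
  case (Suc m)
  have "V (a + m) (\<lambda>x. f x + h x) = (\<lambda>x. V (a + m) f x + V (a + m) h x)"
  proof (intro ext eq_vecI)
    fix x c assume "c < dim_vec (V (a + m) f x + V (a + m) h x)"
    then have c: "c < p" by (simp add: cascade_op_def)
    have "(A (a + m) j *\<^sub>v (f y + h y)) $ c = (A (a + m) j *\<^sub>v f y) $ c + (A (a + m) j *\<^sub>v h y) $ c"
      if j: "j \<in> J" for j y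
    proof -
      have "A (a + m) j \<in> carrier_mat p p" using A_carrier j a by simp
      then show ?thesis using mult_add_distrib_mat_vec[of "A (a + m) j" p p "f y" "h y"] Suc.prems c by simp
    qed
    then show "V (a + m) (\<lambda>x. f x + h x) x $ c = (V (a + m) f x + V (a + m) h x) $ c"
      using c by (simp add: cascade_op_def sum.distrib)
  qed (simp add: cascade_op_def)
  then show ?case
    unfolding cascade_from_Suc' using Suc.IH[of "V (a + m) f" "V (a + m) h"] V_carrier by simp
qed simp

text \<open>Each operator halves a translation of its argument function, because it dilates the
  variable by 2.\<close>

lemma cascade_from_shift:
  "cascade_from a m (\<lambda>x. f (x - s)) = (\<lambda>x. cascade_from a m f (x - s / 2 ^ m))"
proof (induction m arbitrary: f s)
  case (Suc m)
  have eq: "2 * x - real_of_int j - s = 2 * (x - s / 2) - real_of_int j" for x j by simp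
  have "V (a + m) (\<lambda>x. f (x - s)) = (\<lambda>x. V (a + m) f (x - s / 2))"
    by (intro ext) (simp only: cascade_op_def eq)
  then show ?case unfolding cascade_from_Suc' using Suc.IH[of "V (a + m) f" "s / 2"] by simp
qed simp

text \<open>Integers inside the window have local coordinate 0, which \<open>doubling\<close> fixes;
  there the iterate is a product of matrices applied to the zero vector
  \<open>G f 0\<close>.\<close>

lemma cascade_from_integer:
  assumes f: "windowed p lm lp f" and G0: "G f 0 = 0\<^sub>v D" and a: "a \<ge> 1"
  shows "cascade_from a m f (real_of_int i) = 0\<^sub>v p"
proof (cases "lm \<le> i \<and> i < lp")
  case True
  let ?h = "cascade_from a m f"
  have h: "windowed p lm lp ?h" by (rule windowed_cascade_from[OF f a])
  have "doubling 0 = 0" by (simp add: doubling_def binary_digit_def)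
  then have "(doubling ^^ m) 0 = 0" by (induction m) auto
  then have "G ?h 0 = 0\<^sub>v D"
    using stack_cascade_from[OF f a, of 0 m] G0 a
      mult_mat_vec_zero[OF chrono_prod_carrier[OF binary_family_T _ set_binary_digits]] by simp
  moreover have "?h (real_of_int i) $ c = G ?h 0 $ (nat (i - lm) * p + c)"
    and "nat (i - lm) * p + c < D" if c: "c < p" for c
  proof -
    have i: "nat \<lfloor>real_of_int i - real_of_int lm\<rfloor> = nat (i - lm)" by (metis floor_of_int of_int_diff)
    have z: "real_of_int i - real_of_int lm - real (nat (i - lm)) = 0" using True by simp
    show "?h (real_of_int i) $ c = G ?h 0 $ (nat (i - lm) * p + c)" "nat (i - lm) * p + c < D"
      using windowed_eq_stack(4)[OF lm_less_lp, where x = "real_of_int i" and c = c and p = p and f = ?h]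
        windowed_eq_stack(3)[OF lm_less_lp, where x = "real_of_int i" and c = c and p = p] True c
      unfolding i z by auto
  qed
  ultimately show ?thesis using windowed_carrier[OF h, of "real_of_int i"] by (intro eq_vecI) auto
next
  case False
  then show ?thesis by (intro windowed_zero[OF windowed_cascade_from[OF f a]]) auto
qed

text \<open>Which cell contains \<open>x\<close> is not a continuous function of \<open>x\<close>,
  so all cells are evaluated. In a wrong cell the clamped coordinate is 0 or 1, an integer point
  where \<open>h\<close> vanishes, and the sum keeps the right cell only.\<close>

lemma windowed_eq_cell_sum:
  assumes h: "windowed p lm lp h" and int: "\<And>i. h (real_of_int i) = 0\<^sub>v p" and c: "c < p"
  shows "h x $ c = (\<Sum>i<nat (lp - lm). G h (clamp (x - real_of_int lm - real i)) $ (i * p + c))"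
proof -
  have term_eq: "G h (clamp (x - real_of_int lm - real i)) $ (i * p + c) =
      (if 0 < x - real_of_int lm - real i \<and> x - real_of_int lm - real i < 1 then h x $ c else 0)"
    if i: "i < nat (lp - lm)" for i
  proof -
    let ?y = "x - real_of_int lm - real i"
    have "i * p + c < (i + 1) * p" using c by simp
    also have "\<dots> \<le> nat (lp - lm) * p" using i by (intro mult_le_mono1) simp
    finally have "i * p + c < D" by (simp add: mult.commute)
    then have G: "G h (clamp ?y) $ (i * p + c) = h (clamp ?y + real_of_int lm + real i) $ c"
      using c by (simp add: stack_def)
    consider "?y \<le> 0" | "0 < ?y" "?y < 1" | "1 \<le> ?y" by linarith
    then show ?thesis
    proof cases
      case 1
      then show ?thesis using G int[of "lm + int i"] c by (simp add: clamp_eq_0)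
    next
      case 2
      then have "clamp ?y = ?y" by (intro clamp_id) auto
      then have "clamp ?y + real_of_int lm + real i = x" by simp
      then show ?thesis using G 2 by simp
    next
      case 3
      then show ?thesis using G int[of "lm + int i + 1"] c by (simp add: clamp_eq_1 add_ac)
    qed
  qed
  show ?thesis
  proof (cases "real_of_int lm \<le> x \<and> x < real_of_int lp")
    case True
    define i0 where "i0 = nat \<lfloor>x - real_of_int lm\<rfloor>"
    note i0 = windowed_eq_stack(1,2)[OF lm_less_lp conjunct1[OF True] conjunct2[OF True] c, folded i0_def]
    have "(\<Sum>i<nat (lp - lm). G h (clamp (x - real_of_int lm - real i)) $ (i * p + c)) =
        (\<Sum>i<nat (lp - lm). if i = i0 then h x $ c else 0)"
    proof (rule sum.cong[OF refl])
      fix i assume "i \<in> {..<nat (lp - lm)}"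
      then have i: "i < nat (lp - lm)" by simp
      show "G h (clamp (x - real_of_int lm - real i)) $ (i * p + c) = (if i = i0 then h x $ c else 0)"
      proof (cases "i = i0")
        case True
        show ?thesis
        proof (cases "x = real_of_int (lm + int i0)")
          case True
          then have "h x = 0\<^sub>v p" using int by blast
          then show ?thesis using term_eq[OF i] c by simp
        next
          case False
          then have "0 < x - real_of_int lm - real i0" using i0(1) by force
          then show ?thesis using term_eq[OF i] True i0(1) by simp
        qed
      next
        case False
        then have "real i \<le> real i0 - 1 \<or> real i \<ge> real i0 + 1" by linarith
        then show ?thesis using term_eq[OF i] False i0(1) by auto
      qed
    qed
    then show ?thesis using i0(2) by simp
  next
    case False
    then have "h x = 0\<^sub>v p" by (intro windowed_zero[OF h]) auto
    then show ?thesis using term_eq c by (simp add: sum.neutral)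
  qed
qed

text \<open>The translation \<open>s\<close> enters only through the affine input of each cell, so
  the counts are uniform in it.\<close>

lemma piece_computable:
  assumes B: "\<forall>k\<ge>1. \<forall>j\<in>J. mat_norm2 (A k j) \<le> B"
    and f: "windowed p lm lp f"
    and near: "\<And>t. t \<in> {0..1} \<Longrightarrow> min t (1 - t) \<le> 1 / 8 \<Longrightarrow> G f t = 0\<^sub>v D"
    and pwl: "\<And>a. a < D \<Longrightarrow> \<phi> a \<in> pwl"
    and \<phi>: "\<And>a t. a < D \<Longrightarrow> t \<in> {0..1} \<Longrightarrow> \<phi> a t = G f t $ a"
    and Mf: "\<And>t. vec_norm2 (G f t) \<le> Mf"
  shows "\<exists>c k. \<forall>N s X w. finite X \<longrightarrow> (\<lambda>x. x) \<in> aff X \<longrightarrow> 2 * (card X + k) \<le> w \<longrightarrow>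
    (\<exists>m\<le>c * (N + 1). computes w m X (X \<union> (\<lambda>i x. cascade_from 1 N f (x - s) $ i) ` {..<p}))"
proof -
  obtain n k where nk: "computable_family n k D \<phi>" using pwl_family_computable[of D \<phi>] pwl by blast
  obtain \<tau> where \<tau>: "\<tau> \<ge> 1" "\<And>k e. k \<ge> 1 \<Longrightarrow> mat_norm2 (T k e) \<le> \<tau>" using T_norm_bounded[OF B] by metis
  let ?L = "nat (lp - lm)"
  have Mf0: "0 \<le> Mf" using order_trans[OF vec_norm2_nonneg Mf] .
  have bound: "vec_norm2 (G (cascade_from a m f) t) \<le> \<tau> ^ m * Mf" if a: "a \<ge> 1" and t: "t \<in> {0..1}" for a m t
  proof -
    have P: "chrono_prod D T a (binary_digits m t) \<in> carrier_mat D D"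
      by (rule chrono_prod_carrier[OF binary_family_T a set_binary_digits])
    have "vec_norm2 (G (cascade_from a m f) t) \<le>
        mat_norm2 (chrono_prod D T a (binary_digits m t)) * vec_norm2 (G f ((doubling ^^ m) t))"
      unfolding stack_cascade_from[OF f a t] by (rule vec_norm2_mult_mat_vec_le[OF P stack_carrier])
    also have "\<dots> \<le> \<tau> ^ m * Mf"
      using chrono_prod_norm_le_power[OF binary_family_T _ a set_binary_digits, of \<tau> m t] \<tau> Mf
      by (intro mult_mono) auto
    finally show ?thesis .
  qed
  \<comment> \<open>Bounds a difference of two vectors, each a product of at most N + 1 transition
    matrices applied to a vector of norm at most \<open>Mf\<close>. Its exponential growth affects
    the values of the weights, not their number.\<close>
  define M where "M N = 2 * \<tau> ^ (N + 1) * Mf" for N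
  have M1: "\<bar>G f t $ a\<bar> \<le> M N" if "a < D" for t a N
  proof -
    have "\<bar>G f t $ a\<bar> \<le> 1 * Mf"
      using abs_vec_index_le_norm2[of a "G f t"] that Mf[of t] by (simp add: stack_def)
    also have "\<dots> \<le> (2 * \<tau> ^ (N + 1)) * Mf"
      using one_le_power[OF \<tau>(1), of "N + 1"] Mf0 by (intro mult_right_mono) linarith+
    finally show ?thesis by (simp add: M_def)
  qed
  have M2: "\<bar>(T k 1 *\<^sub>v G (cascade_from (Suc k) j f) t) $ a - (T k 0 *\<^sub>v G (cascade_from (Suc k) j f) t) $ a\<bar> \<le> M N"
    if a: "a < D" and k: "1 \<le> k" and j: "j < N" and t: "t \<in> {0..1}" for a k j t N
  proof -
    let ?v = "G (cascade_from (Suc k) j f) t"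
    have e: "\<bar>(T k e *\<^sub>v ?v) $ a\<bar> \<le> \<tau> ^ (N + 1) * Mf" for e
    proof -
      have "\<bar>(T k e *\<^sub>v ?v) $ a\<bar> \<le> vec_norm2 (T k e *\<^sub>v ?v)"
        using a by (intro abs_vec_index_le_norm2) (simp add: transition_def)
      also have "\<dots> \<le> mat_norm2 (T k e) * vec_norm2 ?v"
        by (rule vec_norm2_mult_mat_vec_le[OF transition_carrier stack_carrier])
      also have "\<dots> \<le> \<tau> * (\<tau> ^ j * Mf)" using \<tau> k bound[OF _ t] Mf0 by (intro mult_mono) auto
      also have "\<dots> = \<tau> ^ Suc j * Mf" by simp
      also have "\<dots> \<le> \<tau> ^ (N + 1) * Mf" using \<tau>(1) j Mf0 by (intro mult_right_mono power_increasing) auto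
      finally show ?thesis .
    qed
    show ?thesis using e[of 0] e[of 1] unfolding M_def by linarith
  qed
  define c where "c = ?L * (7 + n + 4 * D)"
  \<comment> \<open>\<open>?L * D\<close> registers hold the outputs of all cells; 14 is the 12 of
    \<open>computes_back_vec\<close> plus two for clamping the argument.\<close>
  define k' where "k' = ?L * D + (k + 3 * D + 14)"
  have "\<exists>m\<le>c * (N + 1). computes w m X (X \<union> (\<lambda>i x. cascade_from 1 N f (x - s) $ i) ` {..<p})"
    if X: "finite X" "(\<lambda>x. x) \<in> aff X" "2 * (card X + k') \<le> w" for N s X w
  proof -
    define u where "u i x = clamp (x - s - real_of_int lm - real i)" for i x
    define Out where "Out i = (\<lambda>a x. back_vec N \<phi> (M N) N a (u i x)) ` {..<D}" for i
    define C where "C = 2 + ((1 + N * 3) + n + 2 + 2 * D + N * (2 + 2 * D))"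
    have "computes w (?L * C) X (X \<union> (\<Union>i<?L. Out i))"
    proof (rule computes_sequence)
      fix i X assume X': "finite X" "(\<lambda>x. x) \<in> aff X" "2 * (card X + (k + 3 * D + 14)) \<le> w"
      define z where "z = (\<lambda>x. x - s - real_of_int lm - real i)"
      have z: "z \<in> aff X" unfolding z_def by (intro aff_diff aff_const X')
      let ?Z = "insert (\<lambda>x. max (z x) 0) (insert (\<lambda>x. max (z x - 1) 0) X)"
      have 1: "computes w 2 X ?Z" using X' by (intro computes_relu2 z aff_diff aff_const) auto
      have "(\<lambda>x. max (z x) 0) \<in> aff ?Z" "(\<lambda>x. max (z x - 1) 0) \<in> aff ?Z" by (auto intro: aff_mem)
      from aff_diff[OF this] have u: "u i \<in> aff ?Z" by (simp add: u_def[abs_def] clamp_def z_def)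
      have "card ?Z \<le> card X + 2"
        using card_insert_le_Suc[of "\<lambda>x. max (z x) 0" "insert (\<lambda>x. max (z x - 1) 0) X"]
          card_insert_le_Suc[of "\<lambda>x. max (z x - 1) 0" X] by linarith
      then have 2: "computes w ((1 + N * 3) + n + 2 + 2 * D + N * (2 + 2 * D)) ?Z (?Z \<union> Out i)"
        unfolding Out_def using X' by (intro computes_back_vec[OF nk] u) auto
      have 3: "computes w 0 (?Z \<union> Out i) (X \<union> Out i)" by (rule computes_aff) (auto intro: aff_mem)
      from computes_trans[OF 1 computes_trans[OF 2 3]] show "computes w C X (X \<union> Out i)"
        by (simp add: C_def)
    next
      show "finite (Out i) \<and> card (Out i) \<le> D" for i
        using card_image_le[of "{..<D}" "\<lambda>a x. back_vec N \<phi> (M N) N a (u i x)"] by (simp add: Out_def)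
      show "2 * (card X + (?L * D + (k + 3 * D + 14))) \<le> w" using X(3) by (simp add: k'_def)
    qed (rule X)+
    moreover have "computes w 0 (X \<union> (\<Union>i<?L. Out i)) (X \<union> (\<lambda>i x. cascade_from 1 N f (x - s) $ i) ` {..<p})"
    proof (rule computes_aff, safe)
      let ?A = "aff (X \<union> (\<Union>i<?L. Out i))"
      show "h \<in> ?A" if "h \<in> X" for h using that by (auto intro: aff_mem)
      fix cc assume cc: "cc < p"
      let ?h = "cascade_from 1 N f"
      have wh: "windowed p lm lp ?h" by (rule windowed_cascade_from[OF f]) simp
      have int: "?h (real_of_int i) = 0\<^sub>v p" for i
        by (rule cascade_from_integer[OF f near]) auto
      have "?h (x - s) $ cc = (\<Sum>i<?L. back_vec N \<phi> (M N) N (i * p + cc) (u i x))" for x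
      proof -
        have "?h (x - s) $ cc = (\<Sum>i<?L. G ?h (u i x) $ (i * p + cc))"
          using windowed_eq_cell_sum[OF wh int cc, of "x - s"] by (simp add: u_def)
        also have "\<dots> = (\<Sum>i<?L. back_vec N \<phi> (M N) N (i * p + cc) (u i x))"
        proof (rule sum.cong[OF refl])
          fix i assume i: "i \<in> {..<?L}"
          have "i * p + cc < (i + 1) * p" using cc by simp
          also have "\<dots> \<le> ?L * p" using i by (intro mult_le_mono1) simp
          finally have "i * p + cc < D" by (simp add: mult.commute)
          moreover have "u i x \<in> {0..1}" unfolding u_def by (rule clamp_unit_interval)
          ultimately have "back_vec N \<phi> (M N) N (i * p + cc) (u i x) =
              G (cascade_from (Suc (N - N)) N f) ((doubling ^^ (N - N)) (u i x)) $ (i * p + cc)"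
            using f near \<phi> M1 M2 by (intro back_vec_exact) auto
          then show "G ?h (u i x) $ (i * p + cc) = back_vec N \<phi> (M N) N (i * p + cc) (u i x)" by simp
        qed
        finally show ?thesis .
      qed
      moreover have "(\<lambda>x. \<Sum>i<?L. back_vec N \<phi> (M N) N (i * p + cc) (u i x)) \<in> ?A"
      proof (rule aff_sum, rule aff_mem)
        fix i assume i: "i \<in> {..<?L}"
        have "i * p + cc < (i + 1) * p" using cc by simp
        also have "\<dots> \<le> ?L * p" using i by (intro mult_le_mono1) simp
        finally have "i * p + cc < D" by (simp add: mult.commute)
        then have "(\<lambda>x. back_vec N \<phi> (M N) N (i * p + cc) (u i x)) \<in> Out i" unfolding Out_def by auto
        then show "(\<lambda>x. back_vec N \<phi> (M N) N (i * p + cc) (u i x)) \<in> X \<union> (\<Union>i<?L. Out i)" using i by blast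
      qed
      ultimately show "(\<lambda>x. ?h (x - s) $ cc) \<in> ?A" by simp
    qed
    ultimately have *: "computes w (?L * C + 0) X (X \<union> (\<lambda>i x. cascade_from 1 N f (x - s) $ i) ` {..<p})"
      by (rule computes_trans)
    have CN: "?L * C \<le> c * (N + 1)"
    proof -
      have "C \<le> (7 + n + 4 * D) * (N + 1)" by (simp add: C_def algebra_simps)
      then show ?thesis unfolding c_def mult.assoc by (rule mult_le_mono2)
    qed
    show ?thesis using * CN by auto
  qed
  then show ?thesis by blast
qed

end

lemma relu_realizable_mono:
  "relu_realizable p w m f \<Longrightarrow> m \<le> m' \<Longrightarrow> relu_realizable p w m' f"
  unfolding relu_realizable_def by (meson order_trans)

lemma abs_clip_le: "0 \<le> m \<Longrightarrow> \<bar>clip t m\<bar> \<le> \<bar>t\<bar>"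
  by (auto simp: clip_def max_def)

context cascade_window
begin

text \<open>
  The generator is cut into a piece vanishing near the integers and one vanishing near the half-integers.
  A shift by one half of the argument of \<open>g\<close> is a shift by \<open>2\<^sup>-\<^sup>n\<^sup>-\<^sup>1\<close> of the iterate, so both pieces can
  be computed by digit extraction.
\<close>
lemma cascade_realizable:
  assumes B: "\<forall>k\<ge>1. \<forall>j\<in>J. mat_norm2 (A k j) \<le> B"
    and g: "windowed p (lm + 1) lp g" and cpwl: "cpwl p g"
  shows "\<exists>W C. \<forall>n\<ge>1. relu_realizable p W (C * real n) (cascade p J A g n)"
proof -
  have "continuous_vec p g" using cpwl by (simp add: cpwl_def)
  then obtain M where M: "M \<ge> 0" "\<And>x c. c < p \<Longrightarrow> \<bar>g x $ c\<bar> \<le> M"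
    using continuous_windowed_bounded[OF g] by metis
  have gc: "g x \<in> carrier_vec p" for x by (rule windowed_carrier[OF g])
  \<comment> \<open>The level is 0 within 1/8 of the integers and \<open>M\<close> beyond 1/4. Since
    \<open>M\<close> bounds \<open>g\<close>, clipping at this level yields 0 near the integers and
    leaves \<open>g\<close> unchanged near the half-integers.\<close>
  define cut where "cut x = M * clamp (8 * int_dist x - 1)" for x
  have cut0: "0 \<le> cut x" for x using M(1) by (simp add: cut_def clamp_nonneg)
  define f1 where "f1 x = Matrix.vec p (\<lambda>c. clip (g x $ c) (cut x))" for x
  define f2 where "f2 x = Matrix.vec p (\<lambda>c. g (x + 1 / 2) $ c - clip (g (x + 1 / 2) $ c) (cut (x + 1 / 2)))" for x
  have fc: "f1 x \<in> carrier_vec p" "f2 x \<in> carrier_vec p" for x by (simp_all add: f1_def f2_def)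
  have w1: "windowed p lm lp f1"
    unfolding windowed_def
  proof (intro conjI allI impI fc)
    fix x :: real assume "x \<le> real_of_int lm \<or> real_of_int lp \<le> x"
    then have "g x = 0\<^sub>v p" by (intro windowed_zero[OF g]) auto
    then show "f1 x = 0\<^sub>v p" using cut0 by (intro eq_vecI) (auto simp: f1_def clip_0_left)
  qed
  \<comment> \<open>Moving \<open>g\<close> to the left by 1/2 may use up half a cell; this is why
    \<open>g\<close> is assumed to vanish already up to \<open>lm + 1\<close>.\<close>
  have w2: "windowed p lm lp f2"
    unfolding windowed_def
  proof (intro conjI allI impI fc)
    fix x :: real assume "x \<le> real_of_int lm \<or> real_of_int lp \<le> x"
    then have "g (x + 1 / 2) = 0\<^sub>v p" by (intro windowed_zero[OF g]) auto
    then show "f2 x = 0\<^sub>v p" using cut0 by (intro eq_vecI) (auto simp: f2_def clip_0_left)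
  qed
  define m where "m a = real_of_int (lm + int (a div p))" for a
  define \<phi>1 where "\<phi>1 a t = clip (g (t + m a) $ (a mod p)) (M * clamp (8 * (t - max (2 * t - 1) 0) - 1))" for a t
  define \<phi>2 where "\<phi>2 a t = g (t + (m a + 1 / 2)) $ (a mod p) - clip (g (t + (m a + 1 / 2)) $ (a mod p))
      (M * clamp (8 * (1 / 2 - (t - max (2 * t - 1) 0)) - 1))" for a t
  have fold: "t - max (2 * t - 1) 0 = min t (1 - t)" for t :: real by (auto simp: min_def max_def)
  have G1: "\<phi>1 a t = G f1 t $ a" if a: "a < D" and t: "t \<in> {0..1}" for a t
  proof -
    have "G f1 t $ a = f1 (t + m a) $ (a mod p)" using a by (simp add: stack_def m_def add_ac)
    also have "\<dots> = clip (g (t + m a) $ (a mod p)) (cut (t + m a))"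
      using stack_index_less(2)[OF a] by (simp add: f1_def)
    also have "cut (t + m a) = M * clamp (8 * (t - max (2 * t - 1) 0) - 1)"
      unfolding cut_def m_def int_dist_cell[OF t] fold ..
    finally show ?thesis by (simp add: \<phi>1_def)
  qed
  have G2: "\<phi>2 a t = G f2 t $ a" if a: "a < D" and t: "t \<in> {0..1}" for a t
  proof -
    have "G f2 t $ a = f2 (t + m a) $ (a mod p)" using a by (simp add: stack_def m_def add_ac)
    also have "\<dots> = g (t + m a + 1 / 2) $ (a mod p) - clip (g (t + m a + 1 / 2) $ (a mod p)) (cut (t + m a + 1 / 2))"
      using stack_index_less(2)[OF a] by (simp add: f2_def)
    also have "cut (t + m a + 1 / 2) = M * clamp (8 * (1 / 2 - (t - max (2 * t - 1) 0)) - 1)"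
      unfolding cut_def m_def int_dist_half_shift[OF t] fold ..
    finally show ?thesis by (simp add: \<phi>2_def add.assoc)
  qed
  have near1: "G f1 t = 0\<^sub>v D" if t: "t \<in> {0..1}" "min t (1 - t) \<le> 1 / 8" for t
  proof (rule eq_vecI)
    fix a assume "a < dim_vec (0\<^sub>v D :: real vec)"
    then have a: "a < D" by simp
    have "clamp (8 * (t - max (2 * t - 1) 0) - 1) = 0" unfolding fold using t(2) by (intro clamp_eq_0) auto
    then have "\<phi>1 a t = 0" by (simp add: \<phi>1_def)
    then show "G f1 t $ a = 0\<^sub>v D $ a" using G1[OF a t(1)] a by simp
  qed (simp add: stack_def)
  \<comment> \<open>Within 1/8 of the integers the argument of \<open>g\<close> is at least 3/8 away
    from them, so the level there is \<open>M\<close>, clipping does nothing, and the difference is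
    0.\<close>
  have near2: "G f2 t = 0\<^sub>v D" if t: "t \<in> {0..1}" "min t (1 - t) \<le> 1 / 8" for t
  proof (rule eq_vecI)
    fix a assume "a < dim_vec (0\<^sub>v D :: real vec)"
    then have a: "a < D" by simp
    have "clamp (8 * (1 / 2 - (t - max (2 * t - 1) 0)) - 1) = 1" unfolding fold using t(2) by (intro clamp_eq_1) auto
    then have "\<phi>2 a t = 0"
      using clip_id[OF M(2)[OF stack_index_less(2)[OF a]]] by (simp add: \<phi>2_def)
    then show "G f2 t $ a = 0\<^sub>v D $ a" using G2[OF a t(1)] a by simp
  qed (simp add: stack_def)
  have tent: "(\<lambda>t. t - max (2 * t - 1) 0) \<in> pwl" by (intro pwl_diff pwl_relu pwl_cmult pwl_id pwl_const)
  have pwl1: "\<phi>1 a \<in> pwl" if a: "a < D" for a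
    unfolding \<phi>1_def[abs_def]
    by (intro pwl_clip pwl_cmult pwl_clamp pwl_diff pwl_const
        pwl_shift[OF cpwl_component_pwl[OF cpwl stack_index_less(2)[OF a]]] tent[THEN pwl_cmult] tent)
  have pwl2: "\<phi>2 a \<in> pwl" if a: "a < D" for a
    unfolding \<phi>2_def[abs_def]
    by (intro pwl_diff pwl_clip pwl_cmult pwl_clamp pwl_const
        pwl_shift[OF cpwl_component_pwl[OF cpwl stack_index_less(2)[OF a]]] tent)
  have b1: "vec_norm2 (G f1 t) \<le> real D * M" for t
  proof (rule stack_norm_le)
    fix x c assume c: "c < p"
    show "\<bar>f1 x $ c\<bar> \<le> M" using abs_clip_le[OF cut0, of "g x $ c" x] M(2)[OF c, of x] c by (simp add: f1_def)
  qed
  have b2: "vec_norm2 (G f2 t) \<le> real D * (2 * M)" for t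
  proof (rule stack_norm_le)
    fix x c assume c: "c < p"
    have "f2 x $ c = g (x + 1 / 2) $ c - clip (g (x + 1 / 2) $ c) (cut (x + 1 / 2))" using c by (simp add: f2_def)
    then show "\<bar>f2 x $ c\<bar> \<le> 2 * M"
      using abs_clip_le[OF cut0, of "g (x + 1 / 2) $ c" "x + 1 / 2"] M(2)[OF c, of "x + 1 / 2"] by linarith
  qed
  obtain c1 k1 where P1: "\<forall>N s X w. finite X \<longrightarrow> (\<lambda>x. x) \<in> aff X \<longrightarrow> 2 * (card X + k1) \<le> w \<longrightarrow>
      (\<exists>m\<le>c1 * (N + 1). computes w m X (X \<union> (\<lambda>i x. cascade_from 1 N f1 (x - s) $ i) ` {..<p}))"
    using piece_computable[OF B w1 near1 pwl1 G1 b1] by blast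
  obtain c2 k2 where P2: "\<forall>N s X w. finite X \<longrightarrow> (\<lambda>x. x) \<in> aff X \<longrightarrow> 2 * (card X + k2) \<le> w \<longrightarrow>
      (\<exists>m\<le>c2 * (N + 1). computes w m X (X \<union> (\<lambda>i x. cascade_from 1 N f2 (x - s) $ i) ` {..<p}))"
    using piece_computable[OF B w2 near2 pwl2 G2 b2] by blast
  \<comment> \<open>The input and the \<open>p\<close> outputs of the first piece are kept while the
    second piece is computed.\<close>
  define W where "W = 2 * (1 + p + k1 + k2)"
  define C where "C = real (2 * (c1 + c2) + 1) * real ((W + p + 1) * (W + p + 1))"
  have "relu_realizable p W (C * real n) (cascade p J A g n)" if n: "n \<ge> 1" for n
  proof -
    let ?X0 = "{\<lambda>x :: real. x}"
    let ?s = "(1 / 2 :: real) / 2 ^ n"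
    let ?O1 = "(\<lambda>i x. cascade_from 1 n f1 (x - 0) $ i) ` {..<p}"
    let ?O2 = "(\<lambda>i x. cascade_from 1 n f2 (x - ?s) $ i) ` {..<p}"
    have id0: "(\<lambda>x. x) \<in> aff ?X0" by (auto intro: aff_mem)
    have "2 * (card ?X0 + k1) \<le> W" by (simp add: W_def)
    then obtain m1 where m1: "m1 \<le> c1 * (n + 1)" "computes W m1 ?X0 (?X0 \<union> ?O1)"
      using P1[rule_format, of ?X0 W n 0, OF _ id0] by auto
    have "card (?X0 \<union> ?O1) \<le> card ?X0 + card ?O1" by (rule card_Un_le)
    also have "\<dots> \<le> 1 + p"
      using card_image_le[of "{..<p}" "\<lambda>i x. cascade_from 1 n f1 (x - 0) $ i"] by simp
    finally have "2 * (card (?X0 \<union> ?O1) + k2) \<le> W" by (simp add: W_def)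
    moreover have "finite (?X0 \<union> ?O1)" "(\<lambda>x. x) \<in> aff (?X0 \<union> ?O1)" by (auto intro: aff_mem)
    ultimately obtain m2 where m2: "m2 \<le> c2 * (n + 1)" "computes W m2 (?X0 \<union> ?O1) (?X0 \<union> ?O1 \<union> ?O2)"
      using P2[rule_format, of "?X0 \<union> ?O1" W n ?s] by blast
    let ?Y = "?X0 \<union> ?O1 \<union> ?O2"
    have stage: "stage W (m1 + m2) ?Y"
      using computes_trans[OF m1(2) m2(2)] stage_initial[of W] unfolding computes_def by fastforce
    have "g = (\<lambda>x. f1 x + f2 (x - 1 / 2))"
    proof
      fix x
      show "g x = f1 x + f2 (x - 1 / 2)" using gc[of x] by (intro eq_vecI) (auto simp: f1_def f2_def)
    qed
    then have "cascade p J A g n = cascade_from 1 n (\<lambda>x. f1 x + f2 (x - 1 / 2))"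
      by (simp add: cascade_eq_from)
    also have "\<dots> = (\<lambda>x. cascade_from 1 n f1 x + cascade_from 1 n f2 (x - ?s))"
      using cascade_from_add[of f1 "\<lambda>x. f2 (x - 1 / 2)" 1 n] fc cascade_from_shift[of 1 n f2 "1 / 2"] by simp
    finally have F: "cascade p J A g n = (\<lambda>x. cascade_from 1 n f1 x + cascade_from 1 n f2 (x - ?s))" .
    have wF: "windowed p lm lp (cascade_from 1 n f1)" "windowed p lm lp (cascade_from 1 n f2)"
      by (auto intro: windowed_cascade_from w1 w2)
    have comp: "(\<lambda>x. cascade p J A g n x $ c) \<in> aff ?Y" if c: "c < p" for c
    proof -
      have "(\<lambda>x. cascade_from 1 n f1 (x - 0) $ c) \<in> aff ?Y" "(\<lambda>x. cascade_from 1 n f2 (x - ?s) $ c) \<in> aff ?Y"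
        using c by (auto intro!: aff_mem)
      note sum = aff_add[OF this]
      have "cascade p J A g n x $ c = cascade_from 1 n f1 (x - 0) $ c + cascade_from 1 n f2 (x - ?s) $ c" for x
        unfolding F using c windowed_carrier[OF wF(2), of "x - ?s"] by simp
      with sum show ?thesis by (simp only:)
    qed
    have "cascade p J A g n x \<in> carrier_vec p" for x
      unfolding F using windowed_carrier[OF wF(1)] windowed_carrier[OF wF(2)] by simp
    then have "relu_realizable p W (real (m1 + m2 + 1) * real ((W + p + 1) * (W + p + 1))) (cascade p J A g n)"
      using comp by (intro stage_realizable[OF stage])
    then show ?thesis
    proof (rule relu_realizable_mono)
      have "m1 + m2 + 1 \<le> (c1 + c2) * (n + 1) + 1" using m1(1) m2(1) by (simp add: algebra_simps)
      also have "\<dots> \<le> (c1 + c2) * (2 * n) + n" using n by (intro add_mono mult_le_mono2) auto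
      also have "\<dots> = (2 * (c1 + c2) + 1) * n" by (simp add: algebra_simps)
      finally have "real (m1 + m2 + 1) \<le> real ((2 * (c1 + c2) + 1) * n)" by (rule of_nat_mono)
      then have "real (m1 + m2 + 1) * real ((W + p + 1) * (W + p + 1)) \<le>
          real ((2 * (c1 + c2) + 1) * n) * real ((W + p + 1) * (W + p + 1))" by (rule mult_right_mono) simp
      also have "\<dots> = C * real n" by (simp only: C_def of_nat_mult mult_ac)
      finally show "real (m1 + m2 + 1) * real ((W + p + 1) * (W + p + 1)) \<le> C * real n" .
    qed
  qed
  then show ?thesis by blast
qed

end

section \<open>Parameter counts for a given accuracy\<close>

text \<open>The number n is (K / \<epsilon>) to the power 1 / (\<alpha> - 1), rounded up; as that
  power is at least 1, rounding at most doubles it.\<close>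

lemma polynomial_step_count:
  fixes \<alpha> K \<epsilon> :: real
  assumes \<alpha>: "1 < \<alpha>" and K: "1 \<le> K" and \<epsilon>: "0 < \<epsilon>" "\<epsilon> < 1"
  shows "\<exists>n\<ge>1. K * (real n + 1) powr (1 - \<alpha>) \<le> \<epsilon> \<and>
    real n \<le> 2 * K powr (1 / (\<alpha> - 1)) * \<epsilon> powr (- 1 / (\<alpha> - 1))"
proof -
  let ?e = "1 / (\<alpha> - 1)"
  define y where "y = (K / \<epsilon>) powr ?e"
  have e0: "0 < ?e" using \<alpha> by simp
  have "1 \<le> K / \<epsilon>" using K \<epsilon> by simp
  then have y1: "1 \<le> y" unfolding y_def using e0 by (intro ge_one_powr_ge_zero) auto
  have y_split: "y = K powr ?e * \<epsilon> powr (- 1 / (\<alpha> - 1))"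
    using K \<epsilon> by (simp add: y_def powr_divide powr_minus_divide)
  define n where "n = nat \<lceil>y\<rceil>"
  have n: "y \<le> real n" "real n \<le> y + 1" unfolding n_def using y1 by linarith+
  have "(real n + 1) powr (1 - \<alpha>) \<le> y powr (1 - \<alpha>)"
    using n y1 \<alpha> by (intro powr_mono2') auto
  also have "\<dots> = (K / \<epsilon>) powr (- 1)"
  proof -
    have "?e * (1 - \<alpha>) = - 1" using \<alpha> by (simp add: field_simps)
    then show ?thesis unfolding y_def powr_powr by simp
  qed
  also have "\<dots> = \<epsilon> / K" using K \<epsilon> by (simp add: powr_minus_divide)
  finally have "K * (real n + 1) powr (1 - \<alpha>) \<le> K * (\<epsilon> / K)" using K by (intro mult_left_mono) auto
  then have "K * (real n + 1) powr (1 - \<alpha>) \<le> \<epsilon>" using K by simp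
  moreover have "real n \<le> 2 * K powr ?e * \<epsilon> powr (- 1 / (\<alpha> - 1))" using n y1 y_split by linarith
  moreover have "n \<ge> 1" using n(1) y1 by linarith
  ultimately show ?thesis by blast
qed

text \<open>As \<epsilon> < 1/2 keeps ln (1 / \<epsilon>) above ln 2, the additive constants from
  \<open>K\<close> and from rounding up are absorbed as multiples of it.\<close>

lemma geometric_step_count:
  fixes \<kappa> K \<epsilon> :: real
  assumes \<kappa>: "0 < \<kappa>" "\<kappa> < 1" and K: "1 \<le> K" and \<epsilon>: "0 < \<epsilon>" "\<epsilon> < 1 / 2"
  shows "\<exists>n\<ge>1. K * \<kappa> ^ n \<le> \<epsilon> \<and>
    real n \<le> ((ln K / ln 2 + 1) / ln (1 / \<kappa>) + 1 / ln 2) * ln (1 / \<epsilon>)"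
proof -
  have l\<kappa>: "0 < ln (1 / \<kappa>)" using \<kappa> by simp
  have l2: "0 < ln (2 :: real)" by simp
  have "ln 2 \<le> ln (1 / \<epsilon>)" using \<epsilon> by (subst ln_le_cancel_iff) (auto simp: field_simps)
  then have ratio: "1 \<le> ln (1 / \<epsilon>) / ln 2" by simp
  have lK: "0 \<le> ln K" using K by simp
  define y where "y = ln (K / \<epsilon>) / ln (1 / \<kappa>)"
  have ln_split: "ln (K / \<epsilon>) = ln K + ln (1 / \<epsilon>)" using K \<epsilon> by (simp add: ln_div)
  have "0 < ln (1 / \<epsilon>)" using \<epsilon> by (intro ln_gt_zero) auto
  then have y0: "0 < y" unfolding y_def ln_split using lK l\<kappa> by (intro divide_pos_pos) auto
  define n where "n = nat \<lceil>y\<rceil>"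
  have n: "y \<le> real n" "real n \<le> y + 1" unfolding n_def using y0 by linarith+
  have n1: "n \<ge> 1" using n(1) y0 by (cases n) auto
  have "ln (K / \<epsilon>) \<le> real n * ln (1 / \<kappa>)" using n(1) l\<kappa> by (simp add: y_def divide_le_eq)
  then have "ln (K / \<epsilon>) \<le> ln ((1 / \<kappa>) ^ n)" using \<kappa> by (subst ln_realpow) auto
  then have "K / \<epsilon> \<le> (1 / \<kappa>) ^ n" using K \<epsilon> \<kappa> by (subst (asm) ln_le_cancel_iff) auto
  then have "K * \<kappa> ^ n \<le> \<epsilon>" using \<kappa> \<epsilon> by (simp add: power_one_over field_simps)
  moreover have "real n \<le> ((ln K / ln 2 + 1) / ln (1 / \<kappa>) + 1 / ln 2) * ln (1 / \<epsilon>)"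
  proof -
    have "ln K * 1 \<le> ln K * (ln (1 / \<epsilon>) / ln 2)" using lK ratio by (intro mult_left_mono)
    then have "ln (K / \<epsilon>) \<le> (ln K / ln 2 + 1) * ln (1 / \<epsilon>)" unfolding ln_split by (simp add: algebra_simps)
    then have "y \<le> (ln K / ln 2 + 1) * ln (1 / \<epsilon>) / ln (1 / \<kappa>)"
      unfolding y_def using l\<kappa> by (intro divide_right_mono) auto
    then have "real n \<le> (ln K / ln 2 + 1) * ln (1 / \<epsilon>) / ln (1 / \<kappa>) + ln (1 / \<epsilon>) / ln 2"
      using n(2) ratio by linarith
    then show ?thesis by (simp add: algebra_simps add_divide_distrib)
  qed
  ultimately show ?thesis using n1 by blast
qed

lemma compact_supp_windowed:
  assumes "windowed p lm lp f"
  shows "compact (supp p f)"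
proof -
  have "{x. f x \<noteq> 0\<^sub>v p} \<subseteq> {real_of_int lm..real_of_int lp}"
    using windowed_zero[OF assms] by (auto simp: not_le[symmetric]) (meson linear)+
  then have "supp p f \<subseteq> {real_of_int lm..real_of_int lp}"
    unfolding supp_def by (intro closure_minimal) auto
  then have "supp p f = {real_of_int lm..real_of_int lp} \<inter> supp p f" by blast
  moreover have "compact ({real_of_int lm..real_of_int lp} \<inter> supp p f)"
    unfolding supp_def by (intro compact_Int_closed compact_Icc closed_closure)
  ultimately show ?thesis by simp
qed

theorem theorem2p2:
  fixes p r :: nat
    and J :: "int set"
    and A :: "nat \<Rightarrow> int \<Rightarrow> real Matrix.mat"
    and g :: "real \<Rightarrow> real Matrix.vec"
    and lm lp :: int
    and P U :: "nat \<Rightarrow> real Matrix.mat"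
    and \<gamma> \<Gamma> :: real
  defines "D \<equiv> p * nat (lp - lm)"
    and "F \<equiv> cascade p J A g"
    and "\<rho> \<equiv> chrono_radius (p * nat (lp - lm) - r)
                (\<lambda>k e. transpose_mat (U k) * transition p J A lm lp k e * U (Suc k))"
    and "\<delta> \<equiv> defect p J A g lm lp P U"
    and "\<Lambda> \<equiv> max 1 (2 * (SUP k\<in>{1..}. \<Sum>j\<in>J. mat_norm2 (A k j)))"
  assumes p: "p \<ge> 1"
    and J: "finite J"
    and A_carrier: "\<And>k j. k \<ge> 1 \<Longrightarrow> j \<in> J \<Longrightarrow> A k j \<in> carrier_mat p p"
    and A_bounded: "\<exists>B. \<forall>k\<ge>1. \<forall>j\<in>J. mat_norm2 (A k j) \<le> B"
    and g_carrier: "\<And>x. g x \<in> carrier_vec p"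
    and g_cont: "continuous_vec p g"
    and g_supp: "compact (supp p g)"
    and window: "window p J g lm lp"
    and r: "1 \<le> r" "r < D"
    and P_carrier: "\<And>k. k \<ge> 1 \<Longrightarrow> P k \<in> carrier_mat r D"
    and P_rank: "\<And>k. k \<ge> 1 \<Longrightarrow> vec_space.rank r (P k) = r"
    and \<gamma>: "\<gamma> > 0" "\<And>k. k \<ge> 1 \<Longrightarrow> sigma_min (P k) \<ge> \<gamma>"
    and \<Gamma>: "\<And>k. k \<ge> 1 \<Longrightarrow> mat_norm2 (P k) \<le> \<Gamma>"
    and U_carrier: "\<And>k. k \<ge> 1 \<Longrightarrow> U k \<in> carrier_mat D (D - r)"
    and U_basis: "\<And>k. k \<ge> 1 \<Longrightarrow> orthonormal_kernel_basis (P k) (U k)"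
    and radius: "\<rho> < 1"
    and defect: "summable (\<lambda>k. \<delta> (Suc k))"
  shows "\<exists>\<Phi> :: real \<Rightarrow> real Matrix.vec.
    (\<forall>x. \<Phi> x \<in> carrier_vec p) \<and> compact (supp p \<Phi>) \<and>
    uniformly_converges p F \<Phi> \<and>
    (\<forall>q. \<rho> < q \<and> q < 1 \<longrightarrow>
      (\<exists>Cq. \<forall>n\<ge>1. sup_norm p (\<lambda>x. F n x - \<Phi> x)
         \<le> ereal (Cq * (q ^ n + (\<Sum>j=1..n. \<delta> j * q ^ (n - j)) + (\<Sum>j. \<delta> (n + 1 + j)))))) \<and>
    (\<forall>\<alpha> c. \<alpha> > 1 \<and> (\<forall>k\<ge>1. \<delta> k \<le> c * (real k + 1) powr (- \<alpha>)) \<longrightarrow>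
      (\<exists>K. \<forall>n\<ge>1. sup_norm p (\<lambda>x. F n x - \<Phi> x) \<le> ereal (K * (real n + 1) powr (1 - \<alpha>))) \<and>
      (cpwl p g \<longrightarrow>
        (\<exists>W C. \<forall>\<epsilon>. 0 < \<epsilon> \<and> \<epsilon> < 1/2 \<longrightarrow>
          (\<exists>n\<ge>1. relu_realizable p W (C * \<epsilon> powr (- 1 / (\<alpha> - 1))) (F n) \<and>
                 sup_norm p (\<lambda>x. F n x - \<Phi> x) \<le> ereal \<epsilon>)))) \<and>
    (\<forall>\<theta> c \<kappa>. 0 < \<theta> \<and> \<theta> < 1 \<and> (\<forall>k\<ge>1. \<delta> k \<le> c * \<theta> ^ k) \<and> max \<rho> \<theta> < \<kappa> \<and> \<kappa> < 1 \<longrightarrow>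
      (\<exists>K. \<forall>n\<ge>1. sup_norm p (\<lambda>x. F n x - \<Phi> x) \<le> ereal (K * \<kappa> ^ n)) \<and>
      holder_continuous (ln (1 / \<kappa>) / ln (\<Lambda> / \<kappa>)) \<Phi> \<and>
      (cpwl p g \<longrightarrow>
        (\<exists>W C C'. (\<forall>n\<ge>1. relu_realizable p W (C * real n) (F n)) \<and>
          (\<forall>\<epsilon>. 0 < \<epsilon> \<and> \<epsilon> < 1/2 \<longrightarrow>
            (\<exists>n\<ge>1. relu_realizable p W (min (C * real n) (C' * ln (1 / \<epsilon>))) (F n) \<and>
                   sup_norm p (\<lambda>x. F n x - \<Phi> x) \<le> ereal \<epsilon>)))))"
proof -
  obtain B where B: "\<forall>k\<ge>1. \<forall>j\<in>J. mat_norm2 (A k j) \<le> B" using A_bounded by blast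
  have win: "lm < lp" "J \<subseteq> {lm..lp}" using window by (auto simp: window_def)
  have g: "windowed p lm lp g" by (rule window_imp_windowed[OF window g_carrier])
  interpret M: matched_cascade p J A lm lp g r P U \<gamma> \<Gamma> B
    using p J A_carrier win g g_cont r P_carrier \<gamma> \<Gamma> U_carrier U_basis B
    unfolding D_def by unfold_locales auto
  have sm: "summable (\<lambda>k. M.\<delta> (Suc k))" using defect by (simp add: \<delta>_def)
  have rad: "M.\<rho> < 1" using radius by (simp add: \<rho>_def)
  have \<rho>0: "0 \<le> M.\<rho>" by (rule chrono_radius_decay(1)[OF M.Cm_family M.Cm_bounded rad])
  have \<delta>0: "0 \<le> M.\<delta> j" if "j \<ge> 1" for j by (rule M.defect_nonneg[OF that])
  obtain \<Phi> where \<Phi>: "windowed p lm lp \<Phi>" "uniformly_converges p (cascade p J A g) \<Phi>"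
    and rate: "\<And>q. M.\<rho> < q \<Longrightarrow> q < 1 \<Longrightarrow> \<exists>C\<ge>0. \<forall>n x. \<forall>c<p. \<bar>cascade p J A g n x $ c - \<Phi> x $ c\<bar> \<le>
        C * (discounted_sum q M.\<delta> n + defect_tail M.\<delta> n)"
    using M.cascade_limit[OF sm rad] by blast
  have err: "sup_norm p (\<lambda>x. F n x - \<Phi> x) \<le> ereal b"
    if "\<And>x c. c < p \<Longrightarrow> \<bar>cascade p J A g n x $ c - \<Phi> x $ c\<bar> \<le> b" for n b
  proof (rule sup_norm_le[OF p])
    fix x c assume c: "c < p"
    then show "\<bar>(F n x - \<Phi> x) $ c\<bar> \<le> b" using that[OF c, of x] windowed_carrier[OF \<Phi>(1), of x] by (simp add: F_def)
  qed
  have nets: "\<exists>W C. 0 \<le> C \<and> (\<forall>n\<ge>1. relu_realizable p W (C * real n) (F n))" if cp: "cpwl p g"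
  proof -
    \<comment> \<open>The window is enlarged by one cell on the left, the room that
      \<open>cascade_realizable\<close> asks for. The iterates themselves do not depend on the
      window.\<close>
    interpret E: cascade_window p J A "lm - 1" lp
      using p J A_carrier win by unfold_locales auto
    have "windowed p (lm - 1 + 1) lp g" using g by simp
    from E.cascade_realizable[OF B this cp]
    obtain W C where WC: "\<forall>n\<ge>1. relu_realizable p W (C * real n) (cascade p J A g n)" by (elim exE)
    have "relu_realizable p W (\<bar>C\<bar> * real n) (F n)" if "n \<ge> 1" for n
    proof (rule relu_realizable_mono)
      show "relu_realizable p W (C * real n) (F n)" unfolding F_def using WC that by blast
      show "C * real n \<le> \<bar>C\<bar> * real n" by (intro mult_right_mono) auto
    qed
    then show ?thesis by (intro exI[of _ W] exI[of _ "\<bar>C\<bar>"]) auto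
  qed
  have \<Lambda>: "2 * (\<Sum>j\<in>J. mat_norm2 (A k j)) \<le> \<Lambda>" if "k \<ge> 1" for k
  proof -
    have "(\<Sum>j\<in>J. mat_norm2 (A k j)) \<le> (\<Sum>j\<in>J. B)" if "k \<ge> 1" for k using B that by (intro sum_mono) auto
    then have "bdd_above ((\<lambda>k. \<Sum>j\<in>J. mat_norm2 (A k j)) ` {1..})" by (intro bdd_aboveI2) auto
    then have "(\<Sum>j\<in>J. mat_norm2 (A k j)) \<le> (SUP k\<in>{1..}. \<Sum>j\<in>J. mat_norm2 (A k j))"
      using that by (intro cSUP_upper) auto
    then show ?thesis by (simp add: \<Lambda>_def)
  qed
  have \<Lambda>1: "1 \<le> \<Lambda>" by (simp add: \<Lambda>_def)
  show ?thesis
  proof (intro exI[of _ \<Phi>] conjI allI impI)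
    show "\<Phi> x \<in> carrier_vec p" for x by (rule windowed_carrier[OF \<Phi>(1)])
    show "compact (supp p \<Phi>)" by (rule compact_supp_windowed[OF \<Phi>(1)])
    show "uniformly_converges p F \<Phi>" using \<Phi>(2) by (simp add: F_def)
  next
    fix q assume q: "\<rho> < q \<and> q < 1"
    then obtain C where C: "\<forall>n x. \<forall>c<p. \<bar>cascade p J A g n x $ c - \<Phi> x $ c\<bar> \<le>
        C * (discounted_sum q M.\<delta> n + defect_tail M.\<delta> n)"
      using rate[of q] by (auto simp: \<rho>_def)
    have "\<bar>cascade p J A g n x $ c - \<Phi> x $ c\<bar> \<le>
        C * (q ^ n + (\<Sum>j=1..n. \<delta> j * q ^ (n - j)) + (\<Sum>j. \<delta> (n + 1 + j)))" if "c < p" for n x c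
      using C that unfolding \<delta>_def discounted_sum_def defect_tail_def by blast
    from err[OF this] show "\<exists>Cq. \<forall>n\<ge>1. sup_norm p (\<lambda>x. F n x - \<Phi> x) \<le>
        ereal (Cq * (q ^ n + (\<Sum>j=1..n. \<delta> j * q ^ (n - j)) + (\<Sum>j. \<delta> (n + 1 + j))))" by blast
  next
    fix \<alpha> c assume a: "\<alpha> > 1 \<and> (\<forall>k\<ge>1. \<delta> k \<le> c * (real k + 1) powr (- \<alpha>))"
    \<comment> \<open>Any rate between \<rho> and 1 serves here; the midpoint is moreover
      positive.\<close>
    define q where "q = (1 + M.\<rho>) / 2"
    have q: "M.\<rho> < q" "q < 1" "0 < q" using rad \<rho>0 by (auto simp: q_def)
    obtain C where C: "C \<ge> 0" "\<forall>n x. \<forall>c<p. \<bar>cascade p J A g n x $ c - \<Phi> x $ c\<bar> \<le>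
        C * (discounted_sum q M.\<delta> n + defect_tail M.\<delta> n)" using rate[OF q(1,2)] by blast
    obtain K0 where K0: "K0 \<ge> 0"
      "\<And>n. discounted_sum q M.\<delta> n + defect_tail M.\<delta> n \<le> K0 * (real n + 1) powr (1 - \<alpha>)"
      using polynomial_rate[OF sm \<delta>0, of \<alpha> c q] a q unfolding \<delta>_def by blast
    \<comment> \<open>The value 1 is enforced for the step count, which divides by \<epsilon> and
      expects K >= 1.\<close>
    define K where "K = max 1 (C * K0)"
    have bound: "\<bar>cascade p J A g n x $ c - \<Phi> x $ c\<bar> \<le> K * (real n + 1) powr (1 - \<alpha>)" if "c < p" for n x c
    proof -
      have "\<bar>cascade p J A g n x $ c - \<Phi> x $ c\<bar> \<le> C * (discounted_sum q M.\<delta> n + defect_tail M.\<delta> n)"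
        using C(2) that by blast
      also have "\<dots> \<le> C * (K0 * (real n + 1) powr (1 - \<alpha>))" using C(1) K0(2) by (intro mult_left_mono)
      also have "\<dots> \<le> K * (real n + 1) powr (1 - \<alpha>)"
        unfolding mult.assoc[symmetric] by (intro mult_right_mono) (auto simp: K_def)
      finally show ?thesis .
    qed
    show "\<exists>K. \<forall>n\<ge>1. sup_norm p (\<lambda>x. F n x - \<Phi> x) \<le> ereal (K * (real n + 1) powr (1 - \<alpha>))"
      by (intro exI[of _ K] allI impI err bound)
    assume "cpwl p g"
    from nets[OF this] obtain W C1 where WC: "0 \<le> C1" "\<forall>n\<ge>1. relu_realizable p W (C1 * real n) (F n)" by blast
    show "\<exists>W C. \<forall>\<epsilon>. 0 < \<epsilon> \<and> \<epsilon> < 1/2 \<longrightarrow>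
        (\<exists>n\<ge>1. relu_realizable p W (C * \<epsilon> powr (- 1 / (\<alpha> - 1))) (F n) \<and>
          sup_norm p (\<lambda>x. F n x - \<Phi> x) \<le> ereal \<epsilon>)"
    proof (rule exI[of _ W], rule exI[of _ "C1 * (2 * K powr (1 / (\<alpha> - 1)))"], intro allI impI)
      fix \<epsilon> :: real assume \<epsilon>: "0 < \<epsilon> \<and> \<epsilon> < 1/2"
      then obtain n where n: "n \<ge> 1" "K * (real n + 1) powr (1 - \<alpha>) \<le> \<epsilon>"
        "real n \<le> 2 * K powr (1 / (\<alpha> - 1)) * \<epsilon> powr (- 1 / (\<alpha> - 1))"
        using polynomial_step_count[of \<alpha> K \<epsilon>] a by (auto simp: K_def)
      have "relu_realizable p W (C1 * (2 * K powr (1 / (\<alpha> - 1))) * \<epsilon> powr (- 1 / (\<alpha> - 1))) (F n)"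
      proof (rule relu_realizable_mono)
        show "relu_realizable p W (C1 * real n) (F n)" using WC(2) n(1) by blast
        show "C1 * real n \<le> C1 * (2 * K powr (1 / (\<alpha> - 1))) * \<epsilon> powr (- 1 / (\<alpha> - 1))"
          unfolding mult.assoc[of C1] using WC(1) n(3) by (intro mult_left_mono)
      qed
      moreover have "sup_norm p (\<lambda>x. F n x - \<Phi> x) \<le> ereal \<epsilon>"
        using bound[of _ n] n(2) by (intro err) (rule order_trans)
      ultimately show "\<exists>n\<ge>1. relu_realizable p W (C1 * (2 * K powr (1 / (\<alpha> - 1))) * \<epsilon> powr (- 1 / (\<alpha> - 1))) (F n) \<and>
          sup_norm p (\<lambda>x. F n x - \<Phi> x) \<le> ereal \<epsilon>" using n(1) by blast
    qed
  next
    fix \<theta> c \<kappa>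
    assume b: "0 < \<theta> \<and> \<theta> < 1 \<and> (\<forall>k\<ge>1. \<delta> k \<le> c * \<theta> ^ k) \<and> max \<rho> \<theta> < \<kappa> \<and> \<kappa> < 1"
    then have \<kappa>: "M.\<rho> < \<kappa>" "\<kappa> < 1" "\<theta> < \<kappa>" "0 < \<kappa>" by (auto simp: \<rho>_def)
    obtain C where C: "C \<ge> 0" "\<forall>n x. \<forall>c<p. \<bar>cascade p J A g n x $ c - \<Phi> x $ c\<bar> \<le>
        C * (discounted_sum \<kappa> M.\<delta> n + defect_tail M.\<delta> n)" using rate[OF \<kappa>(1,2)] by blast
    obtain K0 where K0: "K0 \<ge> 0" "\<And>n. discounted_sum \<kappa> M.\<delta> n + defect_tail M.\<delta> n \<le> K0 * \<kappa> ^ n"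
      using geometric_rate[OF sm, of \<theta> c \<kappa>] b \<kappa> unfolding \<delta>_def by blast
    define K where "K = max 1 (C * K0)"
    have bound: "\<bar>cascade p J A g n x $ c - \<Phi> x $ c\<bar> \<le> K * \<kappa> ^ n" if "c < p" for n x c
    proof -
      have "\<bar>cascade p J A g n x $ c - \<Phi> x $ c\<bar> \<le> C * (discounted_sum \<kappa> M.\<delta> n + defect_tail M.\<delta> n)"
        using C(2) that by blast
      also have "\<dots> \<le> C * (K0 * \<kappa> ^ n)" using C(1) K0(2) by (intro mult_left_mono)
      also have "\<dots> \<le> K * \<kappa> ^ n"
        unfolding mult.assoc[symmetric] using \<kappa>(4) by (intro mult_right_mono) (auto simp: K_def)
      finally show ?thesis .
    qed
    show "\<exists>K. \<forall>n\<ge>1. sup_norm p (\<lambda>x. F n x - \<Phi> x) \<le> ereal (K * \<kappa> ^ n)"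
      by (intro exI[of _ K] allI impI err bound)
    show "holder_continuous (ln (1 / \<kappa>) / ln (\<Lambda> / \<kappa>)) \<Phi>"
      by (rule M.limit_holder_continuous[OF sm \<kappa>(1,2) K0(2,1) \<Phi>(1) bound _ \<Lambda> \<Lambda>1]) (auto simp: K_def)
    assume "cpwl p g"
    from nets[OF this] obtain W C1 where WC: "0 \<le> C1" "\<forall>n\<ge>1. relu_realizable p W (C1 * real n) (F n)" by blast
    let ?C' = "C1 * ((ln K / ln 2 + 1) / ln (1 / \<kappa>) + 1 / ln 2)"
    show "\<exists>W C C'. (\<forall>n\<ge>1. relu_realizable p W (C * real n) (F n)) \<and>
        (\<forall>\<epsilon>. 0 < \<epsilon> \<and> \<epsilon> < 1/2 \<longrightarrow>
          (\<exists>n\<ge>1. relu_realizable p W (min (C * real n) (C' * ln (1 / \<epsilon>))) (F n) \<and>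
            sup_norm p (\<lambda>x. F n x - \<Phi> x) \<le> ereal \<epsilon>))"
    proof (rule exI[of _ W], rule exI[of _ C1], rule exI[of _ ?C'], intro conjI allI impI)
      show "relu_realizable p W (C1 * real n) (F n)" if "n \<ge> 1" for n using WC(2) that by blast
      fix \<epsilon> :: real assume \<epsilon>: "0 < \<epsilon> \<and> \<epsilon> < 1/2"
      then obtain n where n: "n \<ge> 1" "K * \<kappa> ^ n \<le> \<epsilon>"
        "real n \<le> ((ln K / ln 2 + 1) / ln (1 / \<kappa>) + 1 / ln 2) * ln (1 / \<epsilon>)"
        using geometric_step_count[of \<kappa> K \<epsilon>] \<kappa> by (auto simp: K_def)
      have "C1 * real n \<le> ?C' * ln (1 / \<epsilon>)"
        unfolding mult.assoc[of C1] using WC(1) n(3) by (intro mult_left_mono)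
      then have "min (C1 * real n) (?C' * ln (1 / \<epsilon>)) = C1 * real n" by simp
      moreover have "sup_norm p (\<lambda>x. F n x - \<Phi> x) \<le> ereal \<epsilon>"
        using bound[of _ n] n(2) by (intro err) (rule order_trans)
      ultimately show "\<exists>n\<ge>1. relu_realizable p W (min (C1 * real n) (?C' * ln (1 / \<epsilon>))) (F n) \<and>
          sup_norm p (\<lambda>x. F n x - \<Phi> x) \<le> ereal \<epsilon>" using WC(2) n(1) by auto
    qed
  qed
qed

end
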